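(* Let $n\ge1$ and $i\in\{1,2,\ldots,n\}$. The set $\mathcal{B}_i=\mathcal{B}_{i,\psi}^-\cap\langle\mathcal{Y}_i(z)\rangle$ forms a basis for the space $\langle\mathcal{Y}_i(z)\rangle$ over $\mathbb{C}(q^{1/2})$.
   Context: **Notation.** $n\ge1$ is an integer, $q$ an indeterminate, $F=\mathbb{C}(q^{1/2})$, $[m]=\frac{q^m-q^{-m}}{q-q^{-1}}$. $(a_{ij})_{i,j=1}^n$ is the Cartan matrix of type $A_n$; $\alpha_1,\ldots,\alpha_n$ and $\lambda_1,\ldots,\lambda_n$ are the simple roots and fundamental weights of $\mathfrak{sl}_{n+1}$; $Q=\bigoplus\mathbb{Z}\alpha_i\subset P=\bigoplus\mathbb{Z}\lambda_i$; $(\cdot,\cdot)$ is the symmetric bilinear form with $(\alpha_i,\alpha_j)=a_{ij}$, $(\lambda_i,\alpha_j)=\delta_{ij}$. **The space $V$.** $K(1)$ is the symmetric algebra over $F$ on the symbols $a_i(-r)$, $1\le i\le n$, $r\in\mathbb{Z}_{>0}$; $a_i(-r)$ acts by multiplication and $a_i(r)$, $r>0$, acts as the derivation annihilating $1$ such that $[a_i(r),a_j(s)]=\delta_{r+s,0}\frac{[a_{ij}r][r]}{r}$ for all $r,s\in\mathbb{Z}\setminus\{0\}$. $\mathbb{C}\{P\}$ is the (twisted group) algebra, with scalars in $F$, generated by the invertible elements $e^{\alpha_2},\ldots,e^{\alpha_n},e^{\lambda_n}$ with relations $e^{\alpha_i}e^{\alpha_j}=(-1)^{(\alpha_i,\alpha_j)}e^{\alpha_j}e^{\alpha_i}$,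 $e^{\alpha_i}e^{\lambda_n}=(-1)^{\delta_{in}}e^{\lambda_n}e^{\alpha_i}$ ($2\le i,j\le n$). For $\alpha=m_2\alpha_2+\cdots+m_n\alpha_n+m_{n+1}\lambda_n\in P$ put $e^\alpha=(e^{\alpha_2})^{m_2}\cdots(e^{\alpha_n})^{m_n}(e^{\lambda_n})^{m_{n+1}}$. Let $V=K(1)\otimes\mathbb{C}\{P\}$, $1=1\otimes e^0\in V$. The $e^\alpha$ act by left multiplication on $\mathbb{C}\{P\}$; $z^{\partial_\alpha}e^\beta=z^{(\alpha,\beta)}e^\beta$; $(-1)^{m\partial_\alpha}e^\beta=(-1)^{m(\alpha,\beta)}e^\beta$ with $(-1)^s=e^{\pi\sqrt{-1}s}$; $K_j^{\pm1}$ acts by $K_j^{\pm1}(v\otimes e^\beta)=q^{\pm(\alpha_j,\beta)}v\otimes e^\beta$. **Operators.** For $j=1,\ldots,n$: $$x_j^\pm(z)=\exp\Big(\pm\sum_{r\ge1}\tfrac{q^{\mp r/2}}{[r]}a_j(-r)z^r\Big)\exp\Big(\mp\sum_{r\ge1}\tfrac{q^{\mp r/2}}{[r]}a_j(r)z^{-r}\Big)\otimes e^{\pm\alpha_j}z^{\pm\partial_{\alpha_j}},$$ $$\psi_j(z)=K_j\exp\Big((q-q^{-1})\sum_{r\ge1}a_j(r)z^{-r}\Big),\qquad \phi_j(z)=K_j^{-1}\exp\Big(-(q-q^{-1})\sum_{r\ge1}a_j(-r)z^{r}\Big),$$ elements of $\mathrm{Hom}(V,V((z)))$. For $l\ne0$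 let $a_i^*(l)=\sum_{j=1}^n m_i^{(j)}a_j(l)$ with $m_i^{(j)}=\frac{[jl][(n-i+1)l]}{[(n+1)l][l]}$ if $j\le i$ and $m_i^{(j)}=\frac{[il][(n-j+1)l]}{[(n+1)l][l]}$ if $j>i$. For $i=1,\ldots,n$, $$\mathcal{Y}_i(z)=\exp\Big(\sum_{r\ge1}\tfrac{q^{r/2}}{[r]}a_i^*(-r)z^r\Big)\exp\Big(-\sum_{r\ge1}\tfrac{q^{r/2}}{[r]}a_i^*(r)z^{-r}\Big)\otimes e^{\lambda_i}(-1)^{(1-\delta_{in})i\,\partial_{\lambda_n}}z^{\partial_{\lambda_i}}\in\mathrm{Hom}(V,V((z^{1/(n+1)}))).$$ **Products.** A pair $(a(z),b(z))$, $a(z)\in\mathrm{Hom}(V,V((z)))$, $b(z)\in\mathrm{Hom}(V,V((z^{1/(n+1)})))$, is quasi compatible if there is a nonzero polynomial $p(z_1,z_2)\in F[z_1,z_2]$ with $p(z_1,z_2)a(z_1)b(z_2)\in\mathrm{Hom}(V,V((z_1,z_2^{1/(n+1)})))$. For such a pair, the products $a(z)_rb(z)$, $r\in\mathbb{Z}$, are defined by $$\sum_{r\in\mathbb{Z}}(a(z)_rb(z))z_0^{-r-1}=\iota_{z,z_0}\big(p(z_0+z,z)^{-1}\big)\,\big(p(z_1,z)a(z_1)b(z)\big)\big|_{z_1=z+z_0},$$ where $\iota_{z,z_0}$ expands in $F((z))((z_0))$ (i.e. in nonnegative powers of $z_0$ up to a finite pole), and $z_1=z+z_0$ is likewise expanded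 in nonnegative powers of $z_0$; this is independent of $p$. For $c(z)\in\mathrm{Hom}(V,V((z^{1/(n+1)})))$ write $\mathrm{wt}\,c(z)=\alpha\in P$ if $c(z)1=d(z)\otimes e^\alpha$ for some $d(z)\in K(1)((z^{1/(n+1)}))$; e.g. $\mathrm{wt}\,x_j^\pm(z)=\pm\alpha_j$, $\mathrm{wt}\,\psi_j(z)=\mathrm{wt}\,\phi_j(z)=0$, $\mathrm{wt}\,\mathcal{Y}_i(z)=\lambda_i$. For a quasi compatible pair define $$a(z)_\bullet b(z)=\sum_{t\in\frac12\mathbb{Z}}\Big(\frac{1}{zq^t}\Big)^{(\mathrm{wt}\,a(z),\mathrm{wt}\,b(z))+1}q^t\,a(zq^t)_0b(z)$$ (a finite sum; $a(zq^t)_0b(z)$ is the zeroth product of the operators $a(zq^t)$ and $b(z)$), extended linearly in $b(z)$ to sums of operators with different weights. Iterated products are nested from the right: $a_1(z)_\bullet a_2(z)_\bullet b(z)=a_1(z)_\bullet(a_2(z)_\bullet b(z))$. **The space $\langle\mathcal{Y}_i(z)\rangle$.** It is the $F$-span of all $a_1(z)_\bullet\cdots{}_\bullet a_k(z)_\bullet\mathcal{Y}_i(z)$ with $k\ge0$ and each $a_s(z)\in\{x_j^\pm(z),\psi_j(z),\phi_j(z):j=1,\ldots,n\}$. **The sets $\mathcal{B}_i^-$, $\mathcal{B}_{i,\psi}^-$.** $\mathcal{B}_i^-$ is the set of all nonzero elements $x_{j_k}^-(z)_\bullet\cdots{}_\bullet x_{j_1}^-(z)_\bullet\mathcal{Y}_i(z)$,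 $k\ge0$, $j_s\in\{1,\ldots,n\}$. $\mathcal{B}_{i,\psi}^-$ is the set of all operators (ordinary compositions) $b^-(z)\psi_{j_1}(zq^{t_1})\cdots\psi_{j_k}(zq^{t_k})$, where $b^-(z)\in\mathcal{B}_i^-$, $k\ge0$, $1\le j_1\le\cdots\le j_k\le n$, $t_s\in\frac12\mathbb{Z}$, and $t_s\le t_r$ whenever $s\le r$ and $j_s=j_r$. *)

theory Defs
  imports
    Complex_Main
    "HOL-Library.Poly_Mapping"
    "HOL-Library.Function_Algebras"
    "HOL-Computational_Algebra.Computational_Algebra"
begin

section \<open>The ground field\<close>

text \<open>The field \<open>\<complex>(q\<^sup>1\<^sup>/\<^sup>2)\<close> of rational functions; the polynomial indeterminate is
  \<open>q\<^sup>1\<^sup>/\<^sup>2\<close>.\<close>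

type_synonym scal = "complex poly fract"

definition cst :: "complex \<Rightarrow> scal" where
  "cst c = to_fract [:c:]"

definition qhalf :: scal where
  "qhalf = to_fract [:0, 1:]"

text \<open>\<open>qpow t\<close> is \<open>q\<^sup>t\<close>; it is only meaningful, and only used, for \<open>2 * t \<in> \<int>\<close>.\<close>

definition qpow :: "rat \<Rightarrow> scal" where
  "qpow t = qhalf powi \<lfloor>2 * t\<rfloor>"

definition qint :: "int \<Rightarrow> scal" where
  "qint m = (qpow (of_int m) - qpow (- of_int m)) / (qpow 1 - qpow (- 1))"


section \<open>Weights\<close>

text \<open>A weight is given by its coordinates with respect to the fundamental weights
  \<open>\<lambda>\<^sub>1, \<dots>, \<lambda>\<^sub>n\<close>.\<close>

type_synonym weight = "nat \<Rightarrow>\<^sub>0 int"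

definition cartan :: "nat \<Rightarrow> nat \<Rightarrow> int" where
  "cartan i j = (if i = j then 2 else if i = Suc j \<or> j = Suc i then -1 else 0)"

definition Plat :: "nat \<Rightarrow> weight set" where
  "Plat n = {\<beta>. Poly_Mapping.keys \<beta> \<subseteq> {1..n}}"

definition fund :: "nat \<Rightarrow> weight" where
  "fund i = Poly_Mapping.single i 1"

definition simple_root :: "nat \<Rightarrow> nat \<Rightarrow> weight" where
  "simple_root n j = (\<Sum>l=1..n. Poly_Mapping.single l (cartan j l))"

text \<open>The Gram matrix of the fundamental weights is the inverse of the Cartan matrix; see
  the lemmas \<open>form_fund_simple_root\<close> and \<open>form_simple_root_simple_root\<close> below.\<close>

definition form :: "nat \<Rightarrow> weight \<Rightarrow> weight \<Rightarrow> rat" where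
  "form n \<beta> \<gamma> = (\<Sum>i=1..n. \<Sum>j=1..n.
     of_int (Poly_Mapping.lookup \<beta> i) * of_int (Poly_Mapping.lookup \<gamma> j)
     * (of_nat (min i j) * of_nat (Suc n - max i j) / of_nat (Suc n)))"

text \<open>The coordinates \<open>m\<^sub>2, \<dots>, m\<^sub>n\<^sub>+\<^sub>1\<close> of a weight with respect to the basis
  \<open>\<alpha>\<^sub>2, \<dots>, \<alpha>\<^sub>n, \<lambda>\<^sub>n\<close> of \<open>P\<close>; see the lemma \<open>coord_expansion\<close>.\<close>

definition coord :: "nat \<Rightarrow> weight \<Rightarrow> nat \<Rightarrow> int" where
  "coord n \<beta> k =
     (if k = Suc n then (\<Sum>i=1..n. int (Suc n - i) * Poly_Mapping.lookup \<beta> i)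
      else - (\<Sum>i=1..<k. int (k - i) * Poly_Mapping.lookup \<beta> i))"

text \<open>The generators \<open>e\<^bsup>\<alpha>\<^sub>2\<^esup>, \<dots>, e\<^bsup>\<alpha>\<^sub>n\<^esup>, e\<^bsup>\<lambda>\<^sub>n\<^esup>\<close> of \<open>\<complex>{P}\<close>, numbered \<open>2, \<dots>, n + 1\<close>, commute up to
  \<open>(-1)\<^bsup>gcomm n k l\<^esup>\<close>.\<close>

definition gcomm :: "nat \<Rightarrow> nat \<Rightarrow> nat \<Rightarrow> int" where
  "gcomm n k l =
     (if k = Suc n \<and> l = Suc n then 0
      else if k = Suc n then (if l = n then 1 else 0)
      else if l = Suc n then (if k = n then 1 else 0)
      else cartan k l)"

text \<open>Reordering the product of the ordered monomials \<open>e\<^sup>\<gamma>\<close> and \<open>e\<^sup>\<beta>\<close> in the generators yields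
  \<open>e\<^sup>\<gamma> e\<^sup>\<beta> = eps n \<gamma> \<beta> e\<^sup>\<gamma>\<^sup>+\<^sup>\<beta>\<close>: generator number \<open>k\<close> of the first factor is moved past generator
  number \<open>l < k\<close> of the second one.\<close>

definition eps :: "nat \<Rightarrow> weight \<Rightarrow> weight \<Rightarrow> scal" where
  "eps n \<gamma> \<beta> = (-1) powi (\<Sum>k=2..Suc n. \<Sum>l=2..<k. gcomm n k l * coord n \<gamma> k * coord n \<beta> l)"


section \<open>The space \<open>V\<close>\<close>

text \<open>\<open>K(1)\<close> is the algebra of polynomials in the variables \<open>a\<^sub>i(-r)\<close>; the variable \<open>a\<^sub>i(-r)\<close> has the
  index \<open>(i, r)\<close>.  An element of \<open>V = K(1) \<otimes> \<complex>{P}\<close> is the family of its coefficients in \<open>K(1)\<close> with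
  respect to the basis \<open>e\<^sup>\<beta>\<close> of \<open>\<complex>{P}\<close>, so \<open>p \<otimes> e\<^sup>\<beta>\<close> is \<open>Poly_Mapping.single \<beta> p\<close>.  The actual
  space for given \<open>n\<close> is the set \<open>Vsp n\<close>.\<close>

type_synonym fock = "((nat \<times> nat) \<Rightarrow>\<^sub>0 nat) \<Rightarrow>\<^sub>0 scal"
type_synonym vsp = "weight \<Rightarrow>\<^sub>0 fock"

definition Vsp :: "nat \<Rightarrow> vsp set" where
  "Vsp n = {v. Poly_Mapping.keys v \<subseteq> Plat n \<and>
     (\<forall>\<beta>. \<forall>\<mu>\<in>Poly_Mapping.keys (Poly_Mapping.lookup v \<beta>).
        Poly_Mapping.keys \<mu> \<subseteq> {1..n} \<times> {1..})}"

definition smK :: "scal \<Rightarrow> fock \<Rightarrow> fock" where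
  "smK c = Poly_Mapping.map ((*) c)"

definition smV :: "scal \<Rightarrow> vsp \<Rightarrow> vsp" where
  "smV c = Poly_Mapping.map (smK c)"

definition vac :: vsp where
  "vac = Poly_Mapping.single 0 1"

definition var :: "nat \<times> nat \<Rightarrow> fock" where
  "var x = Poly_Mapping.single (Poly_Mapping.single x 1) 1"

definition pdiff :: "nat \<times> nat \<Rightarrow> fock \<Rightarrow> fock" where
  "pdiff x p = (\<Sum>\<mu>\<in>Poly_Mapping.keys p.
     Poly_Mapping.single (\<mu> - Poly_Mapping.single x 1)
       (of_nat (Poly_Mapping.lookup \<mu> x) * Poly_Mapping.lookup p \<mu>))"

text \<open>The operators \<open>a\<^sub>j(l)\<close> and \<open>a\<^sub>i\<^sup>*(l)\<close>, \<open>l \<noteq> 0\<close>, on \<open>K(1)\<close>.\<close>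

definition heis :: "nat \<Rightarrow> nat \<Rightarrow> int \<Rightarrow> fock \<Rightarrow> fock" where
  "heis n j l p =
     (if l < 0 then var (j, nat (- l)) * p
      else (\<Sum>i=1..n. smK (qint (cartan j i * l) * qint l / of_int l) (pdiff (i, nat l) p)))"

definition mstar :: "nat \<Rightarrow> nat \<Rightarrow> nat \<Rightarrow> int \<Rightarrow> scal" where
  "mstar n i j l =
     (if j \<le> i
      then qint (int j * l) * qint ((int n - int i + 1) * l) / (qint ((int n + 1) * l) * qint l)
      else qint (int i * l) * qint ((int n - int j + 1) * l) / (qint ((int n + 1) * l) * qint l))"

definition heis_star :: "nat \<Rightarrow> nat \<Rightarrow> int \<Rightarrow> fock \<Rightarrow> fock" where
  "heis_star n i l p = (\<Sum>j=1..n. smK (mstar n i j l) (heis n j l p))"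


section \<open>Formal operators\<close>

text \<open>An element \<open>c\<close> of \<open>Hom(V, V((z\<^bsup>1/N\<^esup>)))\<close> is given by the coefficient \<open>c v s\<close> of \<open>z\<^sup>s\<close> in
  \<open>c(z)v\<close>.  Since \<open>V\<close> is a proper subset of the type \<open>vsp\<close>, operators are required to vanish
  outside \<open>V\<close>, so that equality in the type \<open>oper\<close> is equality of operators on \<open>V\<close>.\<close>

type_synonym oper = "vsp \<Rightarrow> rat \<Rightarrow> vsp"

definition smO :: "scal \<Rightarrow> oper \<Rightarrow> oper" where
  "smO c a = (\<lambda>v s. smV c (a v s))"

definition on_V :: "nat \<Rightarrow> oper \<Rightarrow> oper" where
  "on_V n c = (\<lambda>v. if v \<in> Vsp n then c v else 0)"

definition Hom_Laurent :: "nat \<Rightarrow> nat \<Rightarrow> oper set" where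
  "Hom_Laurent n N = {c.
     (\<forall>v. v \<notin> Vsp n \<longrightarrow> c v = 0) \<and>
     (\<forall>v\<in>Vsp n. \<forall>s. c v s \<in> Vsp n) \<and>
     (\<forall>u\<in>Vsp n. \<forall>v\<in>Vsp n. \<forall>s. c (u + v) s = c u s + c v s) \<and>
     (\<forall>k. \<forall>v\<in>Vsp n. \<forall>s. c (smV k v) s = smV k (c v s)) \<and>
     (\<forall>v\<in>Vsp n. \<forall>s. c v s \<noteq> 0 \<longrightarrow> of_nat N * s \<in> \<int>) \<and>
     (\<forall>v\<in>Vsp n. \<exists>b. \<forall>s<b. c v s = 0)}"

text \<open>Composition \<open>b(z)c(z)\<close>, used only where the coefficients are finite sums.\<close>

definition ocomp :: "oper \<Rightarrow> oper \<Rightarrow> oper" where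
  "ocomp b c = (\<lambda>v s. Sum_any (\<lambda>u. b (c v u) (s - u)))"

text \<open>\<open>c(zq\<^sup>t)\<close>, for \<open>c(z) \<in> Hom(V, V((z)))\<close> and \<open>2 * t \<in> \<int>\<close>.\<close>

definition shift :: "rat \<Rightarrow> oper \<Rightarrow> oper" where
  "shift t c = (\<lambda>v s. smV (qpow (t * s)) (c v s))"

text \<open>For \<open>A(w) = \<Sum>r\<ge>1. A r w\<^sup>r\<close> with operators \<open>A r\<close> on \<open>K(1)\<close>, the coefficients of \<open>w\<^sup>m\<close> in
  \<open>A(w)\<^sup>k\<close> and in \<open>exp A(w)\<close>.\<close>

fun ser_pow :: "(nat \<Rightarrow> fock \<Rightarrow> fock) \<Rightarrow> nat \<Rightarrow> nat \<Rightarrow> fock \<Rightarrow> fock" where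
  "ser_pow A 0 m p = (if m = 0 then p else 0)"
| "ser_pow A (Suc k) m p = (\<Sum>r=1..m. A r (ser_pow A k (m - r) p))"

definition ser_exp :: "(nat \<Rightarrow> fock \<Rightarrow> fock) \<Rightarrow> nat \<Rightarrow> fock \<Rightarrow> fock" where
  "ser_exp A m p = (\<Sum>k\<le>m. smK (1 / of_nat (fact k)) (ser_pow A k m p))"

text \<open>\<open>exp (\<Sum>r\<ge>1. A r z\<^sup>r) \<otimes> 1\<close> and \<open>exp (\<Sum>r\<ge>1. A r z\<^bsup>-r\<^esup>) \<otimes> 1\<close>\<close>

definition exp_up :: "(nat \<Rightarrow> fock \<Rightarrow> fock) \<Rightarrow> oper" where
  "exp_up A v s = (if s \<in> \<nat> then Poly_Mapping.map (ser_exp A (nat \<lfloor>s\<rfloor>)) v else 0)"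

definition exp_down :: "(nat \<Rightarrow> fock \<Rightarrow> fock) \<Rightarrow> oper" where
  "exp_down A v s = exp_up A v (- s)"

text \<open>\<open>1 \<otimes> e\<^sup>\<gamma>\<close>, \<open>1 \<otimes> z\<^bsup>\<partial>\<^sub>\<gamma>\<^esup>\<close>, \<open>1 \<otimes> (-1)\<^bsup>m\<partial>\<^sub>\<gamma>\<^esup>\<close> and \<open>K\<^sub>j\<^sup>\<sigma>\<close> (\<open>\<sigma> = 1, -1\<close>)\<close>

definition e_op :: "nat \<Rightarrow> weight \<Rightarrow> vsp \<Rightarrow> vsp" where
  "e_op n \<gamma> v = (\<Sum>\<beta>\<in>Poly_Mapping.keys v.
     Poly_Mapping.single (\<gamma> + \<beta>) (smK (eps n \<gamma> \<beta>) (Poly_Mapping.lookup v \<beta>)))"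

definition zdel :: "nat \<Rightarrow> weight \<Rightarrow> oper" where
  "zdel n \<gamma> v s = Poly_Mapping.mapp (\<lambda>\<beta> p. if form n \<gamma> \<beta> = s then p else 0) v"

definition signdel :: "nat \<Rightarrow> nat \<Rightarrow> weight \<Rightarrow> vsp \<Rightarrow> vsp" where
  "signdel n m \<gamma> v =
     Poly_Mapping.mapp (\<lambda>\<beta>. smK (cst (exp (pi * \<i> * of_rat (of_nat m * form n \<gamma> \<beta>))))) v"

definition K_op :: "nat \<Rightarrow> int \<Rightarrow> nat \<Rightarrow> vsp \<Rightarrow> vsp" where
  "K_op n \<sigma> j v = Poly_Mapping.mapp (\<lambda>\<beta>. smK (qpow (of_int \<sigma> * form n (simple_root n j) \<beta>))) v"


section \<open>The operators \<open>x\<^sub>j\<^sup>\<plusminus>(z)\<close>, \<open>\<psi>\<^sub>j(z)\<close>, \<open>\<phi>\<^sub>j(z)\<close> and \<open>\<Y>\<^sub>i(z)\<close>\<close>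

text \<open>\<open>x_op n 1 j\<close> is \<open>x\<^sub>j\<^sup>+(z)\<close> and \<open>x_op n (-1) j\<close> is \<open>x\<^sub>j\<^sup>-(z)\<close>.\<close>

definition x_op :: "nat \<Rightarrow> int \<Rightarrow> nat \<Rightarrow> oper" where
  "x_op n \<sigma> j = on_V n
     (ocomp (exp_up (\<lambda>r p. smK (of_int \<sigma> * qpow (- of_int \<sigma> * of_nat r / 2) / qint (int r))
                            (heis n j (- int r) p)))
     (ocomp (exp_down (\<lambda>r p. smK (- of_int \<sigma> * qpow (- of_int \<sigma> * of_nat r / 2) / qint (int r))
                            (heis n j (int r) p)))
       (\<lambda>v s. let \<gamma> = (if \<sigma> = 1 then simple_root n j else - simple_root n j)
              in e_op n \<gamma> (zdel n \<gamma> v s))))"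

definition psi_op :: "nat \<Rightarrow> nat \<Rightarrow> oper" where
  "psi_op n j = on_V n (\<lambda>v s. K_op n 1 j
     (exp_down (\<lambda>r p. smK (qpow 1 - qpow (- 1)) (heis n j (int r) p)) v s))"

definition phi_op :: "nat \<Rightarrow> nat \<Rightarrow> oper" where
  "phi_op n j = on_V n (\<lambda>v s. K_op n (- 1) j
     (exp_up (\<lambda>r p. smK (- (qpow 1 - qpow (- 1))) (heis n j (- int r) p)) v s))"

definition Y_op :: "nat \<Rightarrow> nat \<Rightarrow> oper" where
  "Y_op n i = on_V n
     (ocomp (exp_up (\<lambda>r p. smK (qpow (of_nat r / 2) / qint (int r)) (heis_star n i (- int r) p)))
     (ocomp (exp_down (\<lambda>r p. smK (- qpow (of_nat r / 2) / qint (int r)) (heis_star n i (int r) p)))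
       (\<lambda>v s. e_op n (fund i)
          (signdel n (if i = n then 0 else i) (fund n) (zdel n (fund i) v s)))))"

definition gens :: "nat \<Rightarrow> oper set" where
  "gens n = (\<Union>j\<in>{1..n}. {x_op n 1 j, x_op n (- 1) j, psi_op n j, phi_op n j})"


section \<open>Products\<close>

text \<open>A polynomial \<open>p(z\<^sub>1, z\<^sub>2)\<close> is an element \<open>p\<close> of \<open>scal poly poly\<close>; the coefficient of
  \<open>z\<^sub>1\<^sup>k z\<^sub>2\<^sup>l\<close> is \<open>coeff (coeff p k) l\<close>.  The coefficient of \<open>z\<^sub>1\<^bsup>s\<^esup> z\<^sub>2\<^bsup>s'\<^esup>\<close> in
  \<open>p(z\<^sub>1, z\<^sub>2)a(z\<^sub>1)b(z\<^sub>2)v\<close> is the following.\<close>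

definition pab :: "scal poly poly \<Rightarrow> oper \<Rightarrow> oper \<Rightarrow> vsp \<Rightarrow> rat \<Rightarrow> rat \<Rightarrow> vsp" where
  "pab p a b v s s' = (\<Sum>k\<le>degree p. \<Sum>l\<le>degree (coeff p k).
     smV (coeff (coeff p k) l) (a (b v (s' - of_nat l)) (s - of_nat k)))"

text \<open>\<open>p(z\<^sub>1, z\<^sub>2)a(z\<^sub>1)b(z\<^sub>2) \<in> Hom(V, V((z\<^sub>1, z\<^sub>2\<^bsup>1/(n+1)\<^esup>)))\<close>: the exponents of both variables are
  bounded below (that they lie in \<open>\<int>\<close> and \<open>\<int>/(n+1)\<close> is automatic).\<close>

definition clears :: "nat \<Rightarrow> scal poly poly \<Rightarrow> oper \<Rightarrow> oper \<Rightarrow> bool" where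
  "clears n p a b \<longleftrightarrow> p \<noteq> 0 \<and>
     (\<forall>v\<in>Vsp n. \<exists>N. \<forall>s s'. s < N \<or> s' < N \<longrightarrow> pab p a b v s s' = 0)"

definition quasi_compatible :: "nat \<Rightarrow> oper \<Rightarrow> oper \<Rightarrow> bool" where
  "quasi_compatible n a b \<longleftrightarrow>
     a \<in> Hom_Laurent n 1 \<and> b \<in> Hom_Laurent n (Suc n) \<and> (\<exists>p. clears n p a b)"

text \<open>\<open>\<iota>\<^sub>z\<^sub>,\<^sub>z\<^sub>0(p(z\<^sub>0 + z, z)\<^sup>-\<^sup>1)\<close>: the inverse in the field \<open>F((z))((z\<^sub>0))\<close>, where the outer \<open>fls_X\<close> is
  \<open>z\<^sub>0\<close> and the inner one is \<open>z\<close>.\<close>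

definition iota_inv :: "scal poly poly \<Rightarrow> scal fls fls" where
  "iota_inv p = inverse (\<Sum>k\<le>degree p. \<Sum>l\<le>degree (coeff p k).
     fls_const (fls_const (coeff (coeff p k) l) * fls_X ^ l) * (fls_X + fls_const fls_X) ^ k)"

text \<open>The coefficient of \<open>z\<^sup>s z\<^sub>0\<^sup>k\<close> in \<open>(p(z\<^sub>1, z)a(z\<^sub>1)b(z)v)|\<^bsub>z\<^sub>1 = z + z\<^sub>0\<^esub>\<close>\<close>

definition pab_subst :: "scal poly poly \<Rightarrow> oper \<Rightarrow> oper \<Rightarrow> vsp \<Rightarrow> rat \<Rightarrow> nat \<Rightarrow> vsp" where
  "pab_subst p a b v s k = Sum_any (\<lambda>m::int.
     smV (cst (of_int m gchoose k)) (pab p a b v (of_int m) (s - of_int m + of_nat k)))"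

text \<open>The products \<open>a(z)\<^sub>rb(z)\<close>.  They do not depend on the choice of \<open>p\<close>; for pairs that are not
  quasi compatible they are set to \<open>0\<close>.\<close>

definition nth_prod_with :: "scal poly poly \<Rightarrow> oper \<Rightarrow> oper \<Rightarrow> int \<Rightarrow> oper" where
  "nth_prod_with p a b r = (\<lambda>v s. Sum_any (\<lambda>(k::nat, m::int).
     smV (fls_nth (fls_nth (iota_inv p) (- r - 1 - int k)) m) (pab_subst p a b v (s - of_int m) k)))"

definition nth_prod :: "nat \<Rightarrow> oper \<Rightarrow> oper \<Rightarrow> int \<Rightarrow> oper" where
  "nth_prod n a b r =
     (if quasi_compatible n a b then on_V n (nth_prod_with (SOME p. clears n p a b) a b r) else 0)"

definition has_wt :: "nat \<Rightarrow> oper \<Rightarrow> weight \<Rightarrow> bool" where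
  "has_wt n c \<alpha> \<longleftrightarrow> \<alpha> \<in> Plat n \<and> (\<exists>d. \<forall>s. c vac s = Poly_Mapping.single \<alpha> (d s))"

definition wt :: "nat \<Rightarrow> oper \<Rightarrow> weight" where
  "wt n c = (THE \<alpha>. has_wt n c \<alpha>)"

text \<open>The weight \<open>\<beta>\<close> component of \<open>b(z)\<close>: the part mapping \<open>K(1) \<otimes> e\<^sup>\<gamma>\<close> to
  \<open>K(1)((z\<^bsup>1/(n+1)\<^esup>)) \<otimes> e\<^sup>\<beta>\<^sup>+\<^sup>\<gamma>\<close> for every \<open>\<gamma>\<close>.  It is used for the linear extension of the product
  to sums of operators of different weights.  (An operator annihilating \<open>1\<close> trivially satisfies
  \<open>has_wt n c \<alpha>\<close> for all \<open>\<alpha>\<close>, so that its weight cannot be read off from \<open>c(z)1\<close>.)\<close>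

definition wt_part :: "nat \<Rightarrow> weight \<Rightarrow> oper \<Rightarrow> oper" where
  "wt_part n \<beta> b = on_V n (\<lambda>v s. \<Sum>\<gamma>\<in>Poly_Mapping.keys v.
     Poly_Mapping.single (\<beta> + \<gamma>)
       (Poly_Mapping.lookup (b (Poly_Mapping.single \<gamma> (Poly_Mapping.lookup v \<gamma>)) s) (\<beta> + \<gamma>)))"

text \<open>The product \<open>a(z)\<^sub>\<bullet>b(z)\<close> for \<open>b(z)\<close> of weight \<open>\<beta>\<close>, and in general.  Multiplication by
  \<open>(1/(zq\<^sup>t))\<^sup>e\<close> is a shift of the exponent of \<open>z\<close> by \<open>e\<close> and multiplication by \<open>q\<^bsup>-te\<^esup>\<close>.\<close>

definition bullet_wt :: "nat \<Rightarrow> oper \<Rightarrow> weight \<Rightarrow> oper \<Rightarrow> oper" where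
  "bullet_wt n a \<beta> b = Sum_any (\<lambda>t::rat. if 2 * t \<in> \<int>
     then let e = form n (wt n a) \<beta> + 1
          in (\<lambda>v s. smV (qpow (- (t * e)) * qpow t) (nth_prod n (shift t a) b 0 v (s + e)))
     else 0)"

definition bullet :: "nat \<Rightarrow> oper \<Rightarrow> oper \<Rightarrow> oper" where
  "bullet n a b =
     Sum_any (\<lambda>\<beta>. if \<beta> \<in> Plat n then bullet_wt n a \<beta> (wt_part n \<beta> b) else 0)"



section \<open>The vector space of operators and the sets in question\<close>

lemma lookup_smK: "Poly_Mapping.lookup (smK c p) \<mu> = c * Poly_Mapping.lookup p \<mu>"
  by (simp add: smK_def Poly_Mapping.map.rep_eq when_def)

lemma smK_zero [simp]: "smK c 0 = 0"
  by (rule poly_mapping_eqI) (simp add: lookup_smK)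

lemma lookup_smV: "Poly_Mapping.lookup (smV c v) \<beta> = smK c (Poly_Mapping.lookup v \<beta>)"
  by (simp add: smV_def Poly_Mapping.map.rep_eq when_def)

interpretation oper: vector_space smO
proof
  fix a b :: scal and x y :: oper
  have e: "f = g" if "\<And>v s \<beta> \<mu>. Poly_Mapping.lookup (Poly_Mapping.lookup (f v s) \<beta>) \<mu>
      = Poly_Mapping.lookup (Poly_Mapping.lookup (g v s) \<beta>) \<mu>" for f g :: oper
    using that by (intro ext poly_mapping_eqI) simp
  show "smO a (x + y) = smO a x + smO a y"
    by (rule e) (simp add: smO_def lookup_smV lookup_smK lookup_add algebra_simps)
  show "smO (a + b) x = smO a x + smO b x"
    by (rule e) (simp add: smO_def lookup_smV lookup_smK lookup_add algebra_simps)
  show "smO a (smO b x) = smO (a * b) x"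
    by (rule e) (simp add: smO_def lookup_smV lookup_smK algebra_simps)
  show "smO 1 x = x"
    by (rule e) (simp add: smO_def lookup_smV lookup_smK)
qed

definition Y_space :: "nat \<Rightarrow> nat \<Rightarrow> oper set" where
  "Y_space n i = oper.span {foldr (bullet n) as (Y_op n i) | as. set as \<subseteq> gens n}"

definition B_minus :: "nat \<Rightarrow> nat \<Rightarrow> oper set" where
  "B_minus n i =
     {foldr (\<lambda>j. bullet n (x_op n (- 1) j)) js (Y_op n i) | js. set js \<subseteq> {1..n}} - {0}"

text \<open>A list \<open>[(j\<^sub>1, t\<^sub>1), \<dots>, (j\<^sub>k, t\<^sub>k)]\<close> describes \<open>\<psi>\<^bsub>j\<^sub>1\<^esub>(zq\<^bsup>t\<^sub>1\<^esup>) \<cdots> \<psi>\<^bsub>j\<^sub>k\<^esub>(zq\<^bsup>t\<^sub>k\<^esup>)\<close>.\<close>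

definition psi_words :: "nat \<Rightarrow> (nat \<times> rat) list set" where
  "psi_words n = {w.
     (\<forall>(j, t)\<in>set w. j \<in> {1..n} \<and> 2 * t \<in> \<int>) \<and>
     (\<forall>r<length w. \<forall>s\<le>r. fst (w ! s) \<le> fst (w ! r) \<and>
        (fst (w ! s) = fst (w ! r) \<longrightarrow> snd (w ! s) \<le> snd (w ! r)))}"

definition B_minus_psi :: "nat \<Rightarrow> nat \<Rightarrow> oper set" where
  "B_minus_psi n i =
     {foldl (\<lambda>c (j, t). ocomp c (shift t (psi_op n j))) b w | b w.
        b \<in> B_minus n i \<and> w \<in> psi_words n}"


section \<open>Consistency of the explicit formulas with the defining relations\<close>

text \<open>The following facts check the explicit models chosen above: the bilinear form on the weight
  lattice, the coordinates used in the definition of \<open>e\<^sup>\<alpha>\<close>, the relations of \<open>\<complex>{P}\<close> and the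
  commutation relations of the operators \<open>a\<^sub>i(l)\<close>.\<close>

lemma sum_cartan:
  assumes "1 \<le> j" "j \<le> n" "f 0 = (0::'a::comm_ring_1)"
  shows "(\<Sum>l=1..n. of_int (cartan j l) * f l)
    = 2 * f j - f (j - 1) - (if j < n then f (Suc j) else 0)"
proof -
  have "(\<Sum>l=1..n. of_int (cartan j l) * f l)
      = (\<Sum>l=1..n. (if l = j then 2 * f l else 0) - (if l = j - 1 then f l else 0)
          - (if l = Suc j then f l else 0))"
    using assms(1) by (intro sum.cong) (auto simp: cartan_def)
  also have "\<dots> = 2 * f j - f (j - 1) - (if j < n then f (Suc j) else 0)"
  proof (cases "j = 1")
    case True
    then show ?thesis using assms by (simp add: sum_subtractf)
  next
    case False
    then have "1 \<le> j - 1 \<and> j - 1 \<le> n" using assms by auto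
    then show ?thesis using assms by (auto simp: sum_subtractf)
  qed
  finally show ?thesis .
qed

lemma lookup_simple_root:
  "Poly_Mapping.lookup (simple_root n j) l = (if l \<in> {1..n} then cartan j l else 0)"
  by (simp add: simple_root_def lookup_sum lookup_single when_def)

lemma form_fund_left:
  assumes "i \<in> {1..n}"
  shows "form n (fund i) \<gamma> = (\<Sum>j=1..n. of_int (Poly_Mapping.lookup \<gamma> j)
     * (of_nat (min i j) * of_nat (Suc n - max i j) / of_nat (Suc n)))"
proof -
  have "form n (fund i) \<gamma> = (\<Sum>i'=1..n. if i' = i then (\<Sum>j=1..n. of_int (Poly_Mapping.lookup \<gamma> j)
     * (of_nat (min i j) * of_nat (Suc n - max i j) / of_nat (Suc n))) else 0)"
    unfolding form_def by (intro sum.cong) (auto simp: fund_def lookup_single)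
  then show ?thesis using assms by simp
qed

lemma form_expand_left:
  "form n \<beta> \<gamma> = (\<Sum>i=1..n. of_int (Poly_Mapping.lookup \<beta> i) * form n (fund i) \<gamma>)"
  unfolding form_def[of n \<beta>]
  by (intro sum.cong refl) (simp add: form_fund_left sum_distrib_left mult.assoc del: of_nat_Suc)

lemma form_fund_simple_root:
  assumes "i \<in> {1..n}" "j \<in> {1..n}"
  shows "form n (fund i) (simple_root n j) = (if i = j then 1 else 0)"
proof -
  define f :: "nat \<Rightarrow> rat" where "f l = of_nat (min i l) * of_nat (Suc n - max i l)" for l
  have "form n (fund i) (simple_root n j) = (\<Sum>l=1..n. of_int (cartan j l) * f l) / of_nat (Suc n)"
    using assms
    by (simp add: form_fund_left lookup_simple_root f_def sum_divide_distrib del: of_nat_Suc)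
  also have "(\<Sum>l=1..n. of_int (cartan j l) * f l) = 2 * f j - f (j - 1) - (if j < n then f (Suc j) else 0)"
    using assms by (intro sum_cartan) (auto simp: f_def)
  also have "(if j < n then f (Suc j) else 0) = f (Suc j)"
    using assms by (auto simp: f_def)
  also have "2 * f j - f (j - 1) - f (Suc j) = (if i = j then of_nat (Suc n) else 0)"
  proof -
    obtain j' where j: "j = Suc j'" using assms by (cases j) auto
    consider "i < j" | "i = j" | "i > j" by linarith
    then show ?thesis
    proof cases
      case 1
      then show ?thesis using assms
        by (simp add: f_def j of_nat_diff min_def max_def le_Suc_eq algebra_simps)
    next
      case 2
      then show ?thesis using assms
        by (simp add: f_def j of_nat_diff min_def max_def algebra_simps)
    next
      case 3
      then show ?thesis using assms
        by (cases "i = Suc (Suc j')")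
           (simp_all add: f_def j of_nat_diff min_def max_def algebra_simps)
    qed
  qed
  finally show ?thesis by (simp del: of_nat_Suc)
qed

lemma form_simple_root_simple_root:
  assumes "i \<in> {1..n}" "j \<in> {1..n}"
  shows "form n (simple_root n i) (simple_root n j) = of_int (cartan i j)"
proof -
  have "form n (simple_root n i) (simple_root n j) =
     (\<Sum>l=1..n. if l = j then of_int (cartan i j) else 0)"
    unfolding form_expand_left[of n "simple_root n i"]
    using assms by (intro sum.cong) (auto simp: form_fund_simple_root lookup_simple_root)
  then show ?thesis using assms by simp
qed

lemma coord_add: "coord n (\<beta> + \<gamma>) k = coord n \<beta> k + coord n \<gamma> k"
  by (simp add: coord_def lookup_add sum.distrib distrib_left)

lemma coord_expansion:
  assumes "n \<ge> 1" "\<beta> \<in> Plat n"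
  shows "\<beta> = (\<Sum>k=2..n. Poly_Mapping.map ((*) (coord n \<beta> k)) (simple_root n k))
              + Poly_Mapping.map ((*) (coord n \<beta> (Suc n))) (fund n)"
proof (rule poly_mapping_eqI)
  fix l
  define f where "f k = (\<Sum>i=1..<k. int (k - i) * Poly_Mapping.lookup \<beta> i)" for k
  have f01: "f 0 = 0" "f 1 = 0" by (simp_all add: f_def)
  have cf: "coord n \<beta> k = - f k" if "k \<le> n" for k
    using that by (simp add: coord_def f_def)
  have cn: "coord n \<beta> (Suc n) = f (Suc n)"
    by (simp add: coord_def f_def atLeastLessThanSuc_atLeastAtMost)
  have f_Suc: "f (Suc k) = f k + (\<Sum>i=1..k. Poly_Mapping.lookup \<beta> i)" for k
  proof -
    have "f (Suc k) = (\<Sum>i=1..<Suc k. (int (k - i) + 1) * Poly_Mapping.lookup \<beta> i)"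
      unfolding f_def by (intro sum.cong) auto
    also have "\<dots> = (\<Sum>i=1..<Suc k. int (k - i) * Poly_Mapping.lookup \<beta> i)
        + (\<Sum>i=1..<Suc k. Poly_Mapping.lookup \<beta> i)"
      by (simp add: distrib_right sum.distrib)
    also have "(\<Sum>i=1..<Suc k. int (k - i) * Poly_Mapping.lookup \<beta> i) = f k"
      by (cases k) (auto simp: f_def)
    finally show ?thesis by (simp add: atLeastLessThanSuc_atLeastAtMost)
  qed
  have lm: "Poly_Mapping.lookup (Poly_Mapping.map ((*) (c::int)) \<gamma>) l = c * Poly_Mapping.lookup \<gamma> l"
    for c and \<gamma> :: weight
    by (simp add: Poly_Mapping.map.rep_eq when_def)
  have sym: "cartan a b = cartan b a" for a b by (auto simp: cartan_def)
  show "Poly_Mapping.lookup \<beta> l = Poly_Mapping.lookup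
     ((\<Sum>k=2..n. Poly_Mapping.map ((*) (coord n \<beta> k)) (simple_root n k))
              + Poly_Mapping.map ((*) (coord n \<beta> (Suc n))) (fund n)) l"
  proof (cases "l \<in> {1..n}")
    case False
    then have "l \<notin> Poly_Mapping.keys \<beta>" using assms by (auto simp: Plat_def)
    then show ?thesis using False assms
      by (auto simp: in_keys_iff lookup_add lookup_sum lm lookup_simple_root fund_def lookup_single)
  next
    case True
    have "(\<Sum>k=2..n. coord n \<beta> k * cartan k l) = (\<Sum>k=1..n. - (of_int (cartan l k) * f k))"
    proof (intro sum.mono_neutral_cong_left ballI)
      fix k assume "k \<in> {1..n} - {2..n}"
      then have "k = 1" by auto
      then show "- (of_int (cartan l k) * f k) = 0" using f01 by simp
    qed (auto simp: cf sym[of l])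
    also have "\<dots> = - (2 * f l - f (l - 1) - (if l < n then f (Suc l) else 0))"
      using True f01 unfolding sum_negf by (subst sum_cartan) auto
    finally have eq: "(\<Sum>k=2..n. coord n \<beta> k * cartan k l)
       = - (2 * f l - f (l - 1) - (if l < n then f (Suc l) else 0))" .
    obtain l' where l: "l = Suc l'" using True by (cases l) auto
    have "f (Suc l) - 2 * f l + f (l - 1) = Poly_Mapping.lookup \<beta> l"
      unfolding l f_Suc by simp
    then show ?thesis using True assms eq
      by (auto simp: lookup_add lookup_sum lm lookup_simple_root fund_def lookup_single cn)
  qed
qed

definition lattice_gen :: "nat \<Rightarrow> nat \<Rightarrow> weight" where
  "lattice_gen n k = (if k = Suc n then fund n else simple_root n k)"

lemma coord_gen:
  assumes "n \<ge> 1" "k \<in> {2..Suc n}" "l \<in> {2..Suc n}"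
  shows "coord n (lattice_gen n k) l = (if k = l then 1 else 0)"
proof (cases "k = Suc n")
  case True
  have "(\<Sum>i=1..<l. int (l - i) * Poly_Mapping.lookup (fund n) i) = 0" if "l \<le> n"
    using that by (intro sum.neutral) (auto simp: fund_def lookup_single)
  moreover have "(\<Sum>i=1..n. int (Suc n - i) * Poly_Mapping.lookup (fund n) i)
     = (\<Sum>i=1..n. if i = n then 1 else 0)"
    by (intro sum.cong) (auto simp: fund_def lookup_single)
  ultimately show ?thesis using True assms by (auto simp: lattice_gen_def coord_def)
next
  case False
  define f where "f i = (if i = 0 then 0 else int (l - i))" for i
  have l1: "(\<Sum>i=1..n. int (l - i) * Poly_Mapping.lookup (simple_root n k) i)
      = (\<Sum>i=1..n. of_int (cartan k i) * f i)"
    by (intro sum.cong) (auto simp: lookup_simple_root f_def)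
  also have "\<dots> = 2 * f k - f (k - 1) - (if k < n then f (Suc k) else 0)"
    using False assms by (intro sum_cartan) (auto simp: f_def)
  also have "\<dots> = (if k = l then - 1 else if l = Suc n then (if k = n then 0 else 0) else 0)"
    using False assms by (auto simp: f_def)
  finally have s: "(\<Sum>i=1..n. int (l - i) * Poly_Mapping.lookup (simple_root n k) i)
      = (if k = l then - 1 else 0)" by simp
  show ?thesis
  proof (cases "l = Suc n")
    case True
    then show ?thesis using s False by (simp add: lattice_gen_def coord_def)
  next
    case l: False
    have "(\<Sum>i=1..<l. int (l - i) * Poly_Mapping.lookup (simple_root n k) i)
       = (\<Sum>i=1..n. int (l - i) * Poly_Mapping.lookup (simple_root n k) i)"
      using assms l by (intro sum.mono_neutral_left) auto
    then show ?thesis using s False l by (simp add: lattice_gen_def coord_def)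
  qed
qed

lemma eps_add_left: "eps n (\<gamma> + \<gamma>') \<beta> = eps n \<gamma> \<beta> * eps n \<gamma>' \<beta>"
  by (simp add: eps_def coord_add algebra_simps sum.distrib power_int_add)

lemma eps_add_right: "eps n \<gamma> (\<beta> + \<beta>') = eps n \<gamma> \<beta> * eps n \<gamma> \<beta>'"
  by (simp add: eps_def coord_add algebra_simps sum.distrib power_int_add)

lemma eps_gen:
  assumes "n \<ge> 1" "k \<in> {2..Suc n}" "l \<in> {2..Suc n}"
  shows "eps n (lattice_gen n k) (lattice_gen n l) = (if l < k then (-1) powi gcomm n k l else 1)"
proof -
  have "(\<Sum>k'=2..Suc n. \<Sum>l'=2..<k'. gcomm n k' l' * coord n (lattice_gen n k) k' * coord n (lattice_gen n l) l')
    = (\<Sum>k'=2..Suc n. if k' = k then (\<Sum>l'=2..<k'. if l' = l then gcomm n k l else 0) else 0)"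
    using assms
    by (intro sum.cong refl) (auto simp: coord_gen if_distrib[of "(*) _"] intro!: sum.cong cong: if_cong)
  also have "\<dots> = (if l < k then gcomm n k l else 0)"
    using assms by auto
  finally show ?thesis by (simp add: eps_def)
qed

lemma lookup_pdiff:
  "Poly_Mapping.lookup (pdiff x p) \<mu> = of_nat (Suc (Poly_Mapping.lookup \<mu> x))
     * Poly_Mapping.lookup p (\<mu> + Poly_Mapping.single x 1)"
proof -
  let ?e = "Poly_Mapping.single x (1::nat)"
  have "Poly_Mapping.lookup (pdiff x p) \<mu> = (\<Sum>\<nu>\<in>Poly_Mapping.keys p.
      (if \<nu> = \<mu> + ?e then of_nat (Poly_Mapping.lookup \<nu> x) * Poly_Mapping.lookup p \<nu> else 0))"
    unfolding pdiff_def lookup_sum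
  proof (intro sum.cong refl)
    fix \<nu>
    show "Poly_Mapping.lookup (Poly_Mapping.single (\<nu> - ?e)
          (of_nat (Poly_Mapping.lookup \<nu> x) * Poly_Mapping.lookup p \<nu>)) \<mu>
       = (if \<nu> = \<mu> + ?e then of_nat (Poly_Mapping.lookup \<nu> x) * Poly_Mapping.lookup p \<nu> else 0)"
    proof (cases "Poly_Mapping.lookup \<nu> x = 0")
      case True
      then have "\<nu> \<noteq> \<mu> + ?e" by (auto simp: lookup_add)
      with True show ?thesis by (simp add: lookup_single)
    next
      case False
      then have "(\<nu> - ?e) + ?e = \<nu>"
        by (intro poly_mapping_eqI) (auto simp: lookup_add lookup_minus lookup_single when_def)
      then have "\<nu> - ?e = \<mu> \<longleftrightarrow> \<nu> = \<mu> + ?e" by auto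
      then show ?thesis by (auto simp: lookup_single when_def)
    qed
  qed
  also have "\<dots> = (of_nat (Suc (Poly_Mapping.lookup \<mu> x))
     * Poly_Mapping.lookup p (\<mu> + ?e))"
    by (auto simp: lookup_add in_keys_iff)
  finally show ?thesis .
qed


lemma lookup_var_mult:
  "Poly_Mapping.lookup (var y * p) \<mu> = (if Poly_Mapping.lookup \<mu> y = 0 then 0
     else Poly_Mapping.lookup p (\<mu> - Poly_Mapping.single y 1))"
proof -
  let ?e = "Poly_Mapping.single y (1::nat)"
  have "var y * p = var y * (\<Sum>\<nu>\<in>Poly_Mapping.keys p. Poly_Mapping.single \<nu> (Poly_Mapping.lookup p \<nu>))"
  proof (rule arg_cong[where f = "(*) (var y)"], rule poly_mapping_eqI)
    fix \<nu>
    show "Poly_Mapping.lookup p \<nu> = Poly_Mapping.lookup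
      (\<Sum>\<nu>\<in>Poly_Mapping.keys p. Poly_Mapping.single \<nu> (Poly_Mapping.lookup p \<nu>)) \<nu>"
      by (simp add: lookup_sum lookup_single when_def in_keys_iff)
  qed
  also have "\<dots> = (\<Sum>\<nu>\<in>Poly_Mapping.keys p. Poly_Mapping.single (?e + \<nu>) (Poly_Mapping.lookup p \<nu>))"
    by (simp add: var_def sum_distrib_left mult_single)
  finally have *: "Poly_Mapping.lookup (var y * p) \<mu> =
      (\<Sum>\<nu>\<in>Poly_Mapping.keys p. if ?e + \<nu> = \<mu> then Poly_Mapping.lookup p \<nu> else 0)"
    by (simp add: lookup_sum lookup_single when_def)
  show ?thesis
  proof (cases "Poly_Mapping.lookup \<mu> y = 0")
    case True
    then have "?e + \<nu> \<noteq> \<mu>" for \<nu> by (auto simp: lookup_add)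
    with True * show ?thesis by simp
  next
    case False
    have "?e + (\<mu> - ?e) = \<mu>" using False
      by (intro poly_mapping_eqI) (auto simp: lookup_add lookup_minus lookup_single when_def)
    then have "?e + \<nu> = \<mu> \<longleftrightarrow> \<nu> = \<mu> - ?e" for \<nu> by auto
    with False * show ?thesis by (simp add: in_keys_iff)
  qed
qed

lemma pdiff_var_mult: "pdiff x (var y * p) = (if x = y then p else 0) + var y * pdiff x p"
proof (rule poly_mapping_eqI)
  fix \<mu>
  have e1: "\<mu> + Poly_Mapping.single x (Suc 0) - Poly_Mapping.single y (Suc 0)
       = \<mu> - Poly_Mapping.single y (Suc 0) + Poly_Mapping.single x (Suc 0)"
    if "x \<noteq> y \<or> Poly_Mapping.lookup \<mu> y \<noteq> 0"
    using that
    by (intro poly_mapping_eqI) (auto simp: lookup_add lookup_minus lookup_single when_def)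
  show "Poly_Mapping.lookup (pdiff x (var y * p)) \<mu> =
    Poly_Mapping.lookup ((if x = y then p else 0) + var y * pdiff x p) \<mu>"
    using e1
    by (auto simp: lookup_add lookup_pdiff lookup_var_mult lookup_single when_def lookup_minus
        distrib_left distrib_right left_diff_distrib)
qed

lemma smK_add: "smK c (p + p') = smK c p + smK c p'"
  by (rule poly_mapping_eqI) (simp add: lookup_smK lookup_add algebra_simps)

lemma smK_0_left: "smK 0 p = 0"
  by (rule poly_mapping_eqI) (simp add: lookup_smK)

lemma smK_smK: "smK c (smK d p) = smK (c * d) p"
  by (rule poly_mapping_eqI) (simp add: lookup_smK algebra_simps)

lemma mult_smK: "p * smK c p' = smK c (p * p')"
proof -
  have "smK c r = Poly_Mapping.single 0 c * r" for r :: fock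
    by (simp add: smK_def mult_map_scale_conv_mult)
  then show ?thesis by (simp add: algebra_simps)
qed

lemma pdiff_smK: "pdiff x (smK c p) = smK c (pdiff x p)"
  by (rule poly_mapping_eqI) (simp add: lookup_smK lookup_pdiff algebra_simps)

lemma pdiff_sum: "pdiff x (\<Sum>i\<in>I. f i) = (\<Sum>i\<in>I. pdiff x (f i))"
  by (rule poly_mapping_eqI) (simp add: lookup_sum lookup_pdiff sum_distrib_left)

lemma pdiff_commute: "pdiff x (pdiff y p) = pdiff y (pdiff x p)"
  by (rule poly_mapping_eqI)
     (auto simp: lookup_pdiff lookup_add lookup_single when_def algebra_simps)

lemma smK_sum: "smK c (\<Sum>i\<in>I. f i) = (\<Sum>i\<in>I. smK c (f i))"
  by (rule poly_mapping_eqI) (simp add: lookup_sum lookup_smK sum_distrib_left)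

lemma qint_uminus: "qint (- m) = - qint m"
  by (simp add: qint_def diff_divide_distrib)

lemma heis_commute_pos_neg:
  assumes "j \<in> {1..n}" "l > 0" "m < 0"
  shows "heis n i l (heis n j m p) - heis n j m (heis n i l p) =
     smK (if l + m = 0 then qint (cartan i j * l) * qint l / of_int l else 0) p"
proof -
  have sym: "cartan a b = cartan b a" for a b by (auto simp: cartan_def)
  have "heis n i l (heis n j m p) = (\<Sum>k=1..n. (if k = j then (if l + m = 0
      then smK (qint (cartan i k * l) * qint l / of_int l) p else 0) else 0)
      + var (j, nat (- m)) * smK (qint (cartan i k * l) * qint l / of_int l) (pdiff (k, nat l) p))"
    using assms unfolding heis_def
    by (auto simp: pdiff_var_mult smK_add mult_smK intro!: sum.cong)
  then show ?thesis using assms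
    by (simp add: sum.distrib heis_def sum_distrib_left smK_0_left)
qed

lemma heis_commutator:
  assumes "i \<in> {1..n}" "j \<in> {1..n}" "l \<noteq> 0" "m \<noteq> 0"
  shows "heis n i l (heis n j m p) - heis n j m (heis n i l p) =
     smK (if l + m = 0 then qint (cartan i j * l) * qint l / of_int l else 0) p"
proof -
  have sym: "cartan a b = cartan b a" for a b by (auto simp: cartan_def)
  consider "l > 0" "m < 0" | "l < 0" "m > 0" | "l > 0" "m > 0" | "l < 0" "m < 0"
    using assms by linarith
  then show ?thesis
  proof cases
    case 1
    then show ?thesis using assms by (intro heis_commute_pos_neg)
  next
    case 2
    have "heis n i l (heis n j m p) - heis n j m (heis n i l p)
       = - (heis n j m (heis n i l p) - heis n i l (heis n j m p))" by simp
    also have "\<dots> = - smK (if m + l = 0 then qint (cartan j i * m) * qint m / of_int m else 0) p"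
      using 2 assms by (subst heis_commute_pos_neg) auto
    also have "\<dots> = smK (if l + m = 0 then qint (cartan i j * l) * qint l / of_int l else 0) p"
    proof (rule poly_mapping_eqI)
      fix \<mu>
      have "l + m = 0 \<longleftrightarrow> m = - l" by auto
      then show "Poly_Mapping.lookup (- smK (if m + l = 0 then qint (cartan j i * m) * qint m / of_int m else 0) p) \<mu>
        = Poly_Mapping.lookup (smK (if l + m = 0 then qint (cartan i j * l) * qint l / of_int l else 0) p) \<mu>"
        by (auto simp: lookup_smK sym[of j i] qint_uminus)
    qed
    finally show ?thesis .
  next
    case 3
    have "heis n i l (heis n j m p) = heis n j m (heis n i l p)"
      using 3 unfolding heis_def
      by (simp add: pdiff_sum pdiff_smK smK_sum smK_smK, subst sum.swap)
         (simp add: pdiff_commute[of "(_, nat l)"] mult.commute mult.left_commute)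
    then show ?thesis using 3 by (simp add: smK_0_left)
  next
    case 4
    then show ?thesis
      by (simp add: heis_def algebra_simps smK_0_left)
  qed
qed

lemma lookup_e_op_single:
  "e_op n \<gamma> (Poly_Mapping.single \<beta> p) = Poly_Mapping.single (\<gamma> + \<beta>) (smK (eps n \<gamma> \<beta>) p)"
  by (cases "p = 0") (simp_all add: e_op_def)

lemma wt_part_vac:
  "\<exists>d. \<forall>s. wt_part n \<beta> b vac s = Poly_Mapping.single \<beta> (d s)"
  by (cases "vac \<in> Vsp n") (auto simp: wt_part_def on_V_def vac_def intro: exI[of _ "\<lambda>_. 0"])

end

theory Submission
  imports Defs
begin

text \<open>
  Every operator involved has the form \<open>exp(\<Sum>u(i,r) a\<^sub>i(-r) z\<^sup>r) \<otimes> e\<^sup>\<gamma> z\<^bsup>\<partial>\<^sub>\<gamma>\<^esup>\<close>, preceded by a substitution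
  \<open>a\<^sub>i(-r) \<mapsto> a\<^sub>i(-r) + d(i,r) z\<^bsup>-r\<^esup>\<close> and multiplied by a character of \<open>P\<close>. The product \<open>a(z\<^sub>1)b(z)\<close> of two of them
  is their normally ordered product times a contraction series in \<open>z/z\<^sub>1\<close>. Contracting \<open>x\<^sub>j\<^sup>-\<close> with an element
  of \<open>\<B>\<^sub>i\<^sup>-\<close> gives \<open>(1 - q\<^sup>h z/z\<^sub>1)\<^bsup>-m\<^esup>\<close> with \<open>m \<in> {-1, 0, 1}\<close> the pairing of its weight with \<open>\<alpha>\<^sub>j\<close>, because the
  weights are those of the minuscule representation with highest weight \<open>\<lambda>\<^sub>i\<close>. So \<open>a(z)\<^sub>\<bullet>b(z)\<close> picks up at most one
  simple pole: \<open>x\<^sub>j\<^sup>-\<close> moves down one step, \<open>x\<^sub>j\<^sup>+\<close> moves up and leaves a factor \<open>\<psi>\<^sub>j(zq\<^sup>t)\<close>, \<open>\<psi>\<^sub>j\<close> appends such a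
  factor, and \<open>\<phi>\<^sub>j\<close> gives \<open>0\<close>. Hence every iterated product is a multiple of an element of \<open>\<B>\<^bsub>i,\<psi>\<^esub>\<^sup>-\<close>.
  For a fixed weight, the lowest coefficients of these elements are characters of the monoid of pairs of
  a monomial and an element of \<open>P\<close>, so distinct elements are linearly independent.
\<close>

text \<open>\<open>nth_prod\<close> picks an arbitrary clearing polynomial. Once the result is known
  not to depend on that choice, \<open>z\<^sub>1 - c z\<close> serves throughout, because every
  contraction met here has at most one linear factor above and at most one below. Under
  \<open>z\<^sub>1 = z + z\<^sub>0\<close> it becomes \<open>z\<^sub>0 + (1 - c) z\<close>, whose
  inverse has a pole in \<open>z\<^sub>0\<close> only for \<open>c = 1\<close>. This is why a single
  \<open>t\<close> survives in the sum over shifts; the powers of \<open>z\<close> and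
  \<open>q\<close> in front of each summand then cancel so that the result has the same shape again.
  The position of the pole is found by induction along lowering steps from \<open>{1..i}\<close>;
  the induction starts from the fact that \<open>mstar\<close> inverts the q-deformed Cartan matrix.
  The delicate point is the scalar. \<open>B_minus\<close> is a set of operators, and two words
  leading to the same state might give operators differing by a sign of the cocycle
  \<open>eps\<close>, which would destroy independence. That the signs agree is a diamond argument;
  the first simple root, which is not a generator of the twisted group algebra, needs its own parity
  check.\<close>

abbreviation lookup :: "('a \<Rightarrow>\<^sub>0 'b::zero) \<Rightarrow> 'a \<Rightarrow> 'b" where
  "lookup \<equiv> Poly_Mapping.lookup"

abbreviation single :: "'a \<Rightarrow> 'b \<Rightarrow> ('a \<Rightarrow>\<^sub>0 'b::zero)" where
  "single \<equiv> Poly_Mapping.single"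

abbreviation keys :: "('a \<Rightarrow>\<^sub>0 'b::zero) \<Rightarrow> 'a set" where
  "keys \<equiv> Poly_Mapping.keys"

section \<open>Scalars\<close>

text \<open>The exponentials divide by factorials and the commutators by \<open>r\<close>, so the
  scalars have to be a field of characteristic 0.\<close>

instance fract :: ("{idom,ring_char_0}") field_char_0
proof
  show "inj (of_nat :: nat \<Rightarrow> 'a fract)"
  proof (rule injI)
    fix m n :: nat assume "(of_nat m :: 'a fract) = of_nat n"
    then have "Fract (of_nat m :: 'a) 1 = Fract (of_nat n) 1" by (simp add: of_nat_fract)
    then show "m = n" by (simp add: eq_fract)
  qed
qed

lemma qhalf_neq_0 [simp]: "qhalf \<noteq> 0"
  by (simp add: qhalf_def)

text \<open>Positive powers of the indeterminate have positive degree. Every later use of the fact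
  that \<open>q\<close> is not a root of unity goes back to this, mostly in the form that distinct
  half-integers \<open>t\<close> give distinct \<open>qpow t\<close>.\<close>

lemma qhalf_power_neq_1:
  assumes "k > 0" shows "qhalf ^ k \<noteq> 1"
proof
  assume a: "qhalf ^ k = 1"
  have "to_fract ([:0, 1:] ^ k :: complex poly) = qhalf ^ k"
    by (induction k) (simp_all only: power_0 power_Suc to_fract_1 to_fract_mult qhalf_def)
  then have "([:0, 1:] ^ k :: complex poly) = 1"
    using a by (metis to_fract_1 to_fract_eq_iff)
  then have "degree ([:0, 1:] ^ k :: complex poly) = 0" by simp
  then show False using assms by (simp add: degree_power_eq)
qed

lemma qhalf_powi_eq_1_iff: "qhalf powi k = 1 \<longleftrightarrow> k = 0"
proof
  assume a: "qhalf powi k = 1"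
  show "k = 0"
  proof (rule ccontr)
    assume "k \<noteq> 0"
    have "qhalf ^ nat \<bar>k\<bar> = 1"
    proof (cases "k \<ge> 0")
      case False
      then have "inverse (qhalf ^ nat (- k)) = 1"
        using a by (simp only: power_int_def if_False power_inverse)
      then show ?thesis using False by (metis abs_of_neg inverse_1 inverse_inverse_eq not_le)
    qed (use a in \<open>simp add: power_int_def\<close>)
    then show False using qhalf_power_neq_1[of "nat \<bar>k\<bar>"] \<open>k \<noteq> 0\<close> by auto
  qed
qed simp

lemma qpow_neq_0 [simp]: "qpow t \<noteq> 0"
  by (simp add: qpow_def)

lemma qpow_0 [simp]: "qpow 0 = 1"
  by (simp add: qpow_def)

text \<open>One half-integral summand suffices, because \<open>floor\<close> commutes with adding an
  integer.\<close>

lemma qpow_add: "2 * s \<in> \<int> \<Longrightarrow> qpow (s + t) = qpow s * qpow t"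
  by (auto simp: qpow_def power_int_add distrib_left elim!: Ints_cases)

lemma qpow_minus: "2 * t \<in> \<int> \<Longrightarrow> qpow (- t) = inverse (qpow t)"
  using qpow_add[of t "- t"] by (simp add: field_simps)

lemma qpow_diff: "2 * s \<in> \<int> \<Longrightarrow> 2 * t \<in> \<int> \<Longrightarrow> qpow (s - t) = qpow s / qpow t"
  using qpow_add[of s "- t"] by (simp add: qpow_minus divide_inverse)

lemma qpow_of_nat_mult: "2 * t \<in> \<int> \<Longrightarrow> qpow (of_nat r * t) = qpow t ^ r"
  by (induction r) (simp_all add: distrib_right qpow_add)

lemma qpow_eq_1_iff: "2 * t \<in> \<int> \<Longrightarrow> qpow t = 1 \<longleftrightarrow> t = 0"
  by (auto simp: qpow_def qhalf_powi_eq_1_iff elim!: Ints_cases)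

lemma qpow_eq_iff:
  assumes "2 * s \<in> \<int>" "2 * t \<in> \<int>"
  shows "qpow s = qpow t \<longleftrightarrow> s = t"
proof -
  have "qpow (s - t) = 1 \<longleftrightarrow> s - t = 0"
    using assms by (intro qpow_eq_1_iff) (auto simp: right_diff_distrib)
  then show ?thesis using assms by (auto simp: qpow_diff)
qed

lemma Ints_2_of_int [simp]: "2 * (of_int k :: rat) \<in> \<int>" "2 * (of_nat m :: rat) \<in> \<int>"
  by (auto intro: Ints_mult)

lemma qint_neq_0: "m \<noteq> 0 \<Longrightarrow> qint m \<noteq> 0"
proof -
  assume m: "m \<noteq> 0"
  have "qpow (of_int m) \<noteq> qpow (- of_int m)" "qpow 1 \<noteq> qpow (- 1)"
    using m by (subst qpow_eq_iff; force)+
  then show ?thesis by (simp add: qint_def)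
qed

section \<open>Exponential series\<close>

text \<open>\<open>F\<close> is \<open>exp (\<Sum>r\<ge>1. c r X\<^sup>r)\<close>, characterized without division by its logarithmic derivative.\<close>

definition is_exp :: "(nat \<Rightarrow> 'a::comm_ring_1) \<Rightarrow> 'a fps \<Rightarrow> bool" where
  "is_exp c F \<longleftrightarrow> fps_nth F 0 = 1 \<and>
     (\<forall>m. of_nat m * fps_nth F m = (\<Sum>r=1..m. of_nat r * c r * fps_nth F (m - r)))"

text \<open>The recursion is the coefficientwise form of a first order differential equation, so
  that products and inverses of exponentials reduce to the Leibniz rule.\<close>

lemma is_exp_iff_deriv:
  "is_exp c F \<longleftrightarrow> fps_nth F 0 = 1 \<and> fps_deriv F = Abs_fps (\<lambda>k. of_nat (Suc k) * c (Suc k)) * F"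
proof -
  have "(\<Sum>r=1..Suc m. of_nat r * c r * fps_nth F (Suc m - r))
      = fps_nth (Abs_fps (\<lambda>k. of_nat (Suc k) * c (Suc k)) * F) m" for m
    unfolding fps_mult_nth One_nat_def sum.shift_bounds_cl_Suc_ivl by simp
  note * = this
  define P where "P m \<longleftrightarrow> of_nat m * fps_nth F m = (\<Sum>r=1..m. of_nat r * c r * fps_nth F (m - r))" for m
  have "P 0" by (simp add: P_def)
  then have "(\<forall>m. P m) \<longleftrightarrow> (\<forall>m. P (Suc m))" using not0_implies_Suc by metis
  also have "\<dots> \<longleftrightarrow> fps_deriv F = Abs_fps (\<lambda>k. of_nat (Suc k) * c (Suc k)) * F"
    unfolding P_def * fps_eq_iff by (simp only: fps_deriv_nth Suc_eq_plus1)
  finally show ?thesis by (simp only: is_exp_def P_def)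
qed

lemma is_exp_mult:
  assumes "is_exp c F" "is_exp c' F'" "\<And>r. r > 0 \<Longrightarrow> d r = c r + c' r"
  shows "is_exp d (F * F')"
proof -
  have "Abs_fps (\<lambda>k. of_nat (Suc k) * d (Suc k)) = Abs_fps (\<lambda>k. of_nat (Suc k) * c (Suc k))
      + Abs_fps (\<lambda>k. of_nat (Suc k) * c' (Suc k))"
    by (simp add: fps_eq_iff assms(3) distrib_left del: of_nat_Suc)
  then show ?thesis using assms(1,2) by (auto simp: is_exp_iff_deriv algebra_simps)
qed

text \<open>The coefficients may lie in \<open>fock\<close>, which is not a field; torsion-freeness
  replaces the division by \<open>m\<close>.\<close>

lemma is_exp_unique:
  fixes F F' :: "'a::comm_ring_1 fps"
  assumes "is_exp c F" "is_exp c' F'" "\<And>r. r > 0 \<Longrightarrow> c r = c' r"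
    and tf: "\<And>m (x::'a). m > 0 \<Longrightarrow> of_nat m * x = 0 \<Longrightarrow> x = 0"
  shows "F = F'"
proof (rule fps_ext)
  fix m
  show "fps_nth F m = fps_nth F' m"
  proof (induction m rule: less_induct)
    case (less m)
    show ?case
    proof (cases "m = 0")
      case False
      have "of_nat m * fps_nth F m = of_nat m * fps_nth F' m"
        using assms(1-3) less unfolding is_exp_def by (auto intro!: sum.cong)
      then have "of_nat m * (fps_nth F m - fps_nth F' m) = 0" by (simp add: algebra_simps)
      then have "fps_nth F m - fps_nth F' m = 0"
        by (rule tf[rotated]) (use False in simp)
      then show ?thesis by simp
    qed (use assms in \<open>simp add: is_exp_def\<close>)
  qed
qed

lemma is_exp_scale:
  assumes "is_exp c F" "\<And>r. r > 0 \<Longrightarrow> d r = a ^ r * c r"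
  shows "is_exp d (Abs_fps (\<lambda>m. a ^ m * fps_nth F m))"
  unfolding is_exp_def
proof (intro conjI allI)
  show "fps_nth (Abs_fps (\<lambda>m. a ^ m * fps_nth F m)) 0 = 1" using assms by (simp add: is_exp_def)
  fix m
  have "of_nat m * (a ^ m * fps_nth F m) = (\<Sum>r=1..m. a ^ m * (of_nat r * c r * fps_nth F (m - r)))"
    using assms(1) unfolding is_exp_def sum_distrib_left[symmetric] by (metis mult.left_commute)
  also have "\<dots> = (\<Sum>r=1..m. of_nat r * d r * (a ^ (m - r) * fps_nth F (m - r)))"
  proof (intro sum.cong refl)
    fix r assume r: "r \<in> {1..m}"
    then have "a ^ m = a ^ r * a ^ (m - r)" by (simp flip: power_add)
    have d: "d r = a ^ r * c r" using r by (simp add: assms(2))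
    show "a ^ m * (of_nat r * c r * fps_nth F (m - r)) = of_nat r * d r * (a ^ (m - r) * fps_nth F (m - r))"
      unfolding \<open>a ^ m = _\<close> d by (simp only: mult_ac)
  qed
  finally show "of_nat m * fps_nth (Abs_fps (\<lambda>m. a ^ m * fps_nth F m)) m =
      (\<Sum>r=1..m. of_nat r * d r * fps_nth (Abs_fps (\<lambda>m. a ^ m * fps_nth F m)) (m - r))" by simp
qed

lemma is_exp_0: "(\<And>r. r > 0 \<Longrightarrow> c r = 0) \<Longrightarrow> is_exp c 1"
  by (auto simp: is_exp_iff_deriv fps_eq_iff)

text \<open>This is \<open>log (1 - a X) = - (a X + (a X)^2 / 2 + ...)\<close>. It turns the power
  sums found for the contractions into linear factors, that is, into zeros and poles.\<close>

lemma is_exp_linear: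
  fixes a :: "'a::field_char_0"
  assumes "\<And>r. r > 0 \<Longrightarrow> c r = - (a ^ r) / of_nat r"
  shows "is_exp c (1 - fps_const a * fps_X)"
proof -
  have e: "Abs_fps (\<lambda>k. of_nat (Suc k) * c (Suc k)) = Abs_fps (\<lambda>k. - (a ^ Suc k))"
    by (simp add: fps_eq_iff assms del: of_nat_Suc)
  have "Abs_fps (\<lambda>k. - (a ^ Suc k)) * (1 - fps_const a * fps_X) = - fps_const a"
    (is "?A * _ = _")
  proof (rule fps_ext)
    fix m
    have "?A * (1 - fps_const a * fps_X) = ?A - fps_X * (fps_const a * ?A)"
      by (simp add: algebra_simps)
    then show "fps_nth (?A * (1 - fps_const a * fps_X)) m = fps_nth (- fps_const a) m"
      by (cases m) simp_all
  qed
  moreover have "fps_deriv (1 - fps_const a * fps_X) = - fps_const a"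
    "fps_nth (1 - fps_const a * fps_X) 0 = 1" by simp_all
  ultimately show ?thesis unfolding is_exp_iff_deriv e by metis
qed

lemma is_exp_inverse:
  fixes F :: "'a::field fps"
  assumes "is_exp c F" "\<And>r. r > 0 \<Longrightarrow> d r = - c r"
  shows "is_exp d (inverse F)"
proof -
  have F0: "fps_nth F 0 = 1" using assms by (simp add: is_exp_def)
  have "Abs_fps (\<lambda>k. of_nat (Suc k) * d (Suc k)) = - Abs_fps (\<lambda>k. of_nat (Suc k) * c (Suc k))"
    by (simp add: fps_eq_iff assms(2))
  moreover have "F * inverse F ^ 2 = inverse F"
    using F0 by (simp add: power2_eq_square inverse_mult_eq_1' flip: mult.assoc)
  ultimately show ?thesis using assms(1) F0
    by (simp add: is_exp_iff_deriv fps_inverse_deriv mult.assoc)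
qed

section \<open>Operators on the polynomial algebra\<close>

lemma smK_1 [simp]: "smK 1 p = p"
  by (rule poly_mapping_eqI) (simp add: lookup_smK)

lemma smK_add_left: "smK (c + d) p = smK c p + smK d p"
  by (rule poly_mapping_eqI) (simp add: lookup_smK lookup_add algebra_simps)

lemma smK_diff: "smK c (p - p') = smK c p - smK c p'"
  by (rule poly_mapping_eqI) (simp add: lookup_smK lookup_minus algebra_simps)

lemma smK_mult: "smK c p * p' = smK c (p * p')"
  by (metis mult.commute mult_smK)

lemma smK_sum_left: "smK (\<Sum>i\<in>I. f i) p = (\<Sum>i\<in>I. smK (f i) p)"
  by (rule poly_mapping_eqI) (simp add: lookup_sum lookup_smK sum_distrib_right)

lemma smK_of_nat: "smK (of_nat m) p = of_nat m * p"
  by (induction m) (simp_all add: smK_0_left smK_add_left algebra_simps)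

lemma smK_eq_0_iff: "smK c p = 0 \<longleftrightarrow> c = 0 \<or> p = 0"
proof
  assume a: "smK c p = 0"
  show "c = 0 \<or> p = 0"
  proof (rule disjCI)
    assume "p \<noteq> 0"
    then obtain \<mu> where "lookup p \<mu> \<noteq> 0" by (metis lookup_not_eq_zero_eq_in_keys poly_mapping_eqI lookup_zero)
    then show "c = 0" using arg_cong[OF a, of "\<lambda>p. lookup p \<mu>"] by (simp add: lookup_smK)
  qed
qed (auto simp: smK_0_left)

lemma fock_torsion: "m > 0 \<Longrightarrow> of_nat m * p = 0 \<Longrightarrow> p = (0::fock)"
  by (simp add: smK_eq_0_iff flip: smK_of_nat)

definition lin :: "(fock \<Rightarrow> fock) \<Rightarrow> bool" where
  "lin f \<longleftrightarrow> (\<forall>p p'. f (p + p') = f p + f p') \<and> (\<forall>c p. f (smK c p) = smK c (f p))"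

lemma lin_0: "lin f \<Longrightarrow> f 0 = 0"
  by (metis lin_def smK_0_left)

lemma lin_sum: "lin f \<Longrightarrow> f (\<Sum>i\<in>I. g i) = (\<Sum>i\<in>I. f (g i))"
  by (induction I rule: infinite_finite_induct) (auto simp: lin_0 lin_def)

lemma lin_smK: "lin f \<Longrightarrow> f (smK c p) = smK c (f p)"
  by (simp add: lin_def)

lemma lin_mult: "lin (\<lambda>p. u * p)"
  by (simp add: lin_def distrib_left mult_smK)

lemma lin_ser_pow: "(\<And>r. r > 0 \<Longrightarrow> lin (A r)) \<Longrightarrow> lin (ser_pow A k m)"
proof (induction k arbitrary: m)
  case (Suc k)
  then show ?case unfolding lin_def
    by (auto simp: sum.distrib smK_sum lin_def intro!: sum.cong)
qed (simp add: lin_def)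

lemma lin_ser_exp: "(\<And>r. r > 0 \<Longrightarrow> lin (A r)) \<Longrightarrow> lin (ser_exp A m)"
  using lin_ser_pow[of A]
  by (auto simp: lin_def ser_exp_def sum.distrib smK_sum smK_add smK_smK mult.commute intro!: sum.cong)

lemma ser_pow_eq_0: "(\<And>r. r > 0 \<Longrightarrow> lin (A r)) \<Longrightarrow> m < k \<Longrightarrow> ser_pow A k m p = 0"
proof (induction k arbitrary: m)
  case (Suc k)
  then show ?case by (auto intro!: sum.neutral simp: lin_0)
qed simp

text \<open>With the Euler derivative \<open>E = z d/dz\<close> this says
  \<open>E (A^(k+1)) = (k+1) (E A) A^k\<close>, which is valid because the coefficients of
  \<open>A\<close> commute.\<close>

lemma ser_pow_rec:
  assumes lin: "\<And>r. r > 0 \<Longrightarrow> lin (A r)"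
    and comm: "\<And>r s p. r > 0 \<Longrightarrow> s > 0 \<Longrightarrow> A r (A s p) = A s (A r p)"
  shows "smK (of_nat m) (ser_pow A (Suc k) m p)
    = smK (of_nat (Suc k)) (\<Sum>r=1..m. smK (of_nat r) (A r (ser_pow A k (m - r) p)))"
proof (induction k arbitrary: m)
  case 0
  show ?case unfolding ser_pow.simps smK_sum
  proof (intro sum.cong refl)
    fix r assume "r \<in> {1..m}"
    then show "smK (of_nat m) (A r (if m - r = 0 then p else 0))
        = smK (of_nat (Suc 0)) (smK (of_nat r) (A r (if m - r = 0 then p else 0)))"
      using lin[of r] by (cases "m - r = 0") (auto simp: lin_0)
  qed
next
  case (Suc k)
  have "smK (of_nat m) (ser_pow A (Suc (Suc k)) m p) =
     (\<Sum>s=1..m. smK (of_nat m) (A s (ser_pow A (Suc k) (m - s) p)))"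
    unfolding ser_pow.simps(2)[of A "Suc k"] smK_sum ..
  \<comment> \<open>Leibniz rule: the degree \<open>m\<close> is split into the degree
    \<open>s\<close> of the outermost factor and the degree \<open>m - s\<close> of the remaining
    power, to which the induction hypothesis applies.\<close>
  also have "\<dots> = (\<Sum>s=1..m. smK (of_nat s) (A s (ser_pow A (Suc k) (m - s) p))
      + A s (smK (of_nat (m - s)) (ser_pow A (Suc k) (m - s) p)))"
  proof (intro sum.cong refl)
    fix s assume s: "s \<in> {1..m}"
    then have "(of_nat m :: scal) = of_nat s + of_nat (m - s)" by (simp flip: of_nat_add)
    moreover have "lin (A s)" using s by (auto intro: lin)
    ultimately show "smK (of_nat m) (A s (ser_pow A (Suc k) (m - s) p)) =
      smK (of_nat s) (A s (ser_pow A (Suc k) (m - s) p))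
      + A s (smK (of_nat (m - s)) (ser_pow A (Suc k) (m - s) p))"
      by (simp only: smK_add_left lin_smK)
  qed
  also have "\<dots> = (\<Sum>s=1..m. smK (of_nat s) (A s (ser_pow A (Suc k) (m - s) p)))
      + (\<Sum>s=1..m. \<Sum>r=1..m - s. smK (of_nat (Suc k)) (smK (of_nat r) (A s (A r (ser_pow A k (m - s - r) p)))))"
    unfolding sum.distrib Suc.IH using lin
    by (intro arg_cong2[where f = "(+)"] sum.cong refl) (simp add: lin_smK lin_sum smK_sum del: of_nat_Suc)
  also have "(\<Sum>s=1..m. \<Sum>r=1..m - s. smK (of_nat (Suc k)) (smK (of_nat r) (A s (A r (ser_pow A k (m - s - r) p)))))
     = (\<Sum>r=1..m. \<Sum>s=1..m - r. smK (of_nat (Suc k)) (smK (of_nat r) (A s (A r (ser_pow A k (m - s - r) p)))))"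
    unfolding sum.Sigma[OF finite_atLeastAtMost ballI[OF finite_atLeastAtMost]]
    by (rule sum.reindex_bij_witness[of _ "\<lambda>(a,b). (b,a)" "\<lambda>(a,b). (b,a)"]) auto
  also have "\<dots> = smK (of_nat (Suc k)) (\<Sum>r=1..m. smK (of_nat r) (A r (ser_pow A (Suc k) (m - r) p)))"
    unfolding smK_sum
  proof (intro sum.cong refl)
    fix r assume r: "r \<in> {1..m}"
    have "A s (A r (ser_pow A k (m - s - r) p)) = A r (A s (ser_pow A k (m - r - s) p))"
      if "s \<in> {1..m - r}" for s
      using that r comm[of s r] by (simp add: add.commute)
    then have "(\<Sum>s=1..m - r. A s (A r (ser_pow A k (m - s - r) p))) = A r (ser_pow A (Suc k) (m - r) p)"
      using r lin by (subst ser_pow.simps, subst lin_sum[of "A r"]) (auto intro!: sum.cong)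
    then show "(\<Sum>s=1..m - r. smK (of_nat (Suc k)) (smK (of_nat r) (A s (A r (ser_pow A k (m - s - r) p)))))
      = smK (of_nat (Suc k)) (smK (of_nat r) (A r (ser_pow A (Suc k) (m - r) p)))"
      by (simp only: flip: smK_sum)
  qed
  also have "(\<Sum>s=1..m. smK (of_nat s) (A s (ser_pow A (Suc k) (m - s) p))) +
      smK (of_nat (Suc k)) (\<Sum>r=1..m. smK (of_nat r) (A r (ser_pow A (Suc k) (m - r) p)))
    = smK (of_nat (Suc (Suc k))) (\<Sum>r=1..m. smK (of_nat r) (A r (ser_pow A (Suc k) (m - r) p)))"
    by (simp only: of_nat_Suc[of "Suc k"] smK_add_left smK_1)
  finally show ?case .
qed

text \<open>The division-free form of \<open>E (exp A) = (E A) (exp A)\<close> for the Euler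
  derivative \<open>E\<close>. Exponentials of operators are compared below through this
  recursion.\<close>

lemma ser_exp_rec:
  assumes lin: "\<And>r. r > 0 \<Longrightarrow> lin (A r)"
    and comm: "\<And>r s p. r > 0 \<Longrightarrow> s > 0 \<Longrightarrow> A r (A s p) = A s (A r p)"
  shows "of_nat m * ser_exp A m p = (\<Sum>r=1..m. of_nat r * A r (ser_exp A (m - r) p))"
proof (cases m)
  case (Suc m')
  \<comment> \<open>Powers beyond the degree vanish, so one common range of \<open>k\<close> serves
    all lower coefficients and the two sums can be exchanged.\<close>
  have ex: "ser_exp A j p = (\<Sum>k\<le>m'. smK (1 / of_nat (fact k)) (ser_pow A k j p))" if "j \<le> m'" for j
    unfolding ser_exp_def using that lin by (intro sum.mono_neutral_left) (auto simp: ser_pow_eq_0)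
  have "of_nat m * ser_exp A m p = (\<Sum>k\<le>m. smK (1 / of_nat (fact k)) (smK (of_nat m) (ser_pow A k m p)))"
    by (simp add: ser_exp_def sum_distrib_left mult_smK smK_of_nat)
  also have "\<dots> = (\<Sum>k\<le>m'. smK (1 / of_nat (fact (Suc k))) (smK (of_nat m) (ser_pow A (Suc k) m p)))"
    unfolding Suc by (subst sum.atMost_Suc_shift) (simp add: smK_0_left)
  also have "\<dots> = (\<Sum>k\<le>m'. smK (1 / of_nat (fact k)) (\<Sum>r=1..m. smK (of_nat r) (A r (ser_pow A k (m - r) p))))"
  proof (intro sum.cong refl)
    fix k
    have "(1 / of_nat (fact (Suc k)) :: scal) * of_nat (Suc k) = 1 / of_nat (fact k)"
      unfolding fact_Suc of_nat_id of_nat_mult by (simp del: of_nat_Suc)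
    then show "smK (1 / of_nat (fact (Suc k))) (smK (of_nat m) (ser_pow A (Suc k) m p))
        = smK (1 / of_nat (fact k)) (\<Sum>r=1..m. smK (of_nat r) (A r (ser_pow A k (m - r) p)))"
      by (simp only: ser_pow_rec[OF assms] smK_smK)
  qed
  also have "\<dots> = (\<Sum>r=1..m. smK (of_nat r) (A r (\<Sum>k\<le>m'. smK (1 / of_nat (fact k)) (ser_pow A k (m - r) p))))"
    unfolding smK_sum
    by (subst sum.swap) (use lin in \<open>auto simp: lin_sum lin_smK smK_sum smK_smK mult.commute intro!: sum.cong\<close>)
  also have "\<dots> = (\<Sum>r=1..m. of_nat r * A r (ser_exp A (m - r) p))"
  proof (intro sum.cong refl)
    fix r assume "r \<in> {1..m}"
    then have "m - r \<le> m'" using Suc by auto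
    then show "smK (of_nat r) (A r (\<Sum>k\<le>m'. smK (1 / of_nat (fact k)) (ser_pow A k (m - r) p)))
        = of_nat r * A r (ser_exp A (m - r) p)"
      by (simp only: ex smK_of_nat)
  qed
  finally show ?thesis .
qed simp

lemma ser_exp_0: "ser_exp A 0 p = p"
  by (simp add: ser_exp_def)

lemma fock_cancel:
  assumes "of_nat m * p = of_nat m * p'" "m > 0" shows "p = (p' :: fock)"
proof -
  have "of_nat m * (p - p') = 0" using assms by (simp add: right_diff_distrib)
  from fock_torsion[OF assms(2) this] show ?thesis by simp
qed

lemma monomial_induct [case_names zero add]:
  fixes \<mu> :: "'a \<Rightarrow>\<^sub>0 nat"
  assumes "P 0" "\<And>x \<mu>. P \<mu> \<Longrightarrow> P (single x 1 + \<mu>)"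
  shows "P \<mu>"
proof (induction \<mu> rule: update_induct)
  case const
  show ?case by (rule assms(1))
next
  case (update \<mu> k v)
  have s: "P (single k v + \<mu>)" for v
  proof (induction v)
    case (Suc v)
    have "single k (Suc v) + \<mu> = single k 1 + (single k v + \<mu>)"
      by (simp flip: add.assoc single_add)
    then show ?case using assms(2)[OF Suc] by simp
  qed (use update in simp)
  have "Poly_Mapping.update k v \<mu> = single k v + \<mu>"
    using update(1)
    by (intro poly_mapping_eqI) (auto simp: lookup_update lookup_add lookup_single when_def in_keys_iff)
  then show ?case using s by simp
qed

lemma poly_mapping_monomials: "p = (\<Sum>\<mu>\<in>keys p. single \<mu> (lookup p \<mu>))"
  by (rule poly_mapping_eqI) (simp add: lookup_sum lookup_single when_def in_keys_iff)

lemma smK_single: "smK c (single \<mu> b) = single \<mu> (c * b)"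
  by (rule poly_mapping_eqI) (simp add: lookup_smK lookup_single when_def)

text \<open>Identities for the shift \<open>Tc\<close> are proved by this induction; only the effect
  of one additional variable has to be computed.\<close>

lemma fock_induct [case_names add scale one var]:
  assumes add: "\<And>p p'. P p \<Longrightarrow> P p' \<Longrightarrow> P (p + p')" and sm: "\<And>c p. P p \<Longrightarrow> P (smK c p)"
    and one: "P 1" and var: "\<And>x p. P p \<Longrightarrow> P (var x * p)"
  shows "P (p :: fock)"
proof -
  have mono: "P (single \<mu> 1)" for \<mu>
  proof (induction \<mu> rule: monomial_induct)
    case zero
    then show ?case using one by simp
  next
    case (add x \<mu>)
    have "single (single x 1 + \<mu>) 1 = var x * single \<mu> 1"
      by (simp add: var_def mult_single)
    then show ?case using var[OF add] by simp
  qed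
  have zero: "P 0" using sm[OF one, of 0] by (simp add: smK_0_left)
  have "P (\<Sum>\<mu>\<in>I. single \<mu> (lookup p \<mu>))" for I
  proof (induction I rule: infinite_finite_induct)
    case (insert \<mu> I)
    have "P (single \<mu> (lookup p \<mu>))"
      using sm[OF mono, of "lookup p \<mu>"] by (simp add: smK_single)
    then show ?case using insert add by simp
  qed (use zero in auto)
  then show ?thesis by (subst poly_mapping_monomials[of p])
qed

text \<open>\<open>Hc n u m\<close> is the coefficient of \<open>z\<^sup>m\<close> in \<open>exp (\<Sum>u(i,r) a\<^sub>i(-r) z\<^sup>r)\<close>, and \<open>Tc n d m\<close> the
  coefficient of \<open>z\<^bsup>-m\<^esup>\<close> in the algebra homomorphism \<open>a\<^sub>i(-r) \<mapsto> a\<^sub>i(-r) + d(i,r) z\<^bsup>-r\<^esup>\<close>.\<close>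

definition Up :: "nat \<Rightarrow> (nat \<times> nat \<Rightarrow> scal) \<Rightarrow> nat \<Rightarrow> fock" where
  "Up n u r = (\<Sum>i=1..n. smK (u (i, r)) (var (i, r)))"

definition Dn :: "nat \<Rightarrow> (nat \<times> nat \<Rightarrow> scal) \<Rightarrow> nat \<Rightarrow> fock \<Rightarrow> fock" where
  "Dn n d r p = (\<Sum>i=1..n. smK (d (i, r)) (pdiff (i, r) p))"

definition Hc :: "nat \<Rightarrow> (nat \<times> nat \<Rightarrow> scal) \<Rightarrow> nat \<Rightarrow> fock" where
  "Hc n u m = ser_exp (\<lambda>r p. Up n u r * p) m 1"

definition Tc :: "nat \<Rightarrow> (nat \<times> nat \<Rightarrow> scal) \<Rightarrow> nat \<Rightarrow> fock \<Rightarrow> fock" where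
  "Tc n d m p = ser_exp (Dn n d) m p"

definition Hz :: "nat \<Rightarrow> (nat \<times> nat \<Rightarrow> scal) \<Rightarrow> int \<Rightarrow> fock" where
  "Hz n u m = (if m < 0 then 0 else Hc n u (nat m))"

lemma Hc_0: "Hc n u 0 = 1"
  by (simp add: Hc_def ser_exp_0)

lemma Hc_rec: "of_nat m * Hc n u m = (\<Sum>r=1..m. of_nat r * (Up n u r * Hc n u (m - r)))"
  unfolding Hc_def by (rule ser_exp_rec) (simp_all add: lin_mult mult.left_commute)

lemma is_exp_Hc: "is_exp (Up n u) (Abs_fps (Hc n u))"
  by (simp add: is_exp_def Hc_0 Hc_rec mult.assoc)

lemma ser_exp_mult: "ser_exp (\<lambda>r p. Up n u r * p) m p = Hc n u m * p"
proof (induction m rule: less_induct)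
  case (less m)
  show ?case
  proof (cases "m = 0")
    case False
    have "of_nat m * ser_exp (\<lambda>r p. Up n u r * p) m p
        = (\<Sum>r=1..m. of_nat r * (Up n u r * ser_exp (\<lambda>r p. Up n u r * p) (m - r) p))"
      by (rule ser_exp_rec) (simp_all add: lin_mult mult.left_commute)
    also have "\<dots> = (\<Sum>r=1..m. of_nat r * (Up n u r * Hc n u (m - r))) * p"
      using less False by (simp add: sum_distrib_right mult.assoc)
    also have "\<dots> = of_nat m * (Hc n u m * p)"
      by (simp only: Hc_rec[symmetric] mult.assoc)
    finally show ?thesis using False by (auto intro: fock_cancel)
  qed (simp add: Hc_0 ser_exp_0)
qed

lemma Hc_add: "Hc n (u + u') m = (\<Sum>k\<le>m. Hc n u k * Hc n u' (m - k))"
proof -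
  have "is_exp (Up n (u + u')) (Abs_fps (Hc n u) * Abs_fps (Hc n u'))"
    by (rule is_exp_mult[OF is_exp_Hc is_exp_Hc]) (simp add: Up_def smK_add_left sum.distrib)
  then have "Abs_fps (Hc n (u + u')) = Abs_fps (Hc n u) * Abs_fps (Hc n u')"
    by (rule is_exp_unique[OF is_exp_Hc]) (auto dest: fock_torsion)
  then have "fps_nth (Abs_fps (Hc n (u + u'))) m = fps_nth (Abs_fps (Hc n u) * Abs_fps (Hc n u')) m" by simp
  then show ?thesis by (simp add: fps_mult_nth atLeast0AtMost)
qed

text \<open>Multiplying \<open>u (i, r)\<close> by \<open>a ^ r\<close> amounts to the substitution
  of \<open>a z\<close> for \<open>z\<close>. The case \<open>a = 1\<close> is the congruence rule
  \<open>Hc_cong\<close>.\<close>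

lemma Hc_scale:
  assumes "\<And>i r. i \<in> {1..n} \<Longrightarrow> r > 0 \<Longrightarrow> u' (i, r) = a ^ r * u (i, r)"
  shows "Hc n u' m = smK (a ^ m) (Hc n u m)"
proof -
  \<comment> \<open>The scalar \<open>a\<close> as an element of \<open>fock\<close>, since
    \<open>is_exp_scale\<close> works inside one coefficient ring.\<close>
  define b where "b = (single 0 a :: fock)"
  have b: "smK (a ^ m) p = b ^ m * p" for m p
  proof (induction m)
    case (Suc m)
    have "smK a q = b * q" for q by (simp add: b_def smK_def mult_map_scale_conv_mult)
    then show ?case using Suc by (simp add: mult.assoc flip: smK_smK)
  qed simp
  have "is_exp (Up n u') (Abs_fps (\<lambda>m. b ^ m * fps_nth (Abs_fps (Hc n u)) m))"
    by (rule is_exp_scale[OF is_exp_Hc]) (simp add: Up_def assms b[symmetric] smK_sum smK_smK)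
  then have "Abs_fps (Hc n u') = Abs_fps (\<lambda>m. b ^ m * fps_nth (Abs_fps (Hc n u)) m)"
    by (rule is_exp_unique[OF is_exp_Hc]) (auto dest: fock_torsion)
  then show ?thesis unfolding b fps_eq_iff by simp
qed

lemma Hc_u0: "(\<And>i r. i \<in> {1..n} \<Longrightarrow> r > 0 \<Longrightarrow> u (i, r) = 0) \<Longrightarrow> Hc n u m = (if m = 0 then 1 else 0)"
proof -
  assume u: "\<And>i r. i \<in> {1..n} \<Longrightarrow> r > 0 \<Longrightarrow> u (i, r) = 0"
  have "is_exp (Up n u) 1" by (rule is_exp_0) (simp add: Up_def u smK_0_left)
  then have "Abs_fps (Hc n u) = 1"
    by (rule is_exp_unique[OF is_exp_Hc]) (auto dest: fock_torsion)
  then show ?thesis by (auto simp: fps_eq_iff)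
qed

lemma lin_Dn: "lin (Dn n d r)"
  unfolding lin_def Dn_def
  by (auto simp: pdiff_smK smK_smK smK_sum mult.commute sum.distrib[symmetric] smK_add[symmetric]
      intro!: sum.cong arg_cong2[where f = smK])
     (auto simp: lookup_pdiff lookup_add distrib_left intro!: poly_mapping_eqI)

lemma Dn_commute: "Dn n d r (Dn n d s p) = Dn n d s (Dn n d r p)"
  unfolding Dn_def by (simp add: pdiff_sum pdiff_smK smK_sum smK_smK, subst sum.swap)
     (simp add: pdiff_commute[of "(_, r)"] mult.commute)

lemma Tc_rec: "of_nat m * Tc n d m p = (\<Sum>r=1..m. of_nat r * Dn n d r (Tc n d (m - r) p))"
  unfolding Tc_def by (rule ser_exp_rec) (simp_all add: lin_Dn Dn_commute)

lemma Tc_0 [simp]: "Tc n d 0 p = p"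
  by (simp add: Tc_def ser_exp_0)

lemma lin_Tc: "lin (Tc n d m)"
  unfolding Tc_def[abs_def] by (rule lin_ser_exp) (rule lin_Dn)

lemma Tc_add_arg: "Tc n d m (p + p') = Tc n d m p + Tc n d m p'"
  using lin_Tc by (simp add: lin_def)

lemma Tc_smK: "Tc n d m (smK c p) = smK c (Tc n d m p)"
  using lin_Tc by (simp add: lin_def)

lemma Tc_zero [simp]: "Tc n d m 0 = 0"
  by (rule lin_0[OF lin_Tc])

lemma Tc_sum: "Tc n d m (\<Sum>i\<in>I. f i) = (\<Sum>i\<in>I. Tc n d m (f i))"
  by (rule lin_sum[OF lin_Tc])

lemma pdiff_1 [simp]: "pdiff x 1 = 0"
  by (simp add: pdiff_def)

lemma Tc_1: "Tc n d m 1 = (if m = 0 then 1 else 0)"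
proof (induction m rule: less_induct)
  case (less m)
  show ?case
  proof (cases "m = 0")
    case False
    have "Dn n d r (Tc n d (m - r) 1) = 0" if "r \<in> {1..m}" for r
      using less[of "m - r"] that False lin_0[OF lin_Dn] by (auto simp: Dn_def)
    then have "of_nat m * Tc n d m 1 = 0" by (simp add: Tc_rec)
    then show ?thesis using False by (auto dest: fock_torsion)
  qed simp
qed

text \<open>The amount by which \<open>Tc n d\<close> really shifts the variable \<open>x\<close>:
  the type also contains variables of index 0 or outside \<open>{1..n}\<close>, and these stay
  fixed.\<close>

definition var_coeff :: "nat \<Rightarrow> (nat \<times> nat \<Rightarrow> scal) \<Rightarrow> nat \<times> nat \<Rightarrow> scal" where
  "var_coeff n d x = (if fst x \<in> {1..n} \<and> snd x > 0 then d x else 0)"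

lemma Dn_var:
  assumes "r > 0"
  shows "Dn n d r (var x * p) = var x * Dn n d r p + (if r = snd x then smK (var_coeff n d x) p else 0)"
proof -
  have "Dn n d r (var x * p) = (\<Sum>i=1..n. smK (d (i, r)) (if (i, r) = x then p else 0)
     + var x * smK (d (i, r)) (pdiff (i, r) p))"
    unfolding Dn_def by (intro sum.cong refl) (simp add: pdiff_var_mult smK_add mult_smK)
  also have "\<dots> = (\<Sum>i=1..n. if i = fst x then (if r = snd x then smK (d x) p else 0) else 0)
     + var x * Dn n d r p"
    unfolding sum.distrib Dn_def sum_distrib_left
    by (intro arg_cong2[where f = "(+)"] sum.cong refl) (cases x, auto)
  finally show ?thesis using assms by (auto simp: var_coeff_def smK_0_left)
qed

text \<open>The exponential of a derivation with scalar values on the variables is a substitution: a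
  variable contributes only its terms of order 0 and 1. This justifies reading \<open>Tc\<close> as
  a shift of the variables.\<close>

lemma Tc_var: "Tc n d m (var x * p) = var x * Tc n d m p
   + (if snd x \<le> m then smK (var_coeff n d x) (Tc n d (m - snd x) p) else 0)"
proof (induction m rule: less_induct)
  case (less m)
  define s \<delta> where "s = snd x" and "\<delta> = var_coeff n d x"
  have \<delta>0: "\<delta> = 0" if "s = 0" using that by (simp add: s_def \<delta>_def var_coeff_def)
  show ?case
  proof (cases "m = 0")
    case True
    then show ?thesis using \<delta>0 by (auto simp: s_def \<delta>_def smK_0_left)
  next
    case False
    have "of_nat m * Tc n d m (var x * p) = (\<Sum>r=1..m. of_nat r * Dn n d r (Tc n d (m - r) (var x * p)))"
      by (rule Tc_rec)
    also have "\<dots> = (\<Sum>r=1..m. var x * (of_nat r * Dn n d r (Tc n d (m - r) p))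
         + (if r = s then of_nat r * smK \<delta> (Tc n d (m - r) p) else 0)
         + smK \<delta> (if r \<in> {1..m - s} \<and> s \<le> m then of_nat r * Dn n d r (Tc n d (m - s - r) p) else 0))"
    proof (intro sum.cong refl)
      fix r assume r: "r \<in> {1..m}"
      have "Tc n d (m - r) (var x * p) = var x * Tc n d (m - r) p
        + (if s \<le> m - r then smK \<delta> (Tc n d (m - r - s) p) else 0)"
        using less[of "m - r"] r False by (simp add: s_def \<delta>_def)
      then have "Dn n d r (Tc n d (m - r) (var x * p)) = var x * Dn n d r (Tc n d (m - r) p)
         + (if r = s then smK \<delta> (Tc n d (m - r) p) else 0)
         + (if s \<le> m - r then smK \<delta> (Dn n d r (Tc n d (m - r - s) p)) else 0)"
        using lin_Dn[of n d r] lin_0[OF lin_Dn, of n d r] r by (auto simp: lin_def Dn_var s_def \<delta>_def)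
      moreover have "s \<le> m - r \<longleftrightarrow> r \<in> {1..m - s} \<and> s \<le> m" "m - r - s = m - s - r" using r by auto
      ultimately show "of_nat r * Dn n d r (Tc n d (m - r) (var x * p)) =
         var x * (of_nat r * Dn n d r (Tc n d (m - r) p))
         + (if r = s then of_nat r * smK \<delta> (Tc n d (m - r) p) else 0)
         + smK \<delta> (if r \<in> {1..m - s} \<and> s \<le> m then of_nat r * Dn n d r (Tc n d (m - s - r) p) else 0)"
        by (simp add: distrib_left mult_smK mult.left_commute)
    qed
    also have "\<dots> = var x * (of_nat m * Tc n d m p)
       + (if s \<in> {1..m} then of_nat s * smK \<delta> (Tc n d (m - s) p) else 0)
       + smK \<delta> (if s \<le> m then of_nat (m - s) * Tc n d (m - s) p else 0)"
    proof -
      have "(\<Sum>r=1..m. if r \<in> {1..m - s} \<and> s \<le> m then of_nat r * Dn n d r (Tc n d (m - s - r) p) else 0)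
        = (if s \<le> m then of_nat (m - s) * Tc n d (m - s) p else 0)"
        unfolding Tc_rec[of "m - s"] by (auto intro!: sum.mono_neutral_cong_right)
      moreover have "(\<Sum>r=1..m. if r = s then of_nat r * smK \<delta> (Tc n d (m - r) p) else 0)
        = (if s \<in> {1..m} then of_nat s * smK \<delta> (Tc n d (m - s) p) else 0)" by simp
      ultimately show ?thesis
        unfolding sum.distrib smK_sum[symmetric] sum_distrib_left[symmetric] Tc_rec[of m, symmetric]
        by simp
    qed
    also have "\<dots> = of_nat m * (var x * Tc n d m p + (if s \<le> m then smK \<delta> (Tc n d (m - s) p) else 0))"
    proof (cases "s \<le> m")
      case True
      \<comment> \<open>The derivative that hits \<open>x\<close> supplies the share
        \<open>s\<close>, the recursion for the remaining factor the share
        \<open>m - s\<close>.\<close>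
      then have "(of_nat m :: fock) = of_nat s + of_nat (m - s)" by (simp flip: of_nat_add)
      then show ?thesis using True \<delta>0
        by (cases "s = 0")
           (simp_all add: smK_0_left mult_smK distrib_right distrib_left smK_add[symmetric] del: of_nat_diff)
    qed (simp add: algebra_simps)
    finally show ?thesis using False unfolding s_def \<delta>_def by (auto intro: fock_cancel)
  qed
qed

lemma sum_shift_conv:
  fixes s m :: nat
  shows "(\<Sum>k\<le>m. if s \<le> k then f (k - s) (m - k) else 0) = (if s \<le> m then \<Sum>k\<le>m - s. f k (m - s - k) else (0::'a::comm_monoid_add))"
proof (cases "s \<le> m")
  case True
  have "(\<Sum>k\<le>m. if s \<le> k then f (k - s) (m - k) else 0) = (\<Sum>k\<in>{s..m}. f (k - s) (m - k))"
    by (intro sum.mono_neutral_cong_right) auto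
  also have "\<dots> = (\<Sum>k\<le>m - s. f k (m - s - k))"
    by (rule sum.reindex_bij_witness[of _ "\<lambda>k. k + s" "\<lambda>k. k - s"]) (use True in auto)
  finally show ?thesis using True by simp
qed (auto intro: sum.neutral)

lemma sum_shift_conv':
  fixes s m :: nat
  shows "(\<Sum>k\<le>m. if s \<le> m - k then f k (m - k - s) else 0) = (if s \<le> m then \<Sum>k\<le>m - s. f k (m - s - k) else (0::'a::comm_monoid_add))"
proof (cases "s \<le> m")
  case True
  have "(\<Sum>k\<le>m. if s \<le> m - k then f k (m - k - s) else 0) = (\<Sum>k\<le>m - s. f k (m - s - k))"
    using True by (intro sum.mono_neutral_cong_right) (auto simp: add.commute)
  then show ?thesis using True by simp
next
  case False
  then have "\<not> s \<le> m - k" for k by linarith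
  then show ?thesis using False by simp
qed

text \<open>Shifting the variables is an algebra homomorphism; by \<open>Tc_var\<close> the claim
  survives the addition of one variable to the first factor.\<close>

lemma Tc_mult: "Tc n d m (p * p') = (\<Sum>k\<le>m. Tc n d k p * Tc n d (m - k) p')"
proof (induction p arbitrary: m rule: fock_induct)
  case (add p p')
  then show ?case by (simp add: distrib_right Tc_add_arg sum.distrib)
next
  case (scale c p)
  then show ?case by (simp add: smK_mult Tc_smK smK_sum)
next
  case one
  have "(\<Sum>k\<le>m. Tc n d k 1 * Tc n d (m - k) p') = (\<Sum>k\<in>{0}. Tc n d k 1 * Tc n d (m - k) p')"
    by (intro sum.mono_neutral_right) (auto simp: Tc_1)
  then show ?case by simp
next
  case (var x p)
  let ?s = "snd x" and ?\<delta> = "var_coeff n d x"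
  have "(\<Sum>k\<le>m. Tc n d k (var x * p) * Tc n d (m - k) p')
     = var x * (\<Sum>k\<le>m. Tc n d k p * Tc n d (m - k) p')
       + smK ?\<delta> (\<Sum>k\<le>m. if ?s \<le> k then Tc n d (k - ?s) p * Tc n d (m - k) p' else 0)"
    unfolding sum_distrib_left smK_sum sum.distrib[symmetric]
    by (intro sum.cong refl) (simp add: Tc_var distrib_right smK_mult mult.assoc)
  then show ?case
    unfolding sum_shift_conv[where f = "\<lambda>a b. Tc n d a p * Tc n d b p'"]
    by (simp add: mult.assoc Tc_var var)
qed

lemma var_coeff_add: "var_coeff n (d + d') x = var_coeff n d x + var_coeff n d' x"
  by (simp add: var_coeff_def)

text \<open>Successive shifts add up. It makes normally ordered products and compositions with
  \<open>\<psi>_j\<close> stay within the same family of operators.\<close>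

lemma Tc_add: "Tc n (d + d') m p = (\<Sum>k\<le>m. Tc n d k (Tc n d' (m - k) p))"
proof (induction p arbitrary: m rule: fock_induct)
  case (add p p')
  then show ?case by (simp add: Tc_add_arg sum.distrib)
next
  case (scale c p)
  then show ?case by (simp add: Tc_smK smK_sum)
next
  case one
  have "(\<Sum>k\<le>m. Tc n d k (Tc n d' (m - k) 1)) = (\<Sum>k\<in>{m}. Tc n d k (Tc n d' (m - k) 1))"
    by (intro sum.mono_neutral_right) (auto simp: Tc_1)
  then show ?case by (simp add: Tc_1)
next
  case (var x p)
  let ?s = "snd x" and ?\<delta> = "var_coeff n d x" and ?\<delta>' = "var_coeff n d' x"
  have "(\<Sum>k\<le>m. Tc n d k (Tc n d' (m - k) (var x * p)))
     = var x * (\<Sum>k\<le>m. Tc n d k (Tc n d' (m - k) p))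
       + smK ?\<delta> (\<Sum>k\<le>m. if ?s \<le> k then Tc n d (k - ?s) (Tc n d' (m - k) p) else 0)
       + smK ?\<delta>' (\<Sum>k\<le>m. if ?s \<le> m - k then Tc n d k (Tc n d' (m - k - ?s) p) else 0)"
    unfolding sum_distrib_left smK_sum sum.distrib[symmetric]
    by (intro sum.cong refl) (auto simp: Tc_var Tc_add_arg Tc_smK)
  then show ?case
    unfolding sum_shift_conv[where f = "\<lambda>a b. Tc n d a (Tc n d' b p)"]
      sum_shift_conv'[where f = "\<lambda>a b. Tc n d a (Tc n d' b p)"]
    by (simp add: Tc_var[of n "d + d'"] var var_coeff_add smK_add_left smK_add del: plus_fun_apply)
qed

lemma Tc_scale:
  assumes "\<And>i r. i \<in> {1..n} \<Longrightarrow> r > 0 \<Longrightarrow> d' (i, r) = a ^ r * d (i, r)"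
  shows "Tc n d' m p = smK (a ^ m) (Tc n d m p)"
proof (induction p arbitrary: m rule: fock_induct)
  case (add p p')
  then show ?case by (simp add: Tc_add_arg smK_add)
next
  case (scale c p)
  then show ?case by (simp add: Tc_smK smK_smK mult.commute)
next
  case (var x p)
  have "var_coeff n d' x = a ^ snd x * var_coeff n d x"
    using assms[of "fst x" "snd x"] by (auto simp: var_coeff_def)
  moreover have "a ^ m = a ^ snd x * a ^ (m - snd x)" if "snd x \<le> m"
    using that by (simp flip: power_add)
  ultimately show ?case unfolding Tc_var var by (auto simp: smK_add mult_smK smK_smK mult_ac)
qed (simp add: Tc_1)

lemma Tc_cong:
  assumes "\<And>i r. i \<in> {1..n} \<Longrightarrow> r > 0 \<Longrightarrow> d' (i, r) = d (i, r)"
  shows "Tc n d' m p = Tc n d m p"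
  using Tc_scale[of n d' 1 d m p] assms by simp

lemma Hc_cong:
  assumes "\<And>i r. i \<in> {1..n} \<Longrightarrow> r > 0 \<Longrightarrow> u' (i, r) = u (i, r)"
  shows "Hc n u' m = Hc n u m"
  using Hc_scale[of n u' 1 u m] assms by simp

text \<open>The bound is uniform in the shifts and covers two successive ones, because a product of
  two operators applies both their shifts to the same polynomial.\<close>

definition tbound :: "nat \<Rightarrow> fock \<Rightarrow> nat \<Rightarrow> bool" where
  "tbound n p B \<longleftrightarrow> (\<forall>d d' l l'. l > B \<or> l' > B \<longrightarrow> Tc n d l (Tc n d' l' p) = 0)"

lemma tbound_mono: "tbound n p B \<Longrightarrow> B \<le> B' \<Longrightarrow> tbound n p B'"
  unfolding tbound_def by (meson le_less_trans)

lemma tbound_ex: "\<exists>B. tbound n p B"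
proof (induction p rule: fock_induct)
  case (add p p')
  then obtain B B' where "tbound n p B" "tbound n p' B'" by blast
  then have "tbound n p (max B B')" "tbound n p' (max B B')" by (auto elim: tbound_mono)
  then have "tbound n (p + p') (max B B')" unfolding tbound_def by (auto simp: Tc_add_arg)
  then show ?case ..
next
  case (scale c p)
  then show ?case unfolding tbound_def by (metis Tc_smK smK_zero)
next
  case one
  show ?case by (rule exI[of _ 0]) (auto simp: tbound_def Tc_1)
next
  case (var x p)
  then obtain B where B: "tbound n p B" by blast
  have "Tc n d l (Tc n d' l' (var x * p)) = 0" if "l > B + snd x \<or> l' > B + snd x" for d d' l l'
  proof -
    have "Tc n d l (Tc n d' l' p) = 0"
      "snd x \<le> l \<Longrightarrow> Tc n d (l - snd x) (Tc n d' l' p) = 0"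
      "snd x \<le> l' \<Longrightarrow> Tc n d l (Tc n d' (l' - snd x) p) = 0"
      using B that unfolding tbound_def
      by (metis add_lessD1, metis add_lessD1 less_diff_conv, metis add_lessD1 less_diff_conv)
    then show ?thesis by (simp add: Tc_var Tc_add_arg Tc_smK)
  qed
  then show ?case unfolding tbound_def by blast
qed

lemma tbound_Tc: "tbound n p B \<Longrightarrow> l > B \<Longrightarrow> Tc n d l p = 0"
  unfolding tbound_def by (metis Tc_0)

section \<open>Contractions and normal ordering on the polynomial algebra\<close>

lemma Hz_neg [simp]: "m < 0 \<Longrightarrow> Hz n u m = 0"
  by (simp add: Hz_def)

lemma Tc_Up: "r > 0 \<Longrightarrow> Tc n d l (Up n u r * q) = Up n u r * Tc n d l q
    + (if r \<le> l then smK (\<Sum>i=1..n. d (i, r) * u (i, r)) (Tc n d (l - r) q) else 0)"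
  unfolding Up_def sum_distrib_right smK_mult Tc_sum Tc_smK Tc_var smK_add sum.distrib smK_sum_left
  by (auto simp: smK_smK var_coeff_def mult.commute[of "d _"] intro!: sum.cong)

text \<open>A shift changes the exponent of \<open>exp (sum u(i,r) a_i(-r) w^r)\<close> only by the
  scalar series \<open>sum d(i,r) u(i,r) (w/z)^r\<close>, so the exponential is reproduced up to the
  factor \<open>C (w/z)\<close>. This factor is the contraction.\<close>

lemma Tc_Hc:
  assumes C: "is_exp (\<lambda>r. \<Sum>i=1..n. d (i, r) * u (i, r)) C"
  shows "Tc n d l (Hc n u m) = (if l \<le> m then smK (fps_nth C l) (Hc n u (m - l)) else 0)"
proof (induction m arbitrary: l rule: less_induct)
  case (less m)
  define c where "c r = (\<Sum>i=1..n. d (i, r) * u (i, r))" for r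
  have C0: "fps_nth C 0 = 1" and Cr: "of_nat l * fps_nth C l = (\<Sum>r=1..l. of_nat r * c r * fps_nth C (l - r))" for l
    using C by (auto simp: is_exp_def c_def)
  show ?case
  proof (cases "m = 0")
    case True
    then show ?thesis by (auto simp: Hc_0 Tc_1 C0)
  next
    case False
    have "of_nat m * Tc n d l (Hc n u m) = (\<Sum>r=1..m. of_nat r * Tc n d l (Up n u r * Hc n u (m - r)))"
      unfolding smK_of_nat[symmetric] Tc_smK[symmetric] Tc_sum[symmetric]
      using Hc_rec[of m n u] by (simp only: smK_of_nat)
    also have "\<dots> = (\<Sum>r=1..m. (if r \<le> m - l \<and> l \<le> m then smK (fps_nth C l) (of_nat r * (Up n u r * Hc n u (m - l - r))) else 0)
      + (if r \<le> l \<and> l \<le> m then smK (of_nat r * c r * fps_nth C (l - r)) (Hc n u (m - l)) else 0))"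
    proof (intro sum.cong refl)
      fix r assume r: "r \<in> {1..m}"
      have a: "Tc n d l (Hc n u (m - r)) = (if r \<le> m - l \<and> l \<le> m then smK (fps_nth C l) (Hc n u (m - l - r)) else 0)"
        using r False less[of "m - r" l] by (auto simp: add.commute)
      have b: "Tc n d (l - r) (Hc n u (m - r)) = (if l \<le> m then smK (fps_nth C (l - r)) (Hc n u (m - l)) else 0)" if "r \<le> l"
        using r False less[of "m - r" "l - r"] that by auto
      have e: "Tc n d l (Up n u r * Hc n u (m - r)) = Up n u r * Tc n d l (Hc n u (m - r))
         + (if r \<le> l then smK (c r) (Tc n d (l - r) (Hc n u (m - r))) else 0)"
        using r by (simp add: Tc_Up c_def)
      show "of_nat r * Tc n d l (Up n u r * Hc n u (m - r)) =
        (if r \<le> m - l \<and> l \<le> m then smK (fps_nth C l) (of_nat r * (Up n u r * Hc n u (m - l - r))) else 0)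
        + (if r \<le> l \<and> l \<le> m then smK (of_nat r * c r * fps_nth C (l - r)) (Hc n u (m - l)) else 0)"
        using r by (auto simp: e a b distrib_left mult_smK smK_smK smK_of_nat[symmetric] mult_ac)
    qed
    also have "\<dots> = of_nat m * (if l \<le> m then smK (fps_nth C l) (Hc n u (m - l)) else 0)"
    proof (cases "l \<le> m")
      case True
      have "(\<Sum>r=1..m. if r \<le> m - l \<and> l \<le> m then smK (fps_nth C l) (of_nat r * (Up n u r * Hc n u (m - l - r))) else 0)
         = smK (fps_nth C l) (\<Sum>r=1..m - l. of_nat r * (Up n u r * Hc n u (m - l - r)))"
        unfolding smK_sum using True by (intro sum.mono_neutral_cong_right) auto
      also have "\<dots> = smK (of_nat (m - l)) (smK (fps_nth C l) (Hc n u (m - l)))"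
        by (simp only: Hc_rec[symmetric] smK_of_nat mult_smK)
      finally have 1: "(\<Sum>r=1..m. if r \<le> m - l \<and> l \<le> m then smK (fps_nth C l) (of_nat r * (Up n u r * Hc n u (m - l - r))) else 0)
         = smK (of_nat (m - l)) (smK (fps_nth C l) (Hc n u (m - l)))" .
      have "(\<Sum>r=1..m. if r \<le> l \<and> l \<le> m then smK (of_nat r * c r * fps_nth C (l - r)) (Hc n u (m - l)) else 0)
         = smK (\<Sum>r=1..l. of_nat r * c r * fps_nth C (l - r)) (Hc n u (m - l))"
        unfolding smK_sum_left using True by (intro sum.mono_neutral_cong_right) auto
      also have "\<dots> = smK (of_nat l) (smK (fps_nth C l) (Hc n u (m - l)))"
        by (simp only: Cr smK_smK)
      finally have 2: "(\<Sum>r=1..m. if r \<le> l \<and> l \<le> m then smK (of_nat r * c r * fps_nth C (l - r)) (Hc n u (m - l)) else 0)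
         = smK (of_nat l) (smK (fps_nth C l) (Hc n u (m - l)))" .
      have "(of_nat m :: scal) = of_nat (m - l) + of_nat l" using True by (simp flip: of_nat_add)
      then show ?thesis unfolding sum.distrib 1 2 using True
        by (simp only: smK_of_nat[symmetric] smK_add_left if_True)
    qed (auto intro: sum.neutral)
    finally show ?thesis using False by (auto intro: fock_cancel)
  qed
qed

lemma Tc_Hz:
  assumes C: "is_exp (\<lambda>r. \<Sum>i=1..n. d (i, r) * u (i, r)) C"
  shows "Tc n d l (Hz n u m) = smK (fps_nth C l) (Hz n u (m - int l))"
  using Tc_Hc[OF C, of l "nat m"] by (auto simp: Hz_def nat_diff_distrib)

lemma Tc_Hz_mult:
  assumes C: "is_exp (\<lambda>r. \<Sum>i=1..n. d (i, r) * u (i, r)) C"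
  shows "Tc n d l (Hz n u m * p) = (\<Sum>k\<le>l. smK (fps_nth C k) (Hz n u (m - int k) * Tc n d (l - k) p))"
  by (simp add: Tc_mult Tc_Hz[OF C] smK_mult)

text \<open>The product formula \<open>Hc_add\<close> with displaced indices; the summation window
  contains the support of the summands for all displacements up to \<open>B\<close>, so it can be
  chosen before \<open>l\<close> and \<open>l'\<close>.\<close>

lemma Hz_add:
  assumes "l \<le> B" "l' \<le> B"
  shows "(\<Sum>x\<in>{- int B..Y + int B}. Hz n u (x + int l) * Hz n u' (Y - x + int l')) = Hz n (u + u') (Y + int l + int l')"
proof (cases "Y + int l + int l' < 0")
  case True
  have "Hz n u (x + int l) * Hz n u' (Y - x + int l') = 0" for x
  proof (cases "x + int l < 0")
    case False
    then have "Y - x + int l' < 0" using True by linarith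
    then show ?thesis by simp
  qed simp
  then show ?thesis using True by (simp add: sum.neutral)
next
  case False
  define M where "M = nat (Y + int l + int l')"
  have "(\<Sum>x\<in>{- int B..Y + int B}. Hz n u (x + int l) * Hz n u' (Y - x + int l'))
    = (\<Sum>x\<in>{- int l..Y + int l'}. Hz n u (x + int l) * Hz n u' (Y - x + int l'))"
    using assms by (intro sum.mono_neutral_right) auto
  also have "\<dots> = (\<Sum>k\<le>M. Hc n u k * Hc n u' (M - k))"
    by (rule sum.reindex_bij_witness[of _ "\<lambda>k. int k - int l" "\<lambda>x. nat (x + int l)"])
       (use False in \<open>auto simp: M_def Hz_def nat_diff_distrib algebra_simps intro!: arg_cong2[where f = "(*)"] arg_cong[where f = "Hc n u'"]\<close>)
  finally show ?thesis using False by (simp add: Hc_add Hz_def M_def)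
qed

text \<open>The coefficient of \<open>z\<^sup>m\<close> in \<open>exp (\<Sum>u(i,r) a\<^sub>i(-r) z\<^sup>r) \<circ> (a\<^sub>i(-r) \<mapsto> a\<^sub>i(-r) + d(i,r) z\<^bsup>-r\<^esup>)\<close>, and
  the coefficient of \<open>z\<^sub>1\<^sup>x z\<^sup>y\<close> in the normally ordered product of two such operators.\<close>

definition Lc :: "nat \<Rightarrow> (nat \<times> nat \<Rightarrow> scal) \<Rightarrow> (nat \<times> nat \<Rightarrow> scal) \<Rightarrow> fock \<Rightarrow> int \<Rightarrow> fock" where
  "Lc n u d p m = Sum_any (\<lambda>l. Hz n u (m + int l) * Tc n d l p)"

definition Nc :: "nat \<Rightarrow> (nat \<times> nat \<Rightarrow> scal) \<Rightarrow> (nat \<times> nat \<Rightarrow> scal) \<Rightarrow> (nat \<times> nat \<Rightarrow> scal)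
    \<Rightarrow> (nat \<times> nat \<Rightarrow> scal) \<Rightarrow> nat \<Rightarrow> fock \<Rightarrow> int \<Rightarrow> int \<Rightarrow> fock" where
  "Nc n u d u' d' B p x y = (\<Sum>l\<le>B. \<Sum>l'\<le>B.
     Hz n u (x + int l) * (Hz n u' (y + int l') * Tc n d l (Tc n d' l' p)))"

lemma Lc_eq:
  assumes "\<And>l. l > B \<Longrightarrow> Tc n d l p = 0"
  shows "Lc n u d p m = (\<Sum>l\<le>B. Hz n u (m + int l) * Tc n d l p)"
  unfolding Lc_def
proof (rule Sum_any.expand_superset)
  show "{l. Hz n u (m + int l) * Tc n d l p \<noteq> 0} \<subseteq> {..B}"
    using assms by (auto simp: not_le intro: ccontr)
qed simp

lemma Lc_tbound: "tbound n p B \<Longrightarrow> Lc n u d p m = (\<Sum>l\<le>B. Hz n u (m + int l) * Tc n d l p)"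
  by (rule Lc_eq) (rule tbound_Tc)

lemma Lc_add: "Lc n u d (p + p') m = Lc n u d p m + Lc n u d p' m"
proof -
  obtain B B' where "tbound n p B" "tbound n p' B'" using tbound_ex by blast
  then have "tbound n p (max B B')" "tbound n p' (max B B')" by (auto elim: tbound_mono)
  note B = this
  then have "tbound n (p + p') (max B B')" unfolding tbound_def by (auto simp: Tc_add_arg)
  then show ?thesis using B by (simp add: Lc_tbound Tc_add_arg distrib_left sum.distrib)
qed

lemma Lc_smK: "Lc n u d (smK c p) m = smK c (Lc n u d p m)"
proof -
  obtain B where B: "tbound n p B" using tbound_ex by blast
  then have "tbound n (smK c p) B" unfolding tbound_def by (simp add: Tc_smK)
  then show ?thesis using B by (simp add: Lc_tbound Tc_smK mult_smK smK_sum)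
qed

lemma Lc_0 [simp]: "Lc n u d 0 m = 0"
  using Lc_smK[of n u d 0 0 m] by (simp add: smK_0_left)

lemma Lc_low: "tbound n p B \<Longrightarrow> m < - int B \<Longrightarrow> Lc n u d p m = 0"
  by (simp add: Lc_tbound)

lemma Lc_cong:
  assumes "\<And>i r. i \<in> {1..n} \<Longrightarrow> r > 0 \<Longrightarrow> u' (i, r) = u (i, r)"
    "\<And>i r. i \<in> {1..n} \<Longrightarrow> r > 0 \<Longrightarrow> d' (i, r) = d (i, r)"
  shows "Lc n u' d' p m = Lc n u d p m"
proof -
  have "Hz n u' k * Tc n d' l p = Hz n u k * Tc n d l p" for k l
    unfolding Hz_def using Hc_cong[of n u' u, OF assms(1)] Tc_cong[of n d' d, OF assms(2)] by simp
  then show ?thesis unfolding Lc_def by simp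
qed

text \<open>Replacing \<open>z\<close> by \<open>a z\<close>: creating parts come with positive and
  shifts with negative powers of \<open>z\<close>, hence the inverse in the scaling of
  \<open>d\<close>.\<close>

lemma Lc_scale:
  assumes "a \<noteq> 0"
    and u: "\<And>i r. i \<in> {1..n} \<Longrightarrow> r > 0 \<Longrightarrow> u' (i, r) = a ^ r * u (i, r)"
    and d: "\<And>i r. i \<in> {1..n} \<Longrightarrow> r > 0 \<Longrightarrow> d' (i, r) = inverse a ^ r * d (i, r)"
  shows "Lc n u' d' p m = smK (a powi m) (Lc n u d p m)"
proof -
  obtain B where B: "tbound n p B" using tbound_ex by blast
  have "Hz n u' (m + int l) * Tc n d' l p = smK (a powi m) (Hz n u (m + int l) * Tc n d l p)" for l
  proof (cases "m + int l < 0")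
    case False
    have "a ^ nat (m + int l) * inverse a ^ l = a powi m"
    proof -
      have "a ^ nat (m + int l) = a powi (m + int l)" using False by (simp add: power_int_def)
      also have "\<dots> = a powi m * a ^ l" using assms(1) by (simp add: power_int_add)
      finally show ?thesis using assms(1) by (simp add: field_simps)
    qed
    moreover have "Hc n u' k = smK (a ^ k) (Hc n u k)" "Tc n d' l p = smK (inverse a ^ l) (Tc n d l p)" for k
      using Hc_scale[of n u', OF u] Tc_scale[of n d', OF d] by auto
    ultimately show ?thesis using False mult.commute[of "a ^ nat (m + int l)" "inverse a ^ l"]
      by (simp add: Hz_def mult_smK smK_mult smK_smK)
  qed simp
  then show ?thesis by (simp add: Lc_tbound[OF B] smK_sum)
qed

lemma Nc_low: "x < - int B \<or> y < - int B \<Longrightarrow> Nc n u d u' d' B p x y = 0"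
  by (auto simp: Nc_def)

text \<open>Moving the annihilating part of the first operator through the creating part of the second one
  produces the contraction series \<open>C(z/z\<^sub>1)\<close>.\<close>

lemma Lc_Lc:
  assumes C: "is_exp (\<lambda>r. \<Sum>i=1..n. d (i, r) * u' (i, r)) C"
    and B: "tbound n p B" and K: "y + int B \<le> int K"
  shows "Lc n u d (Lc n u' d' p y) x
    = (\<Sum>k\<le>K. smK (fps_nth C k) (Nc n u d u' d' B p (x + int k) (y - int k)))"
proof -
  define f where "f l' k j = smK (fps_nth C k) (Hz n u (x + int k + int j) *
      (Hz n u' (y - int k + int l') * Tc n d j (Tc n d' l' p)))" for l' k j
  have f0: "f l' k j = 0" if "l' \<le> B" "k > K \<or> j > B" for l' k j
  proof -
    have "j > B \<Longrightarrow> Tc n d j (Tc n d' l' p) = 0" using B by (auto simp: tbound_def)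
    then show ?thesis using that K by (auto simp: f_def)
  qed
  have T: "Tc n d l (Lc n u' d' p y) = (\<Sum>l'\<le>B. \<Sum>k\<le>l. smK (fps_nth C k)
      (Hz n u' (y + int l' - int k) * Tc n d (l - k) (Tc n d' l' p)))" for l
    by (simp add: Lc_tbound[OF B] Tc_sum Tc_Hz_mult[OF C])
  have T': "Hz n u (x + int l) * Tc n d l (Lc n u' d' p y) = (\<Sum>l'\<le>B. \<Sum>k\<le>l. f l' k (l - k))" for l
    unfolding T sum_distrib_left by (intro sum.cong refl) (auto simp: f_def mult_smK algebra_simps of_nat_diff)
  \<comment> \<open>A shift of order \<open>l > K + B\<close> puts more than \<open>B\<close> on the
    polynomial or more than \<open>K\<close> on the exponential, and \<open>K\<close> bounds the
    degree available there.\<close>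
  have "Tc n d l (Lc n u' d' p y) = 0" if "l > K + B" for l
    unfolding T
  proof (intro sum.neutral ballI)
    fix l' k assume lk: "l' \<in> {..B}" "k \<in> {..l}"
    have "l - k > B \<Longrightarrow> Tc n d (l - k) (Tc n d' l' p) = 0" using B by (auto simp: tbound_def)
    moreover have "l - k > B \<or> y + int l' - int k < 0" using that lk K by auto
    ultimately show "smK (fps_nth C k) (Hz n u' (y + int l' - int k) * Tc n d (l - k) (Tc n d' l' p)) = 0"
      by auto
  qed
  then have "Lc n u d (Lc n u' d' p y) x = (\<Sum>l\<le>K + B. \<Sum>l'\<le>B. \<Sum>k\<le>l. f l' k (l - k))"
    unfolding T'[symmetric] by (rule Lc_eq)
  also have "\<dots> = (\<Sum>l'\<le>B. \<Sum>l\<le>K + B. \<Sum>k\<le>l. f l' k (l - k))" by (rule sum.swap)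
  also have "\<dots> = (\<Sum>l'\<le>B. \<Sum>k\<le>K. \<Sum>j\<le>B. f l' k j)"
  proof (rule sum.cong[OF refl])
    fix l' assume l': "l' \<in> {..B}"
    have "(\<Sum>l\<le>K + B. \<Sum>k\<le>l. f l' k (l - k)) = (\<Sum>(l,k)\<in>(SIGMA l:{..K + B}. {..l}). f l' k (l - k))"
      by (rule sum.Sigma) auto
    \<comment> \<open>The new indices are the order \<open>k\<close> of the contraction and the
      order \<open>j\<close> of the shift left for \<open>p\<close>; the terms outside the rectangle
      vanish by \<open>f0\<close>.\<close>
    also have "\<dots> = (\<Sum>(k,j)\<in>{..K} \<times> {..B}. f l' k j)"
      by (rule sum.reindex_bij_witness_not_neutral[where
            S' = "{(l,k). (l,k) \<in> (SIGMA l:{..K + B}. {..l}) \<and> (k > K \<or> l - k > B)}" and T' = "{}"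
            and i = "\<lambda>(k,j). (k + j, k)" and j = "\<lambda>(l,k). (k, l - k)"])
         (use l' in \<open>auto simp: f0 intro: finite_subset[of _ "SIGMA l:{..K + B}. {..l}"]\<close>)
    also have "\<dots> = (\<Sum>k\<le>K. \<Sum>j\<le>B. f l' k j)" by (simp add: sum.cartesian_product)
    finally show "(\<Sum>l\<le>K + B. \<Sum>k\<le>l. f l' k (l - k)) = (\<Sum>k\<le>K. \<Sum>j\<le>B. f l' k j)" .
  qed
  also have "\<dots> = (\<Sum>k\<le>K. \<Sum>j\<le>B. \<Sum>l'\<le>B. f l' k j)"
    by (subst sum.swap) (intro sum.cong refl sum.swap)
  also have "\<dots> = (\<Sum>k\<le>K. smK (fps_nth C k) (Nc n u d u' d' B p (x + int k) (y - int k)))"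
    by (simp add: Nc_def f_def smK_sum)
  finally show ?thesis .
qed

lemma sum_conv_square:
  fixes f :: "nat \<Rightarrow> nat \<Rightarrow> 'a::comm_monoid_add"
  assumes "\<And>l l'. l > B \<or> l' > B \<Longrightarrow> f l l' = 0"
  shows "(\<Sum>l\<le>B. \<Sum>l'\<le>B. f l l') = (\<Sum>m\<le>2 * B. \<Sum>l\<le>m. f l (m - l))"
proof -
  have "(\<Sum>m\<le>2 * B. \<Sum>l\<le>m. f l (m - l)) = (\<Sum>(m,l)\<in>(SIGMA m:{..2 * B}. {..m}). f l (m - l))"
    by (rule sum.Sigma) auto
  also have "\<dots> = (\<Sum>(l,l')\<in>{..B} \<times> {..B}. f l l')"
    by (rule sum.reindex_bij_witness_not_neutral[where
          S' = "{(m,l). (m,l) \<in> (SIGMA m:{..2 * B}. {..m}) \<and> (l > B \<or> m - l > B)}" and T' = "{}"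
          and i = "\<lambda>(l,l'). (l + l', l)" and j = "\<lambda>(m,l). (l, m - l)"])
       (use assms in \<open>auto intro: finite_subset[of _ "SIGMA m:{..2 * B}. {..m}"]\<close>)
  finally show ?thesis by (simp add: sum.cartesian_product)
qed

text \<open>Setting \<open>z\<^sub>1 = z\<close> in the normally ordered product.\<close>

lemma Nc_diag:
  assumes B: "tbound n p B" and "lo \<le> - int B" "Y + int B \<le> hi"
  shows "(\<Sum>x\<in>{lo..hi}. Nc n u d u' d' B p x (Y - x)) = Lc n (u + u') (d + d') p Y"
proof -
  have T0: "Tc n d l (Tc n d' l' p) = 0" if "l > B \<or> l' > B" for l l'
    using B that unfolding tbound_def by blast
  \<comment> \<open>A total order above \<open>2 * B\<close> forces one of the two shifts above
    \<open>B\<close>.\<close>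
  have T2: "Tc n (d + d') m p = 0" if "m > 2 * B" for m
    unfolding Tc_add by (intro sum.neutral ballI T0) (use that in auto)
  have "(\<Sum>x\<in>{lo..hi}. Nc n u d u' d' B p x (Y - x)) = (\<Sum>x\<in>{- int B..Y + int B}. Nc n u d u' d' B p x (Y - x))"
    using assms by (intro sum.mono_neutral_right) (auto intro!: Nc_low)
  also have "\<dots> = (\<Sum>l\<le>B. \<Sum>l'\<le>B. (\<Sum>x\<in>{- int B..Y + int B}.
      Hz n u (x + int l) * Hz n u' (Y - x + int l')) * Tc n d l (Tc n d' l' p))"
    unfolding Nc_def sum_distrib_right
    by (subst sum.swap, intro sum.cong refl, subst sum.swap) (simp add: mult.assoc)
  also have "\<dots> = (\<Sum>l\<le>B. \<Sum>l'\<le>B. Hz n (u + u') (Y + int l + int l') * Tc n d l (Tc n d' l' p))"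
    by (intro sum.cong refl) (simp add: Hz_add)
  also have "\<dots> = (\<Sum>m\<le>2 * B. \<Sum>l\<le>m. Hz n (u + u') (Y + int l + int (m - l)) * Tc n d l (Tc n d' (m - l) p))"
    by (rule sum_conv_square) (simp add: T0)
  also have "\<dots> = (\<Sum>m\<le>2 * B. Hz n (u + u') (Y + int m) * Tc n (d + d') m p)"
    by (intro sum.cong refl) (simp add: Tc_add sum_distrib_left of_nat_diff)
  also have "\<dots> = Lc n (u + u') (d + d') p Y"
    by (rule Lc_eq[symmetric]) (rule T2)
  finally show ?thesis .
qed

lemma lookup_Sum_any:
  assumes "finite {x. f x \<noteq> 0}"
  shows "lookup (Sum_any f) k = Sum_any (\<lambda>x. lookup (f x) k)"
proof -
  have "Sum_any (\<lambda>x. lookup (f x) k) = (\<Sum>x\<in>{x. f x \<noteq> 0}. lookup (f x) k)"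
    using assms by (intro Sum_any.expand_superset) auto
  then show ?thesis by (simp add: Sum_any.expand_set lookup_sum)
qed

lemma smV_0_left [simp]: "smV 0 v = 0"
  by (rule poly_mapping_eqI) (simp add: lookup_smV smK_0_left)

lemma smV_zero [simp]: "smV c 0 = 0"
  by (rule poly_mapping_eqI) (simp add: lookup_smV)

lemma smV_1 [simp]: "smV 1 v = v"
  by (rule poly_mapping_eqI) (simp add: lookup_smV)

lemma fls_const_sum: "fls_const (\<Sum>i\<in>I. f i) = (\<Sum>i\<in>I. fls_const (f i))"
  by (induction I rule: infinite_finite_induct) (simp_all flip: fls_plus_const)

lemma fls_times_nth_bounds:
  fixes f g :: "'a::semiring_0 fls"
  assumes "\<And>i. i < A \<Longrightarrow> fls_nth f i = 0" "\<And>i. i < B \<Longrightarrow> fls_nth g i = 0"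
  shows "fls_nth (f * g) k = (\<Sum>i\<in>{A..k - B}. fls_nth f i * fls_nth g (k - i))"
proof (cases "f = 0 \<or> g = 0")
  case False
  have "A \<le> fls_subdegree f" "B \<le> fls_subdegree g"
    using False assms by (auto intro: fls_subdegree_geI)
  then show ?thesis unfolding fls_times_nth(2)
    by (intro sum.mono_neutral_left) auto
qed auto

lemma fls_times_nth_nat:
  fixes f g :: "'a::semiring_0 fls"
  assumes "\<And>i. i < A \<Longrightarrow> fls_nth f i = 0" "\<And>i. i < 0 \<Longrightarrow> fls_nth g i = 0"
  shows "fls_nth (f * g) k = (\<Sum>j\<le>nat (k - A). fls_nth f (k - int j) * fls_nth g (int j))"
proof (cases "A \<le> k")
  case True
  have "fls_nth (f * g) k = (\<Sum>i\<in>{A..k}. fls_nth f i * fls_nth g (k - i))"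
    using fls_times_nth_bounds[of A f 0 g k] assms by simp
  also have "\<dots> = (\<Sum>j\<le>nat (k - A). fls_nth f (k - int j) * fls_nth g (int j))"
    by (rule sum.reindex_bij_witness[of _ "\<lambda>j. k - int j" "\<lambda>i. nat (k - i)"]) (use True in auto)
  finally show ?thesis .
next
  case False
  then show ?thesis using fls_times_nth_bounds[of A f 0 g k] assms by simp
qed

section \<open>Independence of the products of the clearing polynomial\<close>

definition array_bdd :: "int \<Rightarrow> (int \<Rightarrow> int \<Rightarrow> scal) \<Rightarrow> bool" where
  "array_bdd N G \<longleftrightarrow> (\<forall>m l. m < N \<or> l < N \<longrightarrow> G m l = 0)"

text \<open>Multiplication by \<open>p (z\<^sub>1, z)\<close> on arrays of coefficients. It is
  defined for arrays unbounded in both directions, since the coefficients of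
  \<open>a(z\<^sub>1)b(z)v\<close> need not be bounded before they are multiplied by a clearing
  polynomial.\<close>

definition act :: "scal poly poly \<Rightarrow> (int \<Rightarrow> int \<Rightarrow> scal) \<Rightarrow> int \<Rightarrow> int \<Rightarrow> scal" where
  "act p G m l = (\<Sum>k\<le>degree p. \<Sum>j\<le>degree (coeff p k). coeff (coeff p k) j * G (m - int k) (l - int j))"

definition subst_coeff :: "(int \<Rightarrow> int \<Rightarrow> scal) \<Rightarrow> nat \<Rightarrow> int \<Rightarrow> scal" where
  "subst_coeff G k l = Sum_any (\<lambda>m. cst (of_int m gchoose k) * G m (l - m + int k))"

text \<open>The series \<open>\<Sum>G m l z\<^sub>1\<^sup>m z\<^sup>l\<close> with \<open>z\<^sub>1 = z + z\<^sub>0\<close>\<close>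

definition subst_ser :: "(int \<Rightarrow> int \<Rightarrow> scal) \<Rightarrow> scal fls fls" where
  "subst_ser G = fps_to_fls (Abs_fps (\<lambda>k. Abs_fls (subst_coeff G k)))"

definition eval_poly2 :: "scal poly poly \<Rightarrow> scal fls fls" where
  "eval_poly2 p = (\<Sum>k\<le>degree p. \<Sum>l\<le>degree (coeff p k).
     fls_const (fls_const (coeff (coeff p k) l) * fls_X ^ l) * (fls_X + fls_const fls_X) ^ k)"

lemma iota_inv_eval: "iota_inv p = inverse (eval_poly2 p)"
  by (simp add: iota_inv_def eval_poly2_def)

lemma cst_add: "cst (x + y) = cst x + cst y"
  by (simp add: cst_def flip: to_fract_add)

lemma cst_1 [simp]: "cst 1 = 1"
  by (simp add: cst_def flip: one_pCons)

lemma subst_coeff_eq: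
  assumes "array_bdd N G" "lo \<le> N" "l + int k - N \<le> hi"
  shows "subst_coeff G k l = (\<Sum>m\<in>{lo..hi}. cst (of_int m gchoose k) * G m (l - m + int k))"
  unfolding subst_coeff_def
proof (rule Sum_any.expand_superset)
  show "{m. cst (of_int m gchoose k) * G m (l - m + int k) \<noteq> 0} \<subseteq> {lo..hi}"
  proof
    fix m assume "m \<in> {m. cst (of_int m gchoose k) * G m (l - m + int k) \<noteq> 0}"
    then have "\<not> (m < N \<or> l - m + int k < N)" using assms(1) unfolding array_bdd_def by auto
    then show "m \<in> {lo..hi}" using assms by auto
  qed
qed simp

lemma subst_coeff_low:
  assumes "array_bdd N G" "l < 2 * N - int k"
  shows "subst_coeff G k l = 0"
  using subst_coeff_eq[OF assms(1) order.refl order.refl, of k l] assms(2) by simp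

lemma subst_ser_nth:
  assumes "array_bdd N G"
  shows "fls_nth (fls_nth (subst_ser G) k) l = (if k < 0 then 0 else subst_coeff G (nat k) l)"
proof -
  have "fls_nth (Abs_fls (subst_coeff G k)) l = subst_coeff G k l" for k
    using nth_Abs_fls_lower_bound[of "2 * N - int k" "subst_coeff G k"] subst_coeff_low[OF assms] by simp
  then show ?thesis by (simp add: subst_ser_def)
qed

lemma subst_ser_eqI:
  assumes "array_bdd N G" "\<And>k l. k \<ge> 0 \<Longrightarrow> fls_nth (fls_nth S k) l = subst_coeff G (nat k) l"
    "\<And>k l. k < 0 \<Longrightarrow> fls_nth (fls_nth S k) l = 0"
  shows "subst_ser G = S"
  by (intro fls_eqI) (use assms in \<open>auto simp: subst_ser_nth not_less\<close>)

lemma array_bdd_shift: "array_bdd N G \<Longrightarrow> array_bdd N (\<lambda>m l. G (m - int k) (l - int j))"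
  by (auto simp: array_bdd_def)

lemma array_bdd_sum: "(\<And>i. i \<in> I \<Longrightarrow> array_bdd N (G i)) \<Longrightarrow> array_bdd N (\<lambda>m l. \<Sum>i\<in>I. G i m l)"
  by (auto simp: array_bdd_def)

lemma array_bdd_scale: "array_bdd N G \<Longrightarrow> array_bdd N (\<lambda>m l. c * G m l)"
  by (auto simp: array_bdd_def)

lemma subst_ser_sum:
  assumes "finite I" "\<And>i. i \<in> I \<Longrightarrow> array_bdd N (G i)"
  shows "subst_ser (\<lambda>m l. \<Sum>i\<in>I. G i m l) = (\<Sum>i\<in>I. subst_ser (G i))"
proof (rule subst_ser_eqI[OF array_bdd_sum[OF assms(2)]])
  have nth: "fls_nth (fls_nth (\<Sum>i\<in>I. subst_ser (G i)) k) l = (\<Sum>i\<in>I. fls_nth (fls_nth (subst_ser (G i)) k) l)" for k l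
    using assms(1) by (induction I rule: finite_induct) auto
  show "fls_nth (fls_nth (\<Sum>i\<in>I. subst_ser (G i)) k) l = subst_coeff (\<lambda>m l. \<Sum>i\<in>I. G i m l) (nat k) l"
    if "k \<ge> 0" for k l
  proof -
    have "(\<Sum>i\<in>I. fls_nth (fls_nth (subst_ser (G i)) k) l)
       = (\<Sum>i\<in>I. \<Sum>m\<in>{N..l + int (nat k) - N}. cst (of_int m gchoose nat k) * G i m (l - m + int (nat k)))"
      by (intro sum.cong refl)
         (use that in \<open>simp add: subst_ser_nth[OF assms(2)] subst_coeff_eq[OF assms(2) order.refl order.refl]\<close>)
    also have "\<dots> = subst_coeff (\<lambda>m l. \<Sum>i\<in>I. G i m l) (nat k) l"
      by (subst subst_coeff_eq[OF array_bdd_sum[OF assms(2)] order.refl order.refl], assumption,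
          subst sum.swap) (simp add: sum_distrib_left)
    finally show ?thesis unfolding nth .
  qed
  show "fls_nth (fls_nth (\<Sum>i\<in>I. subst_ser (G i)) k) l = 0" if "k < 0" for k l
    unfolding nth by (intro sum.neutral ballI) (use that in \<open>simp add: subst_ser_nth[OF assms(2)]\<close>)
qed

lemma subst_ser_scale:
  assumes "array_bdd N G"
  shows "subst_ser (\<lambda>m l. c * G m l) = fls_const (fls_const c) * subst_ser G"
proof (rule subst_ser_eqI[OF array_bdd_scale[OF assms]])
  fix k l :: int assume "k \<ge> 0"
  then show "fls_nth (fls_nth (fls_const (fls_const c) * subst_ser G) k) l = subst_coeff (\<lambda>m l. c * G m l) (nat k) l"
    using assms array_bdd_scale[OF assms, of c]
    by (simp add: subst_ser_nth subst_coeff_eq[OF _ order.refl order.refl] sum_distrib_left mult.left_commute)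
qed (use assms in \<open>simp add: subst_ser_nth\<close>)

lemma subst_ser_z:
  assumes "array_bdd N G"
  shows "subst_ser (\<lambda>m l. G m (l - 1)) = fls_const fls_X * subst_ser G"
proof (rule subst_ser_eqI)
  show "array_bdd N (\<lambda>m l. G m (l - 1))" using array_bdd_shift[OF assms, of 0 1] by simp
  fix k l :: int assume "k \<ge> 0"
  then show "fls_nth (fls_nth (fls_const fls_X * subst_ser G) k) l = subst_coeff (\<lambda>m l. G m (l - 1)) (nat k) l"
    by (simp add: fls_X_times_conv_shift subst_ser_nth[OF assms] subst_coeff_def algebra_simps)
qed (simp add: fls_X_times_conv_shift subst_ser_nth[OF assms])

text \<open>Multiplication by \<open>z\<^sub>1\<close> turns into multiplication by
  \<open>z\<^sub>0 + z\<close>; on coefficients this is Pascal's rule for \<open>gchoose\<close>,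
  which holds for negative upper index as well.\<close>

lemma subst_ser_z1:
  assumes "array_bdd N G"
  shows "subst_ser (\<lambda>m l. G (m - 1) l) = (fls_X + fls_const fls_X) * subst_ser G"
proof (rule subst_ser_eqI)
  show b: "array_bdd N (\<lambda>m l. G (m - 1) l)" using array_bdd_shift[OF assms, of 1 0] by simp
  fix k l :: int
  have nth: "fls_nth (fls_nth ((fls_X + fls_const fls_X) * subst_ser G) k) l
     = fls_nth (fls_nth (subst_ser G) (k - 1)) l + fls_nth (fls_nth (subst_ser G) k) (l - 1)"
    by (simp add: distrib_right fls_X_times_conv_shift)
  show "fls_nth (fls_nth ((fls_X + fls_const fls_X) * subst_ser G) k) l = 0" if "k < 0"
    using that unfolding nth by (simp add: subst_ser_nth[OF assms])
  assume k: "k \<ge> 0"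
  define j where "j = nat k"
  define hi where "hi = l + int j - N + 2"
  have "subst_coeff (\<lambda>m l. G (m - 1) l) j l
      = (\<Sum>m\<in>{N - 1..hi}. cst (of_int m gchoose j) * G (m - 1) (l - m + int j))"
    by (rule subst_coeff_eq[OF b]) (simp_all add: hi_def)
  also have "\<dots> = (\<Sum>m\<in>{N - 2..hi - 1}. cst ((of_int m + 1) gchoose j) * G m (l - 1 - m + int j))"
    by (rule sum.reindex_bij_witness[of _ "\<lambda>m. m + 1" "\<lambda>m. m - 1"]) (auto simp: algebra_simps)
  also have "\<dots> = (\<Sum>m\<in>{N - 2..hi - 1}. (if j = 0 then 0 else cst (of_int m gchoose (j - 1)) * G m (l - m + int (j - 1)))
      + cst (of_int m gchoose j) * G m (l - 1 - m + int j))"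
  proof (intro sum.cong refl)
    fix m
    show "cst ((of_int m + 1) gchoose j) * G m (l - 1 - m + int j) =
      (if j = 0 then 0 else cst (of_int m gchoose (j - 1)) * G m (l - m + int (j - 1)))
      + cst (of_int m gchoose j) * G m (l - 1 - m + int j)"
    proof (cases j)
      case (Suc j')
      have "l - 1 - m + int j = l - m + int (j - 1)" using Suc by simp
      then show ?thesis
        by (simp only:) (simp add: Suc gbinomial_Suc_Suc cst_add distrib_right)
    qed simp
  qed
  also have "\<dots> = (if j = 0 then 0 else subst_coeff G (j - 1) l) + subst_coeff G j (l - 1)"
  proof -
    have "(\<Sum>m\<in>{N - 2..hi - 1}. cst (of_int m gchoose j) * G m (l - 1 - m + int j)) = subst_coeff G j (l - 1)"
      by (rule subst_coeff_eq[OF assms, symmetric]) (simp_all add: hi_def)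
    moreover have "(\<Sum>m\<in>{N - 2..hi - 1}. cst (of_int m gchoose (j - 1)) * G m (l - m + int (j - 1)))
        = subst_coeff G (j - 1) l" if "j \<noteq> 0"
      by (rule subst_coeff_eq[OF assms, symmetric]) (use that in \<open>simp_all add: hi_def\<close>)
    ultimately show ?thesis unfolding sum.distrib by (cases "j = 0") simp_all
  qed
  also have "\<dots> = fls_nth (fls_nth ((fls_X + fls_const fls_X) * subst_ser G) k) l"
    unfolding nth using k by (auto simp: subst_ser_nth[OF assms] j_def nat_diff_distrib)
  finally show "fls_nth (fls_nth ((fls_X + fls_const fls_X) * subst_ser G) k) l
     = subst_coeff (\<lambda>m l. G (m - 1) l) (nat k) l" by (simp add: j_def)
qed

lemma subst_ser_shift:
  assumes "array_bdd N G"
  shows "subst_ser (\<lambda>m l. G (m - int k) (l - int j))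
     = fls_const (fls_X ^ j) * (fls_X + fls_const fls_X) ^ k * subst_ser G"
proof (induction k)
  case 0
  show ?case
  proof (induction j)
    case (Suc j)
    have "subst_ser (\<lambda>m l. G (m - int 0) (l - int (Suc j))) = subst_ser (\<lambda>m l. (\<lambda>m l. G (m - int 0) (l - int j)) m (l - 1))"
      by (simp add: algebra_simps)
    also have "\<dots> = fls_const fls_X * subst_ser (\<lambda>m l. G (m - int 0) (l - int j))"
      by (rule subst_ser_z) (rule array_bdd_shift[OF assms])
    also have "\<dots> = fls_const (fls_X ^ Suc j) * (fls_X + fls_const fls_X) ^ 0 * subst_ser G"
      unfolding Suc.IH by (simp add: mult.assoc flip: fls_const_mult_const)
    finally show ?case .
  qed simp
next
  case (Suc k)
  have "subst_ser (\<lambda>m l. G (m - int (Suc k)) (l - int j)) = subst_ser (\<lambda>m l. (\<lambda>m l. G (m - int k) (l - int j)) (m - 1) l)"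
    by (simp add: algebra_simps)
  also have "\<dots> = (fls_X + fls_const fls_X) * subst_ser (\<lambda>m l. G (m - int k) (l - int j))"
    by (rule subst_ser_z1) (rule array_bdd_shift[OF assms])
  finally show ?case unfolding Suc.IH by (simp add: mult_ac)
qed

text \<open>The substitution is linear over polynomials in both variables; bounded arrays are needed
  for its coefficients to be finite sums.\<close>

lemma subst_ser_act:
  assumes "array_bdd N G"
  shows "subst_ser (act p G) = eval_poly2 p * subst_ser G"
proof -
  have "subst_ser (act p G) = (\<Sum>k\<le>degree p. \<Sum>j\<le>degree (coeff p k).
      subst_ser (\<lambda>m l. coeff (coeff p k) j * G (m - int k) (l - int j)))"
    unfolding act_def[abs_def]
    by (subst subst_ser_sum[of _ N], simp,
        intro array_bdd_sum array_bdd_scale array_bdd_shift assms,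
        intro sum.cong refl,
        subst subst_ser_sum[of _ N], simp,
        intro array_bdd_scale array_bdd_shift assms, rule refl)
  also have "\<dots> = eval_poly2 p * subst_ser G"
    unfolding eval_poly2_def sum_distrib_right
    by (intro sum.cong refl, subst subst_ser_scale[OF array_bdd_shift[OF assms]],
        subst subst_ser_shift[OF assms]) (simp add: mult.assoc flip: fls_const_mult_const)
  finally show ?thesis .
qed

lemma act_commute: "act p (act p' G) = act p' (act p G)"
proof (intro ext)
  fix m l
  define A where "A p = (SIGMA k:{..degree p}. {..degree (coeff p k)})" for p :: "scal poly poly"
  have e: "act p G m l = (\<Sum>x\<in>A p. coeff (coeff p (fst x)) (snd x) * G (m - int (fst x)) (l - int (snd x)))"
    for p G m l
    unfolding act_def A_def by (subst sum.Sigma) (auto simp: split_def)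
  show "act p (act p' G) m l = act p' (act p G) m l"
    unfolding e sum_distrib_left
    by (subst sum.swap) (auto simp: algebra_simps intro!: sum.cong)
qed

text \<open>In \<open>(z\<^sub>0 + z)^k\<close> the highest power of \<open>z\<^sub>0\<close> is the
  \<open>k\<close>-th, with coefficient 1. So the coefficient of top degree in
  \<open>z\<^sub>0\<close> is the leading coefficient of \<open>p\<close>, a nonzero polynomial in
  \<open>z\<close>.\<close>

lemma eval_poly2_nonzero:
  assumes "p \<noteq> 0" shows "eval_poly2 p \<noteq> 0"
proof -
  let ?Y = "fls_X + fls_const fls_X :: scal fls fls"
  define c :: "scal poly \<Rightarrow> scal fls" where "c f = (\<Sum>l\<le>degree f. fls_const (coeff f l) * fls_X ^ l)" for f
  have Y: "fls_nth (?Y ^ k) D = (if D = int k then 1 else 0)" if "D \<ge> int k" for D k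
    using that
  proof (induction k arbitrary: D)
    case (Suc k)
    have "fls_nth (?Y ^ Suc k) D = fls_nth (?Y ^ k) (D - 1) + fls_X * fls_nth (?Y ^ k) D"
      by (simp add: distrib_right fls_X_times_conv_shift)
    then show ?case using Suc.prems by (simp add: Suc.IH)
  qed auto
  have e: "eval_poly2 p = (\<Sum>k\<le>degree p. fls_const (c (coeff p k)) * ?Y ^ k)"
    unfolding eval_poly2_def c_def sum_distrib_right[symmetric]
    by (intro sum.cong refl arg_cong2[where f = "(*)"]) (simp add: fls_const_sum)
  have nth: "fls_nth (\<Sum>k\<in>I. f k) D = (\<Sum>k\<in>I. fls_nth (f k) D)" for I :: "nat set" and f :: "nat \<Rightarrow> 'b::comm_monoid_add fls" and D
    by (induction I rule: infinite_finite_induct) auto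
  have "fls_nth (eval_poly2 p) (degree p) = (\<Sum>k\<le>degree p. if k = degree p then c (coeff p k) else 0)"
    unfolding e nth by (intro sum.cong refl) (auto simp: Y)
  also have "\<dots> = c (lead_coeff p)" by simp
  finally have "fls_nth (eval_poly2 p) (degree p) = c (lead_coeff p)" .
  moreover have "fls_nth (c f) (int l) = coeff f l" for f l
  proof -
    have "fls_nth (c f) (int l) = (\<Sum>j\<le>degree f. if j = l then coeff f j else 0)"
      unfolding c_def nth by (intro sum.cong refl) auto
    then show ?thesis by (simp add: coeff_eq_0)
  qed
  then have "c (lead_coeff p) \<noteq> 0" using assms
    by (metis fls_zero_nth leading_coeff_0_iff)
  ultimately show ?thesis by auto
qed

text \<open>The coefficients of \<open>a(z\<^sub>1)b(z)v\<close> that contribute to the coefficient of \<open>z\<^sup>s\<close> in products\<close>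

definition ab_array :: "oper \<Rightarrow> oper \<Rightarrow> vsp \<Rightarrow> rat \<Rightarrow> weight \<Rightarrow> ((nat \<times> nat) \<Rightarrow>\<^sub>0 nat) \<Rightarrow> int \<Rightarrow> int \<Rightarrow> scal" where
  "ab_array a b v s \<delta> \<mu> m l = lookup (lookup (a (b v (s + of_int l)) (of_int m)) \<delta>) \<mu>"

lemma lookup_pab: "lookup (lookup (pab p a b v (of_int m) (s + of_int l)) \<delta>) \<mu>
   = act p (ab_array a b v s \<delta> \<mu>) m l"
  by (simp add: pab_def act_def ab_array_def lookup_sum lookup_smV lookup_smK add_diff_eq)

lemma clears_bound:
  assumes "clears n p a b" "v \<in> Vsp n"
  obtains N where "\<And>s s'. s < of_int N \<or> s' < of_int N + s0 \<Longrightarrow> pab p a b v s s' = 0"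
proof -
  obtain M where M: "\<And>s s'. s < M \<or> s' < M \<Longrightarrow> pab p a b v s s' = 0"
    using assms unfolding clears_def by blast
  define N where "N = min \<lfloor>M\<rfloor> \<lfloor>M - s0\<rfloor>"
  have "of_int N \<le> M" "of_int N + s0 \<le> M"
    unfolding N_def by linarith+
  then show ?thesis using M by (intro that[of N]) force
qed

lemma clears_array_bdd:
  assumes "clears n p a b" "v \<in> Vsp n"
  shows "\<exists>N. \<forall>\<delta> \<mu>. array_bdd N (act p (ab_array a b v s \<delta> \<mu>))"
proof -
  obtain N where N: "\<And>s1 s'. s1 < of_int N \<or> s' < of_int N + s \<Longrightarrow> pab p a b v s1 s' = 0"
    by (rule clears_bound[OF assms, of s]) blast
  have "array_bdd N (act p (ab_array a b v s \<delta> \<mu>))" for \<delta> \<mu>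
    unfolding array_bdd_def lookup_pab[symmetric] using N by (auto simp: add.commute)
  then show ?thesis by blast
qed

text \<open>\<open>Sum_any\<close> is 0 on infinite supports, so the sum over pairs in
  \<open>nth_prod_with\<close> has to be confined to a finite box before it can be recognized as a
  coefficient of a product in the Laurent series field.\<close>

lemma lookup_nth_prod_with:
  assumes "clears n p a b" "v \<in> Vsp n"
  shows "lookup (lookup (nth_prod_with p a b r v s) \<delta>) \<mu>
    = fls_nth (fls_nth (inverse (eval_poly2 p) * subst_ser (act p (ab_array a b v s \<delta> \<mu>))) (- r - 1)) 0"
proof -
  let ?G = "act p (ab_array a b v s \<delta> \<mu>)"
  let ?i = "inverse (eval_poly2 p)"
  obtain N where N: "\<And>s1 s'. s1 < of_int N \<or> s' < of_int N + s \<Longrightarrow> pab p a b v s1 s' = 0"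
    by (rule clears_bound[OF assms, of s]) blast
  have G: "array_bdd N ?G"
    unfolding array_bdd_def lookup_pab[symmetric] using N by (auto simp: add.commute)
  have sz: "pab p a b v (of_int m') (s - of_int m - of_int m' + of_nat k) = 0"
    if "\<not> (N \<le> m' \<and> m' \<le> int k - m - N)" for m m' k
  proof (rule N)
    have "m' < N \<or> int k - m - m' < N" using that by linarith
    then have "(of_int m' :: rat) < of_int N \<or> (of_int (int k - m - m') :: rat) < of_int N"
      by (simp only: of_int_less_iff)
    then show "(of_int m' :: rat) < of_int N \<or> s - of_int m - of_int m' + of_nat k < of_int N + s" by auto
  qed
  have ps: "pab_subst p a b v (s - of_int m) k = (\<Sum>m'\<in>{N..int k - m - N}.
      smV (cst (of_int m' gchoose k)) (pab p a b v (of_int m') (s - of_int m - of_int m' + of_nat k)))" for m k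
    unfolding pab_subst_def
  proof (rule Sum_any.expand_superset)
    show "{m'. smV (cst (of_int m' gchoose k)) (pab p a b v (of_int m') (s - of_int m - of_int m' + of_nat k)) \<noteq> 0}
       \<subseteq> {N..int k - m - N}"
    proof
      fix m' assume m': "m' \<in> {m'. smV (cst (of_int m' gchoose k)) (pab p a b v (of_int m') (s - of_int m - of_int m' + of_nat k)) \<noteq> 0}"
      have "pab p a b v (of_int m') (s - of_int m - of_int m' + of_nat k) \<noteq> 0"
      proof
        assume "pab p a b v (of_int m') (s - of_int m - of_int m' + of_nat k) = 0"
        then show False using m' by simp
      qed
      then show "m' \<in> {N..int k - m - N}" using sz[of m' k m] by auto
    qed
  qed simp
  have lps: "lookup (lookup (pab_subst p a b v (s - of_int m) k) \<delta>) \<mu>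
     = subst_coeff ?G k (- m)" for m k
  proof -
    have e: "s - of_int m - of_int m' + of_nat k = s + of_int (- m - m' + int k)" for m' by simp
    show ?thesis
      unfolding ps subst_coeff_eq[OF G order.refl order.refl] lookup_sum lookup_smV lookup_smK e lookup_pab
      by (intro sum.cong) auto
  qed
  \<comment> \<open>The lowest \<open>z\<^sub>0\<close>-degree \<open>A\<close> of the inverse
    bounds \<open>k\<close> by \<open>K\<close>; over these finitely many \<open>k\<close>,
    \<open>M\<close> is the lowest \<open>z\<close>-degree of its coefficients, and the bound
    \<open>N\<close> of the cleared product gives the upper limit \<open>U\<close>.\<close>
  define A where "A = fls_subdegree ?i"
  define K where "K = nat (- r - 1 - A)"
  define M where "M = Min ((\<lambda>k. fls_subdegree (fls_nth ?i (- r - 1 - int k))) ` {..K})"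
  define U where "U = int K - 2 * N"
  have i0: "fls_nth (fls_nth ?i (- r - 1 - int k)) m = 0" if "k > K \<or> m < M" for k m
  proof (cases "k > K")
    case True
    then have "- r - 1 - int k < A" unfolding K_def by linarith
    then show ?thesis unfolding A_def by simp
  next
    case False
    then have "M \<le> fls_subdegree (fls_nth ?i (- r - 1 - int k))"
      unfolding M_def by (intro Min_le) auto
    then show ?thesis using False that by (intro fls_eq0_below_subdegree) auto
  qed
  have S0: "pab_subst p a b v (s - of_int m) k = 0" if "k \<le> K" "m > U" for k m
    unfolding ps using that by (auto simp: U_def)
  have sub: "{x. (case x of (k, m) \<Rightarrow> smV (fls_nth (fls_nth (iota_inv p) (- r - 1 - int k)) m)
        (pab_subst p a b v (s - of_int m) k)) \<noteq> 0} \<subseteq> {..K} \<times> {M..U}"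
  proof clarify
    fix k :: nat and m
    assume nz: "smV (fls_nth (fls_nth (iota_inv p) (- r - 1 - int k)) m) (pab_subst p a b v (s - of_int m) k) \<noteq> 0"
    have "\<not> (k > K \<or> m < M)" using nz i0[of k m] by (auto simp: iota_inv_eval)
    moreover have "\<not> m > U" using nz S0[of k m] calculation by auto
    ultimately show "k \<in> {..K} \<and> m \<in> {M..U}" by auto
  qed
  have "nth_prod_with p a b r v s = (\<Sum>x\<in>{..K} \<times> {M..U}. case x of (k, m) \<Rightarrow>
      smV (fls_nth (fls_nth (iota_inv p) (- r - 1 - int k)) m) (pab_subst p a b v (s - of_int m) k))"
    unfolding nth_prod_with_def by (rule Sum_any.expand_superset[OF _ sub]) simp
  then have "lookup (lookup (nth_prod_with p a b r v s) \<delta>) \<mu>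
     = (\<Sum>k\<le>K. \<Sum>m\<in>{M..U}. fls_nth (fls_nth ?i (- r - 1 - int k)) m * subst_coeff ?G k (- m))"
    by (simp add: lookup_sum lookup_smV lookup_smK lps iota_inv_eval sum.cartesian_product split_def)
  also have "\<dots> = (\<Sum>k\<le>K. fls_nth (fls_nth ?i (- r - 1 - int k) * fls_nth (subst_ser ?G) (int k)) 0)"
  proof (intro sum.cong refl)
    fix k assume k: "k \<in> {..K}"
    have "fls_nth (fls_nth ?i (- r - 1 - int k) * fls_nth (subst_ser ?G) (int k)) 0
      = (\<Sum>m\<in>{M..0 - (2 * N - int K)}. fls_nth (fls_nth ?i (- r - 1 - int k)) m * fls_nth (fls_nth (subst_ser ?G) (int k)) (0 - m))"
      by (rule fls_times_nth_bounds)
         (use k i0 in \<open>auto simp: subst_ser_nth[OF G] intro!: subst_coeff_low[OF G]\<close>)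
    then show "(\<Sum>m\<in>{M..U}. fls_nth (fls_nth ?i (- r - 1 - int k)) m * subst_coeff ?G k (- m))
      = fls_nth (fls_nth ?i (- r - 1 - int k) * fls_nth (subst_ser ?G) (int k)) 0"
      by (simp add: subst_ser_nth[OF G] U_def)
  qed
  also have "\<dots> = fls_nth (\<Sum>k\<le>K. fls_nth ?i (- r - 1 - int k) * fls_nth (subst_ser ?G) (int k)) 0"
    by (induction K) auto
  also have "\<dots> = fls_nth (fls_nth (?i * subst_ser ?G) (- r - 1)) 0"
    unfolding K_def
    by (subst fls_times_nth_nat[of A]) (auto simp: A_def intro!: fls_eqI simp: subst_ser_nth[OF G])
  finally show ?thesis .
qed

lemma inverse_cross_mult:
  fixes a b x y :: "'a::field"
  assumes "b * x = a * y" "a \<noteq> 0" "b \<noteq> 0"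
  shows "inverse a * x = inverse b * y"
  using assms by (simp add: field_simps)

text \<open>Applying \<open>p'\<close> to the array cleared by \<open>p\<close>, or \<open>p\<close>
  to the array cleared by \<open>p'\<close>, gives the same array. After substitution this is an
  identity in a field, where both polynomials can be inverted.\<close>

lemma nth_prod_with_indep:
  assumes "clears n p a b" "clears n p' a b" "v \<in> Vsp n"
  shows "nth_prod_with p a b r v s = nth_prod_with p' a b r v s"
proof (rule poly_mapping_eqI, rule poly_mapping_eqI)
  fix \<delta> \<mu>
  let ?G = "ab_array a b v s \<delta> \<mu>"
  obtain N N' where b: "array_bdd N (act p ?G)" "array_bdd N' (act p' ?G)"
    using clears_array_bdd[OF assms(1,3)] clears_array_bdd[OF assms(2,3)] by blast
  have "eval_poly2 p' * subst_ser (act p ?G) = eval_poly2 p * subst_ser (act p' ?G)"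
    using subst_ser_act[OF b(1), of p'] subst_ser_act[OF b(2), of p] by (simp add: act_commute)
  moreover have "eval_poly2 p \<noteq> 0" "eval_poly2 p' \<noteq> 0"
    using assms(1,2) eval_poly2_nonzero[of p] eval_poly2_nonzero[of p'] by (auto simp: clears_def)
  ultimately have "inverse (eval_poly2 p) * subst_ser (act p ?G) = inverse (eval_poly2 p') * subst_ser (act p' ?G)"
    by (rule inverse_cross_mult)
  then show "lookup (lookup (nth_prod_with p a b r v s) \<delta>) \<mu>
     = lookup (lookup (nth_prod_with p' a b r v s) \<delta>) \<mu>"
    using lookup_nth_prod_with assms by simp
qed

text \<open>The polynomial \<open>z\<^sub>1 - cz\<^sub>2\<close>\<close>

definition lin_poly :: "scal \<Rightarrow> scal poly poly" where
  "lin_poly c = [:[:0, - c:], [:1:]:]"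

lemma pab_lin_poly:
  "pab (lin_poly c) a b v s s' = smV (- c) (a (b v (s' - 1)) s) + a (b v s') (s - 1)"
  by (cases "c = 0") (auto simp: pab_def lin_poly_def)

lemma eval_lin_poly: "eval_poly2 (lin_poly c) = fls_X + fls_const (fls_const (1 - c) * fls_X)"
proof -
  have "eval_poly2 (lin_poly c) = fls_const (fls_const (- c) * fls_X) + (fls_X + fls_const fls_X)"
    by (cases "c = 0") (auto simp: eval_poly2_def lin_poly_def)
  also have "\<dots> = fls_X + fls_const (fls_const (1 - c) * fls_X)"
    by (simp add: fls_plus_const[symmetric] fls_minus_const[symmetric] algebra_simps fls_eq_iff)
  finally show ?thesis .
qed

text \<open>For \<open>c = 1\<close> the denominator is \<open>z\<^sub>0\<close> itself, and the
  zeroth product is the cleared product at \<open>z\<^sub>0 = 0\<close>, that is, at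
  \<open>z\<^sub>1 = z\<close>. For \<open>c \<noteq> 1\<close> the denominator is invertible as a
  power series in \<open>z\<^sub>0\<close>, so there is no residue.\<close>

lemma nth_prod_lin_poly:
  assumes cl: "clears n (lin_poly c) a b" and a: "a \<in> Hom_Laurent n 1" and b: "b \<in> Hom_Laurent n (Suc n)"
  shows "nth_prod n a b 0 = on_V n (if c = 1 then
      \<lambda>v s. Sum_any (\<lambda>m::int. pab (lin_poly c) a b v (of_int m) (s - of_int m)) else 0)"
proof -
  have qc: "quasi_compatible n a b" using assms by (auto simp: quasi_compatible_def)
  have cl': "clears n (SOME p. clears n p a b) a b" using cl by (rule someI)
  let ?R = "\<lambda>v s. if c = 1 then Sum_any (\<lambda>m::int. pab (lin_poly c) a b v (of_int m) (s - of_int m)) else 0"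
  have "nth_prod_with (SOME p. clears n p a b) a b 0 v s = ?R v s" if v: "v \<in> Vsp n" for v s
  proof (rule trans[OF nth_prod_with_indep[OF cl' cl v]], rule poly_mapping_eqI, rule poly_mapping_eqI)
    fix \<delta> \<mu>
    let ?G = "act (lin_poly c) (ab_array a b v s \<delta> \<mu>)"
    obtain N where N: "\<And>s1 s'. s1 < of_int N \<or> s' < of_int N + s \<Longrightarrow> pab (lin_poly c) a b v s1 s' = 0"
      by (rule clears_bound[OF cl v, of s]) blast
    have G: "array_bdd N ?G"
      unfolding array_bdd_def lookup_pab[symmetric] using N by (auto simp: add.commute)
    have L: "lookup (lookup (nth_prod_with (lin_poly c) a b 0 v s) \<delta>) \<mu>
       = fls_nth (fls_nth (inverse (eval_poly2 (lin_poly c)) * subst_ser ?G) (- 1)) 0"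
      using lookup_nth_prod_with[OF cl v, of 0 s \<delta> \<mu>] by simp
    show "lookup (lookup (nth_prod_with (lin_poly c) a b 0 v s) \<delta>) \<mu>
       = lookup (lookup (?R v s) \<delta>) \<mu>"
    proof (cases "c = 1")
      case True
      have "eval_poly2 (lin_poly c) = fls_X" using True by (simp add: eval_lin_poly)
      then have "fls_nth (fls_nth (inverse (eval_poly2 (lin_poly c)) * subst_ser ?G) (- 1)) 0
         = fls_nth (fls_nth (subst_ser ?G) 0) 0"
        by (simp add: fls_inverse_X fls_X_inv_times_conv_shift)
      also have "\<dots> = Sum_any (\<lambda>m. ?G m (- m))"
        by (simp add: subst_ser_nth[OF G] subst_coeff_def)
      also have "\<dots> = lookup (lookup (?R v s) \<delta>) \<mu>"
      proof -
        have z: "pab (lin_poly c) a b v (of_int m) (s - of_int m) = 0" if "\<not> (N \<le> m \<and> m \<le> - N)" for m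
        proof (rule N)
          have "m < N \<or> - m < N" using that by linarith
          then have "(of_int m :: rat) < of_int N \<or> (of_int (- m) :: rat) < of_int N"
            by (simp only: of_int_less_iff)
          then show "(of_int m :: rat) < of_int N \<or> s - of_int m < of_int N + s" by auto
        qed
        have e: "s - of_int m = s + of_int (- m)" for m :: int by simp
        have "{m. pab (lin_poly c) a b v (of_int m) (s - of_int m) \<noteq> 0} \<subseteq> {N..- N}"
        proof (rule subsetI)
          fix m assume "m \<in> {m. pab (lin_poly c) a b v (of_int m) (s - of_int m) \<noteq> 0}"
          then have "pab (lin_poly c) a b v (of_int m) (s - of_int m) \<noteq> 0" by (rule CollectD)
          then have "N \<le> m \<and> m \<le> - N" by (rule contrapos_np) (rule z)
          then show "m \<in> {N..- N}" by simp
        qed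
        then have "?R v s = (\<Sum>m\<in>{N..- N}. pab (lin_poly c) a b v (of_int m) (s - of_int m))"
          unfolding if_P[OF True] by (rule Sum_any.expand_superset[rotated]) simp
        then have "lookup (lookup (?R v s) \<delta>) \<mu> = (\<Sum>m\<in>{N..- N}. ?G m (- m))"
          by (simp only: lookup_sum e lookup_pab)
        moreover have "Sum_any (\<lambda>m. ?G m (- m)) = (\<Sum>m\<in>{N..- N}. ?G m (- m))"
        proof (rule Sum_any.expand_superset)
          show "{m. ?G m (- m) \<noteq> 0} \<subseteq> {N..- N}"
          proof
            fix m assume "m \<in> {m. ?G m (- m) \<noteq> 0}"
            then have "\<not> (m < N \<or> - m < N)" using G unfolding array_bdd_def by auto
            then show "m \<in> {N..- N}" by auto
          qed
        qed simp
        ultimately show ?thesis by simp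
      qed
      finally show ?thesis unfolding L .
    next
      case False
      let ?E = "eval_poly2 (lin_poly c)"
      have "fls_subdegree ?E = 0"
        unfolding eval_lin_poly using False
        by (intro fls_subdegree_eqI) (auto simp: fls_eq_iff fls_X_times_conv_shift(2))
      then have "fls_subdegree (inverse ?E) = 0" by (simp add: fls_inverse_subdegree)
      moreover have "fls_subdegree (subst_ser ?G) \<ge> 0"
        by (intro fls_subdegree_ge0I fls_eqI) (simp add: subst_ser_nth[OF G])
      ultimately have "fls_nth (inverse ?E * subst_ser ?G) (- 1) = 0"
        by (intro fls_times_nth_eq0) simp
      then show ?thesis unfolding L using False by simp
    qed
  qed
  then show ?thesis using qc by (auto simp: nth_prod_def on_V_def fun_eq_iff)
qed

section \<open>Vertex operators\<close>

lemma form_add_left: "form n (\<beta> + \<beta>') \<gamma> = form n \<beta> \<gamma> + form n \<beta>' \<gamma>"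
  by (simp add: form_def lookup_add distrib_right sum.distrib add_divide_distrib)

lemma form_add_right: "form n \<beta> (\<gamma> + \<gamma>') = form n \<beta> \<gamma> + form n \<beta> \<gamma>'"
  by (simp add: form_def lookup_add distrib_right distrib_left sum.distrib add_divide_distrib)

lemma form_0_left [simp]: "form n 0 \<gamma> = 0" and form_0_right [simp]: "form n \<gamma> 0 = 0"
  by (simp_all add: form_def)

lemma form_uminus_left: "form n (- \<beta>) \<gamma> = - form n \<beta> \<gamma>"
  using form_add_left[of n "- \<beta>" \<beta> \<gamma>] by simp

text \<open>The origin of the fractional powers \<open>z^(1/(n+1))\<close>: the inverse Cartan
  matrix has denominator \<open>n + 1\<close>.\<close>

lemma form_denominator: "of_nat (Suc n) * form n \<beta> \<gamma> \<in> \<int>"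
proof -
  have "of_nat (Suc n) * form n \<beta> \<gamma> = (\<Sum>i=1..n. \<Sum>j=1..n.
     of_int (lookup \<beta> i) * of_int (lookup \<gamma> j)
     * (of_nat (min i j) * of_nat (Suc n - max i j)))"
    unfolding form_def sum_distrib_left by (intro sum.cong refl) (simp del: of_nat_Suc)
  also have "\<dots> \<in> \<int>" by (intro Ints_sum Ints_mult) auto
  finally show ?thesis .
qed

lemma Plat_add: "\<beta> \<in> Plat n \<Longrightarrow> \<gamma> \<in> Plat n \<Longrightarrow> \<beta> + \<gamma> \<in> Plat n"
  using keys_add[of \<beta> \<gamma>] by (auto simp: Plat_def)

lemma Plat_0 [simp]: "0 \<in> Plat n"
  by (simp add: Plat_def)

lemma Plat_uminus: "\<beta> \<in> Plat n \<Longrightarrow> - \<beta> \<in> Plat n"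
  by (auto simp: Plat_def in_keys_iff)

section \<open>Stability of the space \<open>Vsp\<close> under the operators\<close>

definition Mon :: "nat \<Rightarrow> ((nat \<times> nat) \<Rightarrow>\<^sub>0 nat) set" where
  "Mon n = {\<mu>. keys \<mu> \<subseteq> {1..n} \<times> {1..}}"

definition Fk :: "nat \<Rightarrow> fock set" where
  "Fk n = {p. keys p \<subseteq> Mon n}"

lemma Vsp_iff: "v \<in> Vsp n \<longleftrightarrow> keys v \<subseteq> Plat n \<and> (\<forall>\<beta>. lookup v \<beta> \<in> Fk n)"
  by (auto simp: Vsp_def Fk_def Mon_def)

lemma Mon_0 [simp]: "0 \<in> Mon n"
  by (simp add: Mon_def)

lemma Mon_add: "\<mu> \<in> Mon n \<Longrightarrow> \<nu> \<in> Mon n \<Longrightarrow> \<mu> + \<nu> \<in> Mon n"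
  using keys_add[of \<mu> \<nu>] by (auto simp: Mon_def)

lemma Fk_0 [simp]: "0 \<in> Fk n"
  by (simp add: Fk_def)

lemma Fk_1 [simp]: "1 \<in> Fk n"
  by (simp add: Fk_def)

lemma Fk_add: "p \<in> Fk n \<Longrightarrow> p' \<in> Fk n \<Longrightarrow> p + p' \<in> Fk n"
  using keys_add[of p p'] by (auto simp: Fk_def)

lemma Fk_sum: "(\<And>i. i \<in> I \<Longrightarrow> f i \<in> Fk n) \<Longrightarrow> sum f I \<in> Fk n"
  by (induction I rule: infinite_finite_induct) (auto simp: Fk_add)

lemma Fk_smK: "p \<in> Fk n \<Longrightarrow> smK c p \<in> Fk n"
  by (auto simp: Fk_def in_keys_iff lookup_smK)

lemma Fk_mult: "p \<in> Fk n \<Longrightarrow> p' \<in> Fk n \<Longrightarrow> p * p' \<in> Fk n"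
  using keys_mult[of p p'] Mon_add by (fastforce simp: Fk_def)

lemma Fk_of_nat_mult: "p \<in> Fk n \<Longrightarrow> of_nat m * p \<in> Fk n"
  by (simp add: Fk_smK flip: smK_of_nat)

lemma Fk_cancel: "of_nat m * p \<in> Fk n \<Longrightarrow> m > 0 \<Longrightarrow> p \<in> Fk n"
  using Fk_smK[of "of_nat m * p" n "1 / of_nat m"] by (simp add: smK_smK flip: smK_of_nat)

lemma Fk_var: "i \<in> {1..n} \<Longrightarrow> r > 0 \<Longrightarrow> var (i, r) \<in> Fk n"
  by (auto simp: Fk_def var_def Mon_def)

lemma Fk_pdiff: "p \<in> Fk n \<Longrightarrow> pdiff x p \<in> Fk n"
proof -
  assume p: "p \<in> Fk n"
  have "\<mu> \<in> Mon n" if "\<mu> \<in> keys (pdiff x p)" for \<mu>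
  proof -
    have "\<mu> + single x 1 \<in> keys p"
      using that by (auto simp: in_keys_iff lookup_pdiff)
    then have "keys (\<mu> + single x 1) \<subseteq> {1..n} \<times> {1..}"
      using p by (auto simp: Fk_def Mon_def)
    moreover have "keys \<mu> \<subseteq> keys (\<mu> + single x 1)"
      by (auto simp: in_keys_iff lookup_add)
    ultimately show ?thesis by (auto simp: Mon_def)
  qed
  then show ?thesis by (auto simp: Fk_def)
qed

lemma Fk_Hc: "Hc n u m \<in> Fk n"
proof (induction m rule: less_induct)
  case (less m)
  show ?case
  proof (cases "m = 0")
    case False
    have "of_nat m * Hc n u m \<in> Fk n"
      unfolding Hc_rec Up_def using less False
      by (intro Fk_sum Fk_of_nat_mult Fk_mult Fk_smK Fk_var) auto
    then show ?thesis using False by (auto intro: Fk_cancel)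
  qed (simp add: Hc_0)
qed

lemma Fk_Hz: "Hz n u m \<in> Fk n"
  by (simp add: Hz_def Fk_Hc)

lemma Fk_Tc: "p \<in> Fk n \<Longrightarrow> Tc n d m p \<in> Fk n"
proof (induction m rule: less_induct)
  case (less m)
  show ?case
  proof (cases "m = 0")
    case False
    have "of_nat m * Tc n d m p \<in> Fk n"
      unfolding Tc_rec Dn_def using less False
      by (intro Fk_sum Fk_of_nat_mult Fk_smK Fk_pdiff) auto
    then show ?thesis using False by (auto intro: Fk_cancel)
  qed (use less in simp)
qed

lemma Fk_Lc: "p \<in> Fk n \<Longrightarrow> Lc n u d p m \<in> Fk n"
  using tbound_ex[of n p] by (auto simp: Lc_tbound intro!: Fk_sum Fk_mult Fk_Hz Fk_Tc)

lemma Vsp_add: "u \<in> Vsp n \<Longrightarrow> v \<in> Vsp n \<Longrightarrow> u + v \<in> Vsp n"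
  using keys_add[of u v] by (auto simp: Vsp_iff lookup_add Fk_add)

lemma Vsp_0 [simp]: "0 \<in> Vsp n"
  by (simp add: Vsp_iff)

lemma Vsp_smV: "v \<in> Vsp n \<Longrightarrow> smV c v \<in> Vsp n"
proof -
  assume v: "v \<in> Vsp n"
  have "keys (smV c v) \<subseteq> keys v"
    by (auto simp: in_keys_iff lookup_smV)
  then show ?thesis using v by (auto simp: Vsp_iff lookup_smV Fk_smK)
qed

lemma Vsp_single: "\<beta> \<in> Plat n \<Longrightarrow> p \<in> Fk n \<Longrightarrow> single \<beta> p \<in> Vsp n"
  by (auto simp: Vsp_iff lookup_single when_def)

text \<open>\<open>VO n u d \<gamma> g\<close> maps \<open>p \<otimes> e\<^sup>\<beta>\<close> to
  \<open>g \<beta> exp(\<Sum>u(i,r) a\<^sub>i(-r) z\<^sup>r) p(a\<^sub>i(-r) + d(i,r) z\<^bsup>-r\<^esup>) z\<^bsup>(\<gamma>,\<beta>)\<^esup> \<otimes> e\<^bsup>\<gamma>+\<beta>\<^esup>\<close>; all operators of the theory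
  are of this form.\<close>

definition VOc :: "nat \<Rightarrow> (nat \<times> nat \<Rightarrow> scal) \<Rightarrow> (nat \<times> nat \<Rightarrow> scal) \<Rightarrow> weight \<Rightarrow> (weight \<Rightarrow> scal)
    \<Rightarrow> weight \<Rightarrow> fock \<Rightarrow> rat \<Rightarrow> fock" where
  "VOc n u d \<gamma> g \<beta> p s = (if s - form n \<gamma> \<beta> \<in> \<int> then smK (g \<beta>) (Lc n u d p \<lfloor>s - form n \<gamma> \<beta>\<rfloor>) else 0)"

definition VO :: "nat \<Rightarrow> (nat \<times> nat \<Rightarrow> scal) \<Rightarrow> (nat \<times> nat \<Rightarrow> scal) \<Rightarrow> weight \<Rightarrow> (weight \<Rightarrow> scal) \<Rightarrow> oper" where
  "VO n u d \<gamma> g = on_V n (\<lambda>v s. \<Sum>\<beta>\<in>keys v.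
     single (\<gamma> + \<beta>) (VOc n u d \<gamma> g \<beta> (lookup v \<beta>) s))"

lemma VOc_0 [simp]: "VOc n u d \<gamma> g \<beta> 0 s = 0"
  by (simp add: VOc_def)

lemma VOc_add: "VOc n u d \<gamma> g \<beta> (p + p') s = VOc n u d \<gamma> g \<beta> p s + VOc n u d \<gamma> g \<beta> p' s"
  by (simp add: VOc_def Lc_add smK_add)

lemma VOc_smK: "VOc n u d \<gamma> g \<beta> (smK c p) s = smK c (VOc n u d \<gamma> g \<beta> p s)"
  by (simp add: VOc_def Lc_smK smK_smK mult.commute)

lemma Fk_VOc: "p \<in> Fk n \<Longrightarrow> VOc n u d \<gamma> g \<beta> p s \<in> Fk n"
  by (simp add: VOc_def Fk_smK Fk_Lc)

lemma VO_outside: "v \<notin> Vsp n \<Longrightarrow> VO n u d \<gamma> g v = 0"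
  by (simp add: VO_def on_V_def)

lemma lookup_VO:
  assumes "v \<in> Vsp n"
  shows "lookup (VO n u d \<gamma> g v s) \<delta> = VOc n u d \<gamma> g (\<delta> - \<gamma>) (lookup v (\<delta> - \<gamma>)) s"
proof -
  have "\<gamma> + \<beta> = \<delta> \<longleftrightarrow> \<beta> = \<delta> - \<gamma>" for \<beta> by (auto simp: algebra_simps)
  then show ?thesis using assms
    by (simp add: VO_def on_V_def lookup_sum lookup_single when_def in_keys_iff)
qed

lemma oper_eqI:
  assumes "\<And>v. v \<notin> Vsp n \<Longrightarrow> a v = b v"
    "\<And>v s \<delta>. v \<in> Vsp n \<Longrightarrow> lookup (a v s) \<delta> = lookup (b v s) \<delta>"
  shows "a = (b :: oper)"
proof
  fix v show "a v = b v"
    using assms by (cases "v \<in> Vsp n") (auto intro!: ext poly_mapping_eqI)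
qed

lemma VO_Vsp:
  assumes "v \<in> Vsp n" "\<gamma> \<in> Plat n"
  shows "VO n u d \<gamma> g v s \<in> Vsp n"
  unfolding Vsp_iff
proof
  show "\<forall>\<beta>. lookup (VO n u d \<gamma> g v s) \<beta> \<in> Fk n"
    using assms by (auto simp: lookup_VO Vsp_iff intro: Fk_VOc)
  have "lookup v (\<delta> - \<gamma>) \<noteq> 0" if "\<delta> \<in> keys (VO n u d \<gamma> g v s)" for \<delta>
    using that assms by (auto simp: in_keys_iff lookup_VO)
  then have "\<delta> - \<gamma> \<in> Plat n" if "\<delta> \<in> keys (VO n u d \<gamma> g v s)" for \<delta>
    using that assms(1) by (auto simp: in_keys_iff Vsp_iff)
  then show "keys (VO n u d \<gamma> g v s) \<subseteq> Plat n"
    using Plat_add[OF _ assms(2)] by fastforce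
qed

lemma vbound_ex: "\<exists>B. \<forall>\<beta>. tbound n (lookup v \<beta>) B"
proof -
  have "\<forall>\<beta>. \<exists>B. tbound n (lookup v \<beta>) B" using tbound_ex by blast
  then obtain f where f: "\<And>\<beta>. tbound n (lookup v \<beta>) (f \<beta>)" by metis
  define B where "B = Max (insert 0 (f ` keys v))"
  have "tbound n (lookup v \<beta>) B" for \<beta>
  proof (cases "\<beta> \<in> keys v")
    case True
    then have "f \<beta> \<le> B" by (auto simp: B_def)
    then show ?thesis using f tbound_mono by blast
  next
    case False
    then show ?thesis by (simp add: in_keys_iff tbound_def)
  qed
  then show ?thesis by blast
qed

lemma finite_rat_bound: "finite (A :: rat set) \<Longrightarrow> \<exists>M. \<forall>x\<in>A. - M \<le> x \<and> x \<le> M"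
proof (induction rule: finite_induct)
  case (insert x A)
  then obtain M where M: "\<forall>x\<in>A. - M \<le> x \<and> x \<le> M" by blast
  show ?case
    by (rule exI[of _ "max M \<bar>x\<bar>"]) (use M in \<open>fastforce simp: max_def abs_if\<close>)
qed simp

lemma VO_Hom_Laurent:
  assumes "\<gamma> \<in> Plat n" and N: "\<And>\<beta>. \<beta> \<in> Plat n \<Longrightarrow> of_nat N * form n \<gamma> \<beta> \<in> \<int>"
  shows "VO n u d \<gamma> g \<in> Hom_Laurent n N"
proof -
  let ?c = "VO n u d \<gamma> g"
  have 1: "?c (smV k v) s = smV k (?c v s)" if v: "v \<in> Vsp n" for k v s
    by (rule poly_mapping_eqI) (simp add: lookup_VO v Vsp_smV lookup_smV VOc_smK)
  have 2: "?c (w + v) s = ?c w s + ?c v s" if "w \<in> Vsp n" "v \<in> Vsp n" for v w s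
    by (rule poly_mapping_eqI) (simp add: lookup_VO that Vsp_add lookup_add VOc_add)
  have 3: "of_nat N * s \<in> \<int>" if v: "v \<in> Vsp n" and "?c v s \<noteq> 0" for v s
  proof -
    from that obtain \<delta> where \<delta>: "lookup (?c v s) \<delta> \<noteq> 0"
      by (metis lookup_zero poly_mapping_eqI)
    then have i: "s - form n \<gamma> (\<delta> - \<gamma>) \<in> \<int>" and nz: "lookup v (\<delta> - \<gamma>) \<noteq> 0"
      using v by (auto simp: lookup_VO VOc_def split: if_splits)
    from nz have "\<delta> - \<gamma> \<in> Plat n" using v by (auto simp: Vsp_iff in_keys_iff)
    then have "of_nat N * (s - form n \<gamma> (\<delta> - \<gamma>)) + of_nat N * form n \<gamma> (\<delta> - \<gamma>) \<in> \<int>"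
      by (rule Ints_add[OF Ints_mult[OF Ints_of_nat i] N])
    then show ?thesis by (simp add: algebra_simps)
  qed
  have 4: "\<exists>b. \<forall>s<b. ?c v s = 0" if v: "v \<in> Vsp n" for v
  proof -
    obtain B where B: "\<And>\<beta>. tbound n (lookup v \<beta>) B" using vbound_ex[of n v] by blast
    obtain M where M: "\<And>\<beta>. \<beta> \<in> keys v \<Longrightarrow> - M \<le> form n \<gamma> \<beta>"
      using finite_rat_bound[of "form n \<gamma> ` keys v"] by auto
    show ?thesis
    proof (intro exI allI impI, rule poly_mapping_eqI)
      fix s \<delta> assume s: "s < - M - of_nat B"
      show "lookup (?c v s) \<delta> = lookup 0 \<delta>"
      proof (cases "\<delta> - \<gamma> \<in> keys v")
        case True
        then have "\<lfloor>s - form n \<gamma> (\<delta> - \<gamma>)\<rfloor> < - int B"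
          using s M[OF True] by (simp add: floor_less_iff)
        then show ?thesis by (simp add: lookup_VO v VOc_def Lc_low[OF B])
      qed (simp add: lookup_VO v in_keys_iff)
    qed
  qed
  show ?thesis
    unfolding Hom_Laurent_def using 1 2 3 4 VO_Vsp[OF _ assms(1)] VO_outside by simp
qed

lemma VO_cong:
  assumes "\<And>i r. i \<in> {1..n} \<Longrightarrow> r > 0 \<Longrightarrow> u' (i, r) = u (i, r)"
    "\<And>i r. i \<in> {1..n} \<Longrightarrow> r > 0 \<Longrightarrow> d' (i, r) = d (i, r)"
    "\<And>\<beta>. \<beta> \<in> Plat n \<Longrightarrow> g' \<beta> = g \<beta>"
  shows "VO n u' d' \<gamma> g' = VO n u d \<gamma> g"
proof (rule oper_eqI[of n])
  fix v s \<delta> assume v: "v \<in> Vsp n"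
  show "lookup (VO n u' d' \<gamma> g' v s) \<delta> = lookup (VO n u d \<gamma> g v s) \<delta>"
  proof (cases "lookup v (\<delta> - \<gamma>) = 0")
    case False
    then have "\<delta> - \<gamma> \<in> Plat n" using v by (auto simp: Vsp_iff in_keys_iff)
    then show ?thesis using v assms(3) Lc_cong[of n u' u d' d, OF assms(1,2)]
      by (simp add: lookup_VO VOc_def)
  qed (simp add: lookup_VO v)
qed (simp add: VO_outside)

lemma VO_0: "VO n u d \<gamma> (\<lambda>_. 0) = 0"
  by (rule oper_eqI[of n]) (simp_all add: VO_outside lookup_VO VOc_def smK_0_left)

lemma smO_VO: "smO c (VO n u d \<gamma> g) = VO n u d \<gamma> (\<lambda>\<beta>. c * g \<beta>)"
proof (rule oper_eqI[of n])
  fix v assume "v \<notin> Vsp n" then show "smO c (VO n u d \<gamma> g) v = VO n u d \<gamma> (\<lambda>\<beta>. c * g \<beta>) v"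
    by (simp add: VO_outside smO_def zero_fun_def)
qed (simp add: lookup_VO VOc_def smO_def lookup_smV smK_smK)

section \<open>Shifts and products of vertex operators\<close>

definition scaled :: "rat \<Rightarrow> (nat \<times> nat \<Rightarrow> scal) \<Rightarrow> nat \<times> nat \<Rightarrow> scal" where
  "scaled t u x = qpow t ^ snd x * u x"

text \<open>An exponent of \<open>z\<close> is \<open>form n \<gamma> \<beta>\<close> plus an
  integer. The integer part of the rescaling is absorbed by \<open>u\<close> and \<open>d\<close>,
  the rest goes into the character; integrality of the form keeps all exponents of \<open>q\<close>
  half-integral.\<close>

lemma shift_VO:
  assumes t: "2 * t \<in> \<int>" and \<gamma>: "\<forall>\<beta>\<in>Plat n. form n \<gamma> \<beta> \<in> \<int>"
  shows "shift t (VO n u d \<gamma> g) = VO n (scaled t u) (scaled (- t) d) \<gamma> (\<lambda>\<beta>. qpow (t * form n \<gamma> \<beta>) * g \<beta>)"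
proof (rule oper_eqI[of n])
  fix v assume "v \<notin> Vsp n"
  then show "shift t (VO n u d \<gamma> g) v = VO n (scaled t u) (scaled (- t) d) \<gamma> (\<lambda>\<beta>. qpow (t * form n \<gamma> \<beta>) * g \<beta>) v"
    by (simp add: VO_outside shift_def zero_fun_def)
next
  fix v s \<delta> assume v: "v \<in> Vsp n"
  define \<beta> where "\<beta> = \<delta> - \<gamma>"
  show "lookup (shift t (VO n u d \<gamma> g) v s) \<delta>
     = lookup (VO n (scaled t u) (scaled (- t) d) \<gamma> (\<lambda>\<beta>. qpow (t * form n \<gamma> \<beta>) * g \<beta>) v s) \<delta>"
  proof (cases "lookup v \<beta> = 0 \<or> s - form n \<gamma> \<beta> \<notin> \<int>")
    case True
    then show ?thesis using v by (auto simp: shift_def lookup_smV lookup_VO VOc_def \<beta>_def)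
  next
    case False
    then have "\<beta> \<in> Plat n" using v by (auto simp: Vsp_iff in_keys_iff)
    then obtain f where f: "form n \<gamma> \<beta> = of_int f" using \<gamma> by (auto elim: Ints_cases)
    obtain m where m: "s - form n \<gamma> \<beta> = of_int m" using False by (auto elim: Ints_cases)
    have "Lc n (scaled t u) (scaled (- t) d) p m = smK (qpow t powi m) (Lc n u d p m)" for p
      by (rule Lc_scale) (simp_all add: scaled_def qpow_minus t power_inverse)
    moreover have "qpow (t * s) = qpow (t * form n \<gamma> \<beta>) * qpow t powi m"
    proof -
      have s: "s = form n \<gamma> \<beta> + of_int m" using m by simp
      obtain k where k: "2 * t = of_int k" using t by (auto elim: Ints_cases)
      have "2 * (t * of_int j) = of_int (k * j)" for j using k by simp
      then have e: "2 * (t * of_int j) \<in> \<int>" "qpow (t * of_int j) = qpow t powi j" for j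
        by (simp_all only: qpow_def k floor_of_int power_int_mult Ints_of_int)
      show ?thesis unfolding s f distrib_left by (simp add: qpow_add e)
    qed
    ultimately show ?thesis using v m
      by (simp add: shift_def lookup_smV lookup_VO VOc_def \<beta>_def smK_smK mult_ac)
  qed
qed

text \<open>The case in which the contraction series has a simple pole at \<open>z\<^sub>1 = cz\<close> only\<close>

lemma Lc_pole:
  assumes C: "is_exp (\<lambda>r. \<Sum>i=1..n. d (i, r) * u' (i, r)) C"
    and R: "\<And>m. R m = fps_nth C m - (if m = 0 then 0 else c * fps_nth C (m - 1))"
    and K: "\<forall>m>K. R m = 0" and B: "tbound n p B"
  shows "Lc n u d (Lc n u' d' p y) (x - 1) - smK c (Lc n u d (Lc n u' d' p (y - 1)) x)
    = (\<Sum>k\<le>K. smK (R k) (Nc n u d u' d' B p (x - 1 + int k) (y - int k)))"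
proof -
  define L where "L = max K (nat (y + int B))"
  define F where "F k = Nc n u d u' d' B p (x - 1 + int k) (y - int k)" for k
  have 1: "Lc n u d (Lc n u' d' p y) (x - 1) = (\<Sum>k\<le>Suc L. smK (fps_nth C k) (F k))"
    unfolding F_def by (rule Lc_Lc[OF C B]) (simp add: L_def)
  have "Lc n u d (Lc n u' d' p (y - 1)) x = (\<Sum>k\<le>L. smK (fps_nth C k) (Nc n u d u' d' B p (x + int k) (y - 1 - int k)))"
    by (rule Lc_Lc[OF C B]) (simp add: L_def)
  also have "\<dots> = (\<Sum>k\<le>L. smK (fps_nth C k) (F (Suc k)))"
    unfolding F_def by (intro sum.cong refl) (simp add: algebra_simps)
  also have "smK c \<dots> = (\<Sum>k\<le>Suc L. smK (if k = 0 then 0 else c * fps_nth C (k - 1)) (F k))"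
    by (subst sum.atMost_Suc_shift) (simp add: smK_sum smK_smK smK_0_left)
  finally have 2: "smK c (Lc n u d (Lc n u' d' p (y - 1)) x)
     = (\<Sum>k\<le>Suc L. smK (if k = 0 then 0 else c * fps_nth C (k - 1)) (F k))" .
  have diff: "smK (a - b) q = smK a q - smK b q" for a b q
    by (rule poly_mapping_eqI) (simp add: lookup_smK lookup_minus algebra_simps)
  have "Lc n u d (Lc n u' d' p y) (x - 1) - smK c (Lc n u d (Lc n u' d' p (y - 1)) x)
      = (\<Sum>k\<le>Suc L. smK (R k) (F k))"
    unfolding 1 2 sum_subtractf[symmetric] R diff ..
  also have "\<dots> = (\<Sum>k\<le>K. smK (R k) (F k))"
    by (intro sum.mono_neutral_right) (auto simp: L_def K smK_0_left)
  finally show ?thesis unfolding F_def .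
qed

lemma lookup_VO_VO:
  assumes v: "v \<in> Vsp n" and \<gamma>: "\<gamma> \<in> Plat n" "\<gamma>' \<in> Plat n"
  shows "lookup (VO n u d \<gamma> g (VO n u' d' \<gamma>' g' v s') s) (\<beta> + \<gamma>' + \<gamma>)
    = (if s' - form n \<gamma>' \<beta> \<in> \<int> \<and> s - form n \<gamma> (\<gamma>' + \<beta>) \<in> \<int>
       then smK (g (\<gamma>' + \<beta>) * g' \<beta>) (Lc n u d (Lc n u' d' (lookup v \<beta>) \<lfloor>s' - form n \<gamma>' \<beta>\<rfloor>)
         \<lfloor>s - form n \<gamma> (\<gamma>' + \<beta>)\<rfloor>) else 0)"
proof -
  have e: "\<beta> + \<gamma>' + \<gamma> - \<gamma> = \<gamma>' + \<beta>" "\<gamma>' + \<beta> - \<gamma>' = \<beta>" by (simp_all add: algebra_simps)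
  show ?thesis
    unfolding lookup_VO[OF VO_Vsp[OF v \<gamma>(2)]] lookup_VO[OF v] e
    by (auto simp: VOc_def Lc_smK smK_smK)
qed

text \<open>Writing \<open>z\<^sub>1 - c z\<close> as \<open>z\<^sub>1 (1 - c z/z\<^sub>1)\<close>,
  the second factor turns the contraction \<open>C\<close> into the polynomial \<open>R\<close> in
  \<open>z/z\<^sub>1\<close>, and the first one accounts for the displacement by 1.\<close>

lemma lookup_pab_VO:
  assumes v: "v \<in> Vsp n" and \<gamma>: "\<gamma> \<in> Plat n" "\<gamma>' \<in> Plat n"
    and C: "is_exp (\<lambda>r. \<Sum>i=1..n. d (i, r) * u' (i, r)) C"
    and R: "\<And>m. R m = fps_nth C m - (if m = 0 then 0 else c * fps_nth C (m - 1))"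
    and K: "\<forall>m>K. R m = 0" and B: "tbound n (lookup v \<beta>) B"
  shows "lookup (pab (lin_poly c) (VO n u d \<gamma> g) (VO n u' d' \<gamma>' g') v s s') (\<beta> + \<gamma>' + \<gamma>)
    = (if s' - form n \<gamma>' \<beta> \<in> \<int> \<and> s - form n \<gamma> (\<gamma>' + \<beta>) \<in> \<int>
       then smK (g (\<gamma>' + \<beta>) * g' \<beta>) (\<Sum>k\<le>K. smK (R k) (Nc n u d u' d' B (lookup v \<beta>)
         (\<lfloor>s - form n \<gamma> (\<gamma>' + \<beta>)\<rfloor> - 1 + int k) (\<lfloor>s' - form n \<gamma>' \<beta>\<rfloor> - int k))) else 0)"
proof (cases "s' - form n \<gamma>' \<beta> \<in> \<int> \<and> s - form n \<gamma> (\<gamma>' + \<beta>) \<in> \<int>")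
  case True
  then obtain y x where y: "s' - form n \<gamma>' \<beta> = of_int y" and x: "s - form n \<gamma> (\<gamma>' + \<beta>) = of_int x"
    by (auto elim!: Ints_cases)
  have y1: "s' - 1 - form n \<gamma>' \<beta> = of_int (y - 1)" and x1: "s - 1 - form n \<gamma> (\<gamma>' + \<beta>) = of_int (x - 1)"
    using x y by auto
  have neg: "smK (- c) q = - smK c q" for q
    by (rule poly_mapping_eqI) (simp add: lookup_smK)
  have fl: "smK w P + - smK c (smK w Q) = smK w S" if "P - smK c Q = S" for w P Q S
    unfolding that[symmetric] smK_diff smK_smK by (simp add: mult.commute)
  have "smK w (Lc n u d (Lc n u' d' (lookup v \<beta>) y) (x - 1))
      + - smK c (smK w (Lc n u d (Lc n u' d' (lookup v \<beta>) (y - 1)) x))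
    = smK w (\<Sum>k\<le>K. smK (R k) (Nc n u d u' d' B (lookup v \<beta>) (x - 1 + int k) (y - int k)))" for w
    by (rule fl) (rule Lc_pole[OF C R K B])
  then show ?thesis
    unfolding pab_lin_poly lookup_add lookup_smV lookup_VO_VO[OF v \<gamma>] x y x1 y1 neg
    by (simp add: add.commute)
next
  case False
  have i: "q - 1 - f \<in> \<int> \<longleftrightarrow> q - f \<in> \<int>" for q f :: rat
    using Ints_add[of "q - 1 - f" 1] Ints_diff[of "q - f" 1] by (auto simp: algebra_simps)
  show ?thesis using False unfolding pab_lin_poly lookup_add lookup_smV lookup_VO_VO[OF v \<gamma>] i by auto
qed

lemma Nc_zero [simp]: "Nc n u d u' d' B 0 x y = 0"
  by (simp add: Nc_def)

text \<open>After clearing, finitely many normally ordered terms remain, and in each of them both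
  exponents are bounded below.\<close>

lemma clears_VO:
  assumes \<gamma>: "\<gamma> \<in> Plat n" "\<gamma>' \<in> Plat n"
    and C: "is_exp (\<lambda>r. \<Sum>i=1..n. d (i, r) * u' (i, r)) C"
    and R: "\<And>m. R m = fps_nth C m - (if m = 0 then 0 else c * fps_nth C (m - 1))"
    and K: "\<forall>m>K. R m = 0"
  shows "clears n (lin_poly c) (VO n u d \<gamma> g) (VO n u' d' \<gamma>' g')"
  unfolding clears_def
proof (intro conjI ballI)
  show "lin_poly c \<noteq> 0" by (simp add: lin_poly_def)
  fix v assume v: "v \<in> Vsp n"
  obtain B where B: "\<And>\<beta>. tbound n (lookup v \<beta>) B" using vbound_ex[of n v] by blast
  obtain M1 where M1: "\<And>\<beta>. \<beta> \<in> keys v \<Longrightarrow> - M1 \<le> form n \<gamma> (\<gamma>' + \<beta>)"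
    using finite_rat_bound[of "(\<lambda>\<beta>. form n \<gamma> (\<gamma>' + \<beta>)) ` keys v"] by auto
  obtain M2 where M2: "\<And>\<beta>. \<beta> \<in> keys v \<Longrightarrow> - M2 \<le> form n \<gamma>' \<beta>"
    using finite_rat_bound[of "form n \<gamma>' ` keys v"] by auto
  define N where "N = min (- M1 - of_nat B - of_nat K) (- M2 - of_nat B)"
  show "\<exists>N. \<forall>s s'. s < N \<or> s' < N \<longrightarrow> pab (lin_poly c) (VO n u d \<gamma> g) (VO n u' d' \<gamma>' g') v s s' = 0"
  proof (intro exI[of _ N] allI impI, rule poly_mapping_eqI)
    fix s s' \<delta> assume s: "s < N \<or> s' < N"
    define \<beta> where "\<beta> = \<delta> - \<gamma> - \<gamma>'"
    have \<delta>: "\<delta> = \<beta> + \<gamma>' + \<gamma>" by (simp add: \<beta>_def)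
    show "lookup (pab (lin_poly c) (VO n u d \<gamma> g) (VO n u' d' \<gamma>' g') v s s') \<delta> = lookup 0 \<delta>"
    proof (cases "\<beta> \<in> keys v")
      case False
      then show ?thesis unfolding \<delta> lookup_pab_VO[where d = d and u' = u' and C = C and R = R and K = K and c = c, OF v \<gamma> C R K B] by (simp add: in_keys_iff)
    next
      case True
      have "s < - M1 - of_nat B - of_nat K \<or> s' < - M2 - of_nat B"
        using s unfolding N_def by linarith
      then have "\<lfloor>s - form n \<gamma> (\<gamma>' + \<beta>)\<rfloor> < - int B - int K \<or> \<lfloor>s' - form n \<gamma>' \<beta>\<rfloor> < - int B"
        using M1[OF True] M2[OF True] by (auto simp: floor_less_iff)
      then have "Nc n u d u' d' B (lookup v \<beta>) (\<lfloor>s - form n \<gamma> (\<gamma>' + \<beta>)\<rfloor> - 1 + int k)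
         (\<lfloor>s' - form n \<gamma>' \<beta>\<rfloor> - int k) = 0" if "k \<le> K" for k
        by (intro Nc_low) (use that in linarith)
      then show ?thesis unfolding \<delta> lookup_pab_VO[where d = d and u' = u' and C = C and R = R and K = K and c = c, OF v \<gamma> C R K B] by (simp add: sum.neutral)
    qed
  qed
qed

text \<open>At \<open>z\<^sub>1 = z\<close> all terms of \<open>R\<close> multiply the same normally
  ordered operator, so only the value of \<open>R\<close> at 1 is left.\<close>

lemma lookup_diag_VO:
  assumes v: "v \<in> Vsp n" and \<gamma>: "\<gamma> \<in> Plat n" "\<gamma>' \<in> Plat n"
    and C: "is_exp (\<lambda>r. \<Sum>i=1..n. d (i, r) * u' (i, r)) C"
    and R: "\<And>m. R m = fps_nth C m - (if m = 0 then 0 else c * fps_nth C (m - 1))"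
    and K: "\<forall>m>K. R m = 0"
    and A: "form n \<gamma> (\<gamma>' + \<beta>) = of_int A"
  shows "lookup (Sum_any (\<lambda>m::int. pab (lin_poly c) (VO n u d \<gamma> g) (VO n u' d' \<gamma>' g') v
      (of_int m) (s - of_int m))) (\<beta> + \<gamma>' + \<gamma>)
    = (if s - form n \<gamma>' \<beta> \<in> \<int> then smK (g (\<gamma>' + \<beta>) * g' \<beta> * (\<Sum>k\<le>K. R k))
        (Lc n (u + u') (d + d') (lookup v \<beta>) (\<lfloor>s - form n \<gamma>' \<beta>\<rfloor> - A - 1)) else 0)"
    (is "lookup (Sum_any ?P) _ = _")
proof -
  obtain B where B: "tbound n (lookup v \<beta>) B" using tbound_ex by blast
  obtain N where N: "\<And>s1 s'. s1 < of_int N \<or> s' < of_int N + s \<Longrightarrow>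
      pab (lin_poly c) (VO n u d \<gamma> g) (VO n u' d' \<gamma>' g') v s1 s' = 0"
    by (rule clears_bound[OF clears_VO[where d = d and u' = u' and C = C and R = R and K = K and c = c, OF \<gamma> C R K] v, where ?s0.0 = s]) blast
  \<comment> \<open>The range has to contain the support of the cleared product as well as, for
    every \<open>k \<le> K\<close>, the window required by \<open>Nc_diag\<close>.\<close>
  define lo hi where "lo = min N (A + 1 - int K - int B)" and "hi = max (- N) (\<lfloor>s - form n \<gamma>' \<beta>\<rfloor> + int B)"
  have "{m. ?P m \<noteq> 0} \<subseteq> {lo..hi}"
  proof
    fix m assume "m \<in> {m. ?P m \<noteq> 0}"
    then have "?P m \<noteq> 0" by (rule CollectD)
    then have "\<not> ((of_int m :: rat) < of_int N \<or> s - of_int m < of_int N + s)"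
      by (rule contrapos_nn) (rule N)
    then have "N \<le> m \<and> m \<le> - N" by (auto simp: not_less)
    then show "m \<in> {lo..hi}" unfolding lo_def hi_def by auto
  qed
  then have "Sum_any ?P = (\<Sum>m\<in>{lo..hi}. ?P m)" by (rule Sum_any.expand_superset[rotated]) simp
  then have L: "lookup (Sum_any ?P) (\<beta> + \<gamma>' + \<gamma>)
      = (\<Sum>m\<in>{lo..hi}. lookup (?P m) (\<beta> + \<gamma>' + \<gamma>))"
    by (simp only: lookup_sum)
  show ?thesis
  proof (cases "s - form n \<gamma>' \<beta> \<in> \<int>")
    case False
    have "s - of_int m - form n \<gamma>' \<beta> \<notin> \<int>" for m
      using False Ints_add[of "s - of_int m - form n \<gamma>' \<beta>" "of_int m"] by (auto simp: algebra_simps)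
    then show ?thesis unfolding L lookup_pab_VO[where d = d and u' = u' and C = C and R = R and K = K and c = c, OF v \<gamma> C R K B] using False by simp
  next
    case True
    then obtain Y where Y: "s - form n \<gamma>' \<beta> = of_int Y" by (auto elim: Ints_cases)
    have Ym: "s - of_int m - form n \<gamma>' \<beta> = of_int (Y - m)" and Xm: "of_int m - form n \<gamma> (\<gamma>' + \<beta>) = of_int (m - A)" for m
      using Y A by auto
    let ?p = "lookup v \<beta>"
    have "(\<Sum>m\<in>{lo..hi}. Nc n u d u' d' B ?p (m - A - 1 + int k) (Y - m - int k)) = Lc n (u + u') (d + d') ?p (Y - A - 1)"
      if "k \<le> K" for k
    proof -
      have "(\<Sum>m\<in>{lo..hi}. Nc n u d u' d' B ?p (m - A - 1 + int k) (Y - m - int k))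
        = (\<Sum>x\<in>{lo - A - 1 + int k..hi - A - 1 + int k}. Nc n u d u' d' B ?p x (Y - A - 1 - x))"
        by (rule sum.reindex_bij_witness[of _ "\<lambda>x. x + A + 1 - int k" "\<lambda>m. m - A - 1 + int k"])
           (auto simp: algebra_simps)
      also have "\<dots> = Lc n (u + u') (d + d') ?p (Y - A - 1)"
        by (rule Nc_diag[OF B]) (use that in \<open>auto simp: lo_def hi_def Y\<close>)
      finally show ?thesis .
    qed
    then have "(\<Sum>k\<le>K. smK (R k) (\<Sum>m\<in>{lo..hi}. Nc n u d u' d' B ?p (m - A - 1 + int k) (Y - m - int k)))
       = smK (\<Sum>k\<le>K. R k) (Lc n (u + u') (d + d') ?p (Y - A - 1))"
      by (simp add: smK_sum_left)
    moreover have "(\<Sum>m\<in>{lo..hi}. \<Sum>k\<le>K. smK (R k) (Nc n u d u' d' B ?p (m - A - 1 + int k) (Y - m - int k)))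
      = (\<Sum>k\<le>K. smK (R k) (\<Sum>m\<in>{lo..hi}. Nc n u d u' d' B ?p (m - A - 1 + int k) (Y - m - int k)))"
      unfolding smK_sum by (rule sum.swap)
    ultimately have "(\<Sum>m\<in>{lo..hi}. \<Sum>k\<le>K. smK (R k) (Nc n u d u' d' B ?p (m - A - 1 + int k) (Y - m - int k)))
      = smK (\<Sum>k\<le>K. R k) (Lc n (u + u') (d + d') ?p (Y - A - 1))" by simp
    then show ?thesis
      unfolding L lookup_pab_VO[where d = d and u' = u' and C = C and R = R and K = K and c = c, OF v \<gamma> C R K B] Ym Xm Y
      by (simp only: Ints_of_int floor_of_int if_True simp_thms smK_sum[symmetric] smK_smK)
  qed
qed

text \<open>The argument \<open>s + (form n \<gamma> \<gamma>' + 1)\<close> comes from the power of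
  \<open>z\<close> in the definition of the bullet product; with it the right-hand side is a
  \<open>VO\<close> without any correction.\<close>

lemma nth_prod_VO:
  assumes \<gamma>: "\<gamma> \<in> Plat n" "\<gamma>' \<in> Plat n" and int: "\<forall>\<beta>\<in>Plat n. form n \<gamma> \<beta> \<in> \<int>"
    and C: "is_exp (\<lambda>r. \<Sum>i=1..n. d (i, r) * u' (i, r)) C"
    and R: "\<And>m. R m = fps_nth C m - (if m = 0 then 0 else c * fps_nth C (m - 1))"
    and K: "\<forall>m>K. R m = 0"
  shows "nth_prod n (VO n u d \<gamma> g) (VO n u' d' \<gamma>' g') 0 v (s + (form n \<gamma> \<gamma>' + 1))
    = (if c = 1 then VO n (u + u') (d + d') (\<gamma> + \<gamma>') (\<lambda>\<beta>. (\<Sum>k\<le>K. R k) * g (\<gamma>' + \<beta>) * g' \<beta>) v s else 0)"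
proof -
  have H: "VO n u d \<gamma> g \<in> Hom_Laurent n 1" "VO n u' d' \<gamma>' g' \<in> Hom_Laurent n (Suc n)"
    using \<gamma> int form_denominator by (auto intro!: VO_Hom_Laurent simp del: of_nat_Suc)
  note np = nth_prod_lin_poly[OF clears_VO[where d = d and u' = u' and C = C and R = R and K = K and c = c, OF \<gamma> C R K] H]
  consider "v \<notin> Vsp n" | "c \<noteq> 1" | "v \<in> Vsp n" "c = 1" by blast
  then show ?thesis
  proof cases
    case 1
    then show ?thesis by (simp add: np on_V_def VO_outside)
  next
    case 2
    then show ?thesis by (simp add: np on_V_def)
  next
    case 3
    note v = 3(1)
    show ?thesis
    proof (rule poly_mapping_eqI)
      fix \<delta>
      define \<beta> where "\<beta> = \<delta> - \<gamma> - \<gamma>'"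
      have \<delta>: "\<delta> = \<beta> + \<gamma>' + \<gamma>" and \<beta>: "\<delta> - (\<gamma> + \<gamma>') = \<beta>" by (simp_all add: \<beta>_def algebra_simps)
      have L: "lookup (nth_prod n (VO n u d \<gamma> g) (VO n u' d' \<gamma>' g') 0 v (s + (form n \<gamma> \<gamma>' + 1))) \<delta>
        = lookup (Sum_any (\<lambda>m::int. pab (lin_poly c) (VO n u d \<gamma> g) (VO n u' d' \<gamma>' g') v
            (of_int m) (s + (form n \<gamma> \<gamma>' + 1) - of_int m))) (\<beta> + \<gamma>' + \<gamma>)"
        using 3 by (simp add: np on_V_def \<delta>)
      have Rr: "lookup (VO n (u + u') (d + d') (\<gamma> + \<gamma>') (\<lambda>\<beta>. (\<Sum>k\<le>K. R k) * g (\<gamma>' + \<beta>) * g' \<beta>) v s) \<delta>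
        = VOc n (u + u') (d + d') (\<gamma> + \<gamma>') (\<lambda>\<beta>. (\<Sum>k\<le>K. R k) * g (\<gamma>' + \<beta>) * g' \<beta>) \<beta> (lookup v \<beta>) s"
        by (simp add: lookup_VO[OF v] \<beta>)
      have "lookup (nth_prod n (VO n u d \<gamma> g) (VO n u' d' \<gamma>' g') 0 v (s + (form n \<gamma> \<gamma>' + 1))) \<delta>
         = lookup (VO n (u + u') (d + d') (\<gamma> + \<gamma>') (\<lambda>\<beta>. (\<Sum>k\<le>K. R k) * g (\<gamma>' + \<beta>) * g' \<beta>) v s) \<delta>"
      proof (cases "\<beta> \<in> Plat n")
        case True
        obtain A where A: "form n \<gamma> (\<gamma>' + \<beta>) = of_int A"
          using bspec[OF int Plat_add[OF \<gamma>(2) True]] by (auto elim: Ints_cases)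
        \<comment> \<open>\<open>A\<close> equals
          \<open>form n \<gamma> \<gamma>' + form n \<gamma> \<beta>\<close>, so the displacement
          \<open>A + 1\<close> of \<open>lookup_diag_VO\<close> is cancelled and the exponent of
          weight \<open>\<gamma> + \<gamma>'\<close> remains.\<close>
        have e: "s + (form n \<gamma> \<gamma>' + 1) - form n \<gamma>' \<beta> = s - form n (\<gamma> + \<gamma>') \<beta> + of_int (A + 1)"
          using A by (simp add: form_add_left form_add_right)
        have i: "x + of_int j \<in> \<int> \<longleftrightarrow> x \<in> \<int>" for x :: rat and j
          using Ints_diff[of "x + of_int j" "of_int j"] by auto
        show ?thesis
          unfolding L Rr lookup_diag_VO[where d = d and u' = u' and C = C and R = R and K = K and c = c, OF v \<gamma> C R K A] VOc_def e i
          by (simp add: mult_ac)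
      next
        case False
        then have p0: "lookup v \<beta> = 0" using v by (auto simp: Vsp_iff in_keys_iff)
        obtain B where B: "tbound n (lookup v \<beta>) B" using tbound_ex by blast
        have z: "pab (lin_poly c) (VO n u d \<gamma> g) (VO n u' d' \<gamma>' g') v x y = 0 \<or>
            lookup (pab (lin_poly c) (VO n u d \<gamma> g) (VO n u' d' \<gamma>' g') v x y) (\<beta> + \<gamma>' + \<gamma>) = 0" for x y
          using lookup_pab_VO[where d = d and u' = u' and C = C and R = R and K = K and c = c, OF v \<gamma> C R K B] p0 by simp
        have "lookup (Sum_any f) (\<beta> + \<gamma>' + \<gamma>) = 0"
          if "\<And>m. lookup (f m) (\<beta> + \<gamma>' + \<gamma>) = 0" for f :: "int \<Rightarrow> vsp"
          using that by (cases "finite {m. f m \<noteq> 0}") (simp_all add: lookup_Sum_any)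
        moreover have "lookup (pab (lin_poly c) (VO n u d \<gamma> g) (VO n u' d' \<gamma>' g') v x y) (\<beta> + \<gamma>' + \<gamma>) = 0" for x y
          using z[of x y] by auto
        ultimately show ?thesis unfolding L Rr p0 by simp
      qed
      then show "lookup (nth_prod n (VO n u d \<gamma> g) (VO n u' d' \<gamma>' g') 0 v (s + (form n \<gamma> \<gamma>' + 1))) \<delta>
         = lookup (if c = 1 then VO n (u + u') (d + d') (\<gamma> + \<gamma>') (\<lambda>\<beta>. (\<Sum>k\<le>K. R k) * g (\<gamma>' + \<beta>) * g' \<beta>) v s else 0) \<delta>"
        using 3 by simp
    qed
  qed
qed

text \<open>The condition on \<open>g 0\<close> keeps the image of the vacuum nonzero; an operator
  annihilating the vacuum has every weight, and the \<open>THE\<close> in \<open>wt\<close> would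
  not be determined.\<close>

lemma wt_VO:
  assumes "\<gamma> \<in> Plat n" "g 0 \<noteq> 0"
  shows "wt n (VO n u d \<gamma> g) = \<gamma>"
proof -
  have vac: "vac \<in> Vsp n" unfolding vac_def by (rule Vsp_single) simp_all
  have lv: "lookup vac \<beta> = (if \<beta> = 0 then 1 else 0)" for \<beta>
    by (simp add: vac_def lookup_single lookup_one when_def)
  have s: "VO n u d \<gamma> g vac s = single \<gamma> (VOc n u d \<gamma> g 0 1 s)" for s
    by (rule poly_mapping_eqI) (auto simp: lookup_VO[OF vac] lv lookup_single when_def)
  have "tbound n 1 0" by (auto simp: tbound_def Tc_1)
  then have "Lc n u d 1 0 = 1" by (simp add: Lc_tbound Hz_def Hc_0)
  then have nz: "VOc n u d \<gamma> g 0 1 0 \<noteq> 0" using assms by (simp add: VOc_def smK_eq_0_iff)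
  have "has_wt n (VO n u d \<gamma> g) \<gamma>" using assms s unfolding has_wt_def by blast
  moreover have "\<alpha> = \<gamma>" if hw: "has_wt n (VO n u d \<gamma> g) \<alpha>" for \<alpha>
  proof -
    obtain D where D: "\<forall>s. VO n u d \<gamma> g vac s = single \<alpha> (D s)" using hw unfolding has_wt_def by blast
    have "lookup (single \<gamma> (VOc n u d \<gamma> g 0 1 0)) \<gamma> = lookup (single \<alpha> (D 0)) \<gamma>"
      using s D by metis
    then show ?thesis using nz by (auto simp: lookup_single when_def split: if_splits)
  qed
  ultimately show ?thesis unfolding wt_def by (intro the_equality) auto
qed

lemma wt_part_VO: "wt_part n \<beta> (VO n u d \<gamma> g) = (if \<beta> = \<gamma> then VO n u d \<gamma> g else 0)"
proof (rule oper_eqI[of n])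
  fix v assume "v \<notin> Vsp n"
  then show "wt_part n \<beta> (VO n u d \<gamma> g) v = (if \<beta> = \<gamma> then VO n u d \<gamma> g else 0) v"
    by (simp add: wt_part_def on_V_def VO_outside)
next
  fix v s \<delta> assume v: "v \<in> Vsp n"
  have sg: "single \<alpha> (lookup v \<alpha>) \<in> Vsp n" if "\<alpha> \<in> keys v" for \<alpha>
    using v that by (intro Vsp_single) (auto simp: Vsp_iff)
  have e: "\<beta> + \<alpha> = \<delta> \<longleftrightarrow> \<alpha> = \<delta> - \<beta>" for \<alpha> by (auto simp: algebra_simps)
  have "lookup (wt_part n \<beta> (VO n u d \<gamma> g) v s) \<delta> = (\<Sum>\<alpha>\<in>keys v.
      if \<alpha> = \<delta> - \<beta> then lookup (VO n u d \<gamma> g (single \<alpha> (lookup v \<alpha>)) s) \<delta> else 0)"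
    using v by (auto simp: wt_part_def on_V_def lookup_sum lookup_single when_def e intro!: sum.cong)
  also have "\<dots> = (\<Sum>\<alpha>\<in>keys v.
      if \<alpha> = \<delta> - \<beta> then (if \<beta> = \<gamma> then VOc n u d \<gamma> g \<alpha> (lookup v \<alpha>) s else 0) else 0)"
    by (intro sum.cong refl) (auto simp: lookup_VO[OF sg] lookup_single when_def)
  also have "\<dots> = (if \<beta> = \<gamma> then VOc n u d \<gamma> g (\<delta> - \<gamma>) (lookup v (\<delta> - \<gamma>)) s else 0)"
    by (auto simp: in_keys_iff)
  finally show "lookup (wt_part n \<beta> (VO n u d \<gamma> g) v s) \<delta>
     = lookup ((if \<beta> = \<gamma> then VO n u d \<gamma> g else 0) v s) \<delta>"
    using v by (simp add: lookup_VO)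
qed

text \<open>Passing from \<open>a(z)\<close> to \<open>a(zq^t)\<close> moves the pole from
  \<open>q^t0\<close> to \<open>q^(t0 - t)\<close>, and the zeroth product sees it only at 1. Hence
  exactly the summand \<open>t = t0\<close> counts, with the scalar obtained by evaluating
  \<open>R\<close> at \<open>q^(-t0)\<close>.\<close>

lemma bullet_wt_VO:
  assumes \<gamma>: "\<gamma> \<in> Plat n" "\<gamma>' \<in> Plat n" and int: "\<forall>\<beta>\<in>Plat n. form n \<gamma> \<beta> \<in> \<int>"
    and g: "g 0 \<noteq> 0" and t0: "2 * t0 \<in> \<int>"
    and C: "is_exp (\<lambda>r. \<Sum>i=1..n. d (i, r) * u' (i, r)) C"
    and R: "\<And>m. R m = fps_nth C m - (if m = 0 then 0 else qpow t0 * fps_nth C (m - 1))"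
    and K: "\<forall>m>K. R m = 0"
  shows "bullet_wt n (VO n u d \<gamma> g) \<gamma>' (VO n u' d' \<gamma>' g') =
    VO n (scaled t0 u + u') (scaled (- t0) d + d') (\<gamma> + \<gamma>')
      (\<lambda>\<beta>. (\<Sum>k\<le>K. R k * qpow (- t0) ^ k) * qpow (t0 * form n \<gamma> \<beta>) * g (\<gamma>' + \<beta>) * g' \<beta>)"
proof -
  let ?a = "VO n u d \<gamma> g" and ?b = "VO n u' d' \<gamma>' g'"
  define F where "F t = (\<lambda>v s. smV (qpow (- (t * (form n \<gamma> \<gamma>' + 1))) * qpow t)
      (nth_prod n (shift t ?a) ?b 0 v (s + (form n \<gamma> \<gamma>' + 1))))" for t
  have np: "nth_prod n (shift t ?a) ?b 0 v (s + (form n \<gamma> \<gamma>' + 1))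
     = (if t = t0 then VO n (scaled t u + u') (scaled (- t) d + d') (\<gamma> + \<gamma>')
         (\<lambda>\<beta>. (\<Sum>k\<le>K. qpow (- t) ^ k * R k) * (qpow (t * form n \<gamma> (\<gamma>' + \<beta>)) * g (\<gamma>' + \<beta>)) * g' \<beta>) v s else 0)"
    if t: "2 * t \<in> \<int>" for t v s
  proof -
    have "2 * (t0 - t) \<in> \<int>" using t t0 by (simp add: right_diff_distrib)
    then have c1: "qpow (t0 - t) = 1 \<longleftrightarrow> t = t0" by (auto simp: qpow_eq_1_iff)
    have C': "is_exp (\<lambda>r. \<Sum>i=1..n. scaled (- t) d (i, r) * u' (i, r)) (Abs_fps (\<lambda>m. qpow (- t) ^ m * fps_nth C m))"
      by (rule is_exp_scale[OF C]) (simp add: scaled_def sum_distrib_left mult.assoc)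
    have R': "qpow (- t) ^ m * R m = fps_nth (Abs_fps (\<lambda>m. qpow (- t) ^ m * fps_nth C m)) m
       - (if m = 0 then 0 else qpow (t0 - t) * fps_nth (Abs_fps (\<lambda>m. qpow (- t) ^ m * fps_nth C m)) (m - 1))" for m
      using t t0 by (cases m) (simp_all add: R qpow_diff qpow_minus field_simps)
    have K': "\<forall>m>K. qpow (- t) ^ m * R m = 0" using K by simp
    show ?thesis
      unfolding shift_VO[OF t int]
      using nth_prod_VO[where d = "scaled (- t) d" and u' = u' and u = "scaled t u" and K = K and c = "qpow (t0 - t)"
          and C = "Abs_fps (\<lambda>m. qpow (- t) ^ m * fps_nth C m)" and R = "\<lambda>m. qpow (- t) ^ m * R m",
          OF \<gamma> int C' R' K'] c1 by simp
  qed
  have "bullet_wt n ?a \<gamma>' ?b = Sum_any (\<lambda>t. if 2 * t \<in> \<int> then F t else 0)"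
    unfolding bullet_wt_def wt_VO[of \<gamma> n g, OF \<gamma>(1) g] Let_def F_def ..
  also have "\<dots> = Sum_any (\<lambda>t. if t = t0 then F t0 else 0)"
  proof -
    have "(if 2 * t \<in> \<int> then F t else 0) = (if t = t0 then F t0 else 0)" for t
      using t0 by (cases "2 * t \<in> \<int>") (auto simp: F_def np fun_eq_iff)
    then show ?thesis by simp
  qed
  also have "\<dots> = F t0" by simp
  also have "\<dots> = smO (qpow (- (t0 * (form n \<gamma> \<gamma>' + 1))) * qpow t0)
      (VO n (scaled t0 u + u') (scaled (- t0) d + d') (\<gamma> + \<gamma>')
         (\<lambda>\<beta>. (\<Sum>k\<le>K. qpow (- t0) ^ k * R k) * (qpow (t0 * form n \<gamma> (\<gamma>' + \<beta>)) * g (\<gamma>' + \<beta>)) * g' \<beta>))"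
    using t0 by (simp add: F_def np smO_def fun_eq_iff)
  also have "\<dots> = VO n (scaled t0 u + u') (scaled (- t0) d + d') (\<gamma> + \<gamma>')
      (\<lambda>\<beta>. (\<Sum>k\<le>K. R k * qpow (- t0) ^ k) * qpow (t0 * form n \<gamma> \<beta>) * g (\<gamma>' + \<beta>) * g' \<beta>)"
    unfolding smO_VO
  proof (rule VO_cong)
    fix \<beta> assume "\<beta> \<in> Plat n"
    then obtain x y where x: "form n \<gamma> \<gamma>' = of_int x" and y: "form n \<gamma> \<beta> = of_int y"
      using int \<gamma> by (metis Ints_cases)
    have i: "2 * (t0 * of_int j) \<in> \<int>" for j
      using Ints_mult[OF t0 Ints_of_int[of j]] by (simp add: mult.assoc)
    \<comment> \<open>The powers of \<open>q\<close> in front of the summand cancel the part of the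
      shifted character that comes from \<open>form n \<gamma> \<gamma>'\<close>; the part depending
      on \<open>\<beta>\<close> stays.\<close>
    have q: "qpow (- (t0 * (of_int x + 1))) * qpow t0 * qpow (t0 * of_int (x + y)) = qpow (t0 * of_int y)"
    proof -
      have "qpow (- (t0 * (of_int x + 1))) = inverse (qpow (t0 * (of_int x + 1)))"
        by (rule qpow_minus) (use i[of "x + 1"] in simp)
      also have "qpow (t0 * (of_int x + 1)) = qpow (t0 * of_int x) * qpow t0"
        by (simp add: distrib_left qpow_add i)
      finally have "qpow (- (t0 * (of_int x + 1))) = inverse (qpow (t0 * of_int x) * qpow t0)" .
      moreover have "qpow (t0 * of_int (x + y)) = qpow (t0 * of_int x) * qpow (t0 * of_int y)"
        by (simp add: distrib_left qpow_add i)
      ultimately show ?thesis by (simp add: field_simps)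
    qed
    have xy: "form n \<gamma> (\<gamma>' + \<beta>) = of_int (x + y)" by (simp add: form_add_right x y)
    have "qpow (- (t0 * (form n \<gamma> \<gamma>' + 1))) * qpow t0 *
        ((\<Sum>k\<le>K. qpow (- t0) ^ k * R k) * (qpow (t0 * form n \<gamma> (\<gamma>' + \<beta>)) * g (\<gamma>' + \<beta>)) * g' \<beta>)
      = (\<Sum>k\<le>K. qpow (- t0) ^ k * R k) * (qpow (- (t0 * (of_int x + 1))) * qpow t0 * qpow (t0 * of_int (x + y))) * g (\<gamma>' + \<beta>) * g' \<beta>"
      unfolding xy x by (simp only: mult_ac)
    also have "\<dots> = (\<Sum>k\<le>K. R k * qpow (- t0) ^ k) * qpow (t0 * form n \<gamma> \<beta>) * g (\<gamma>' + \<beta>) * g' \<beta>"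
      unfolding q y by (simp only: mult.commute[of "R _"])
    finally show "qpow (- (t0 * (form n \<gamma> \<gamma>' + 1))) * qpow t0 *
        ((\<Sum>k\<le>K. qpow (- t0) ^ k * R k) * (qpow (t0 * form n \<gamma> (\<gamma>' + \<beta>)) * g (\<gamma>' + \<beta>)) * g' \<beta>)
      = (\<Sum>k\<le>K. R k * qpow (- t0) ^ k) * qpow (t0 * form n \<gamma> \<beta>) * g (\<gamma>' + \<beta>) * g' \<beta>" .
  qed simp_all
  finally show ?thesis .
qed

text \<open>Zero is a vertex operator with vanishing character, so the general product formula
  applies. This disposes of all but one weight component in \<open>bullet\<close>.\<close>

lemma bullet_wt_zero:
  assumes "\<gamma> \<in> Plat n" "\<beta> \<in> Plat n" "\<forall>\<beta>\<in>Plat n. form n \<gamma> \<beta> \<in> \<int>" "g 0 \<noteq> 0"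
  shows "bullet_wt n (VO n u d \<gamma> g) \<beta> 0 = 0"
proof -
  have "is_exp (\<lambda>r. \<Sum>i=1..n. d (i, r) * 0) 1" by (rule is_exp_0) simp
  then have "bullet_wt n (VO n u d \<gamma> g) \<beta> (VO n (\<lambda>_. 0) (\<lambda>_. 0) \<beta> (\<lambda>_. 0)) = 0"
    using assms
    by (subst bullet_wt_VO[where K = 1 and ?t0.0 = 0 and C = 1
          and R = "\<lambda>m. fps_nth 1 m - (if m = 0 then 0 else fps_nth 1 (m - 1))"]) (auto simp: VO_0)
  then show ?thesis by (simp add: VO_0)
qed

lemma bullet_VO:
  assumes "\<gamma> \<in> Plat n" "\<gamma>' \<in> Plat n" and int: "\<forall>\<beta>\<in>Plat n. form n \<gamma> \<beta> \<in> \<int>"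
    and "g 0 \<noteq> 0" and "2 * t0 \<in> \<int>"
    and "is_exp (\<lambda>r. \<Sum>i=1..n. d (i, r) * u' (i, r)) C"
    and "\<And>m. R m = fps_nth C m - (if m = 0 then 0 else qpow t0 * fps_nth C (m - 1))"
    and "\<forall>m>K. R m = 0"
  shows "bullet n (VO n u d \<gamma> g) (VO n u' d' \<gamma>' g') =
    VO n (scaled t0 u + u') (scaled (- t0) d + d') (\<gamma> + \<gamma>')
      (\<lambda>\<beta>. (\<Sum>k\<le>K. R k * qpow (- t0) ^ k) * qpow (t0 * form n \<gamma> \<beta>) * g (\<gamma>' + \<beta>) * g' \<beta>)"
proof -
  let ?W = "bullet_wt n (VO n u d \<gamma> g) \<gamma>' (VO n u' d' \<gamma>' g')"
  have "(if \<beta> \<in> Plat n then bullet_wt n (VO n u d \<gamma> g) \<beta> (wt_part n \<beta> (VO n u' d' \<gamma>' g')) else 0)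
     = (if \<beta> = \<gamma>' then ?W else 0)" for \<beta>
    using assms(1-4) bullet_wt_zero[of \<gamma> n \<beta> g u d] by (auto simp: wt_part_VO)
  then have "bullet n (VO n u d \<gamma> g) (VO n u' d' \<gamma>' g') = ?W"
    unfolding bullet_def by simp
  then show ?thesis using bullet_wt_VO[where g = g and ?t0.0 = t0 and d = d and u' = u' and C = C and R = R and K = K, OF assms] by simp
qed

lemma bullet_zero:
  assumes "\<gamma> \<in> Plat n" and int: "\<forall>\<beta>\<in>Plat n. form n \<gamma> \<beta> \<in> \<int>" and "g 0 \<noteq> 0"
  shows "bullet n (VO n u d \<gamma> g) 0 = 0"
proof -
  have "wt_part n \<beta> 0 = 0" for \<beta>
    using wt_part_VO[of n \<beta> "\<lambda>_. 0" "\<lambda>_. 0" 0 "\<lambda>_. 0"] by (auto simp: VO_0)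
  then have "(if \<beta> \<in> Plat n then bullet_wt n (VO n u d \<gamma> g) \<beta> (wt_part n \<beta> 0) else 0) = 0" for \<beta>
    using assms bullet_wt_zero[of \<gamma> n \<beta> g u d] by auto
  then show ?thesis unfolding bullet_def by simp
qed

section \<open>The generators and \<open>Y_op\<close> as vertex operators\<close>

lemma ser_exp_cong:
  assumes "\<And>r p. r > 0 \<Longrightarrow> A r p = A' r p"
  shows "ser_exp A m p = ser_exp A' m p"
proof -
  have "ser_pow A k m p = ser_pow A' k m p" for k
  proof (induction k arbitrary: m)
    case (Suc k)
    then show ?case using assms by (auto intro!: sum.cong)
  qed simp
  then show ?thesis by (simp add: ser_exp_def)
qed

lemma lookup_exp_up:
  assumes "\<And>m. ser_exp A m 0 = 0"
  shows "lookup (exp_up A v s) \<delta> = (if s \<in> \<nat> then ser_exp A (nat \<lfloor>s\<rfloor>) (lookup v \<delta>) else 0)"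
  using assms by (auto simp: exp_up_def Poly_Mapping.map.rep_eq when_def)

lemma lookup_exp_up_Hc:
  assumes "\<And>r p. r > 0 \<Longrightarrow> A r p = Up n u r * p"
  shows "lookup (exp_up A v s) \<delta> = (if s \<in> \<nat> then Hc n u (nat \<lfloor>s\<rfloor>) * lookup v \<delta> else 0)"
proof -
  have "ser_exp A m p = Hc n u m * p" for m p
    using ser_exp_cong[of A "\<lambda>r p. Up n u r * p"] assms by (simp add: ser_exp_mult)
  then show ?thesis by (subst lookup_exp_up) auto
qed

lemma lookup_exp_down_Tc:
  assumes "\<And>r p. r > 0 \<Longrightarrow> A r p = Dn n d r p"
  shows "lookup (exp_down A v s) \<delta> = (if - s \<in> \<nat> then Tc n d (nat \<lfloor>- s\<rfloor>) (lookup v \<delta>) else 0)"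
proof -
  have "ser_exp A m p = Tc n d m p" for m p
    using ser_exp_cong[of A "Dn n d"] assms by (simp add: Tc_def)
  then show ?thesis unfolding exp_down_def by (subst lookup_exp_up) auto
qed

lemma of_int_in_Nats: "(of_int m :: rat) \<in> \<nat> \<longleftrightarrow> m \<ge> 0"
  by (auto simp: Nats_altdef2)

text \<open>Both compositions are \<open>Sum_any\<close> expressions and need finite supports: a
  vector has finitely many weights, and on each of them only shifts of order at most
  \<open>B\<close> act nontrivially.\<close>

lemma ocomp_exp_VO:
  assumes z: "\<And>v s \<delta>. v \<in> Vsp n \<Longrightarrow> lookup (z v s) \<delta>
      = (if form n \<gamma> (\<delta> - \<gamma>) = s then smK (g (\<delta> - \<gamma>)) (lookup v (\<delta> - \<gamma>)) else 0)"
    and A: "\<And>r p. r > 0 \<Longrightarrow> A r p = Up n u r * p" and D: "\<And>r p. r > 0 \<Longrightarrow> D r p = Dn n d r p"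
  shows "on_V n (ocomp (exp_up A) (ocomp (exp_down D) z)) = VO n u d \<gamma> g"
proof (rule oper_eqI[of n])
  fix v assume "v \<notin> Vsp n"
  then show "on_V n (ocomp (exp_up A) (ocomp (exp_down D) z)) v = VO n u d \<gamma> g v"
    by (simp add: on_V_def VO_outside)
next
  fix v s \<delta> assume v: "v \<in> Vsp n"
  obtain B where B: "\<And>\<beta>. tbound n (lookup v \<beta>) B" using vbound_ex[of n v] by blast
  define w where "w = ocomp (exp_down D) z v"
  have lw: "lookup (w s) \<delta> = (if form n \<gamma> (\<delta> - \<gamma>) - s \<in> \<nat> then smK (g (\<delta> - \<gamma>))
       (Tc n d (nat \<lfloor>form n \<gamma> (\<delta> - \<gamma>) - s\<rfloor>) (lookup v (\<delta> - \<gamma>))) else 0)" for s \<delta>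
  proof -
    have l: "lookup (exp_down D (z v t) (s - t)) \<delta> = (if t = form n \<gamma> (\<delta> - \<gamma>) then
        (if form n \<gamma> (\<delta> - \<gamma>) - s \<in> \<nat> then smK (g (\<delta> - \<gamma>))
       (Tc n d (nat \<lfloor>form n \<gamma> (\<delta> - \<gamma>) - s\<rfloor>) (lookup v (\<delta> - \<gamma>))) else 0) else 0)" for t \<delta>
      using v by (auto simp: lookup_exp_down_Tc[of D n d, OF D] z Tc_smK)
    have "{t. exp_down D (z v t) (s - t) \<noteq> 0} \<subseteq> form n \<gamma> ` keys v"
    proof
      fix t assume "t \<in> {t. exp_down D (z v t) (s - t) \<noteq> 0}"
      then obtain \<delta> where "lookup (exp_down D (z v t) (s - t)) \<delta> \<noteq> 0"
        by (metis (mono_tags) lookup_zero poly_mapping_eqI mem_Collect_eq)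
      then have "t = form n \<gamma> (\<delta> - \<gamma>)" "lookup v (\<delta> - \<gamma>) \<noteq> 0"
        unfolding l by (auto split: if_splits)
      then show "t \<in> form n \<gamma> ` keys v" by (auto simp: in_keys_iff)
    qed
    then have "finite {t. exp_down D (z v t) (s - t) \<noteq> 0}" by (rule finite_subset) simp
    then show ?thesis unfolding w_def ocomp_def by (simp add: lookup_Sum_any l)
  qed
  define \<beta> where "\<beta> = \<delta> - \<gamma>"
  define p where "p = lookup v \<beta>"
  define F where "F t = lookup (exp_up A (w t) (s - t)) \<delta>" for t
  have l: "lookup (exp_up A (w t) (s - t)) \<delta> = (if s - t \<in> \<nat> then Hc n u (nat \<lfloor>s - t\<rfloor>) * lookup (w t) \<delta> else 0)" for t \<delta>
    by (rule lookup_exp_up_Hc[of A n u, OF A])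
  have wt: "t \<in> (\<lambda>l. form n \<gamma> (\<delta> - \<gamma>) - of_nat l) ` {..B} \<and> \<delta> - \<gamma> \<in> keys v"
    if nz: "lookup (w t) \<delta> \<noteq> 0" for t \<delta>
  proof -
    obtain l where l: "form n \<gamma> (\<delta> - \<gamma>) - t = of_nat l" and
      T: "Tc n d l (lookup v (\<delta> - \<gamma>)) \<noteq> 0"
      using nz unfolding lw by (auto simp: Nats_def smK_eq_0_iff split: if_splits)
    have "l \<le> B" using T tbound_Tc[OF B] by (meson not_le)
    moreover have "t = form n \<gamma> (\<delta> - \<gamma>) - of_nat l" using l by simp
    moreover have "\<delta> - \<gamma> \<in> keys v" using T by (auto simp: in_keys_iff)
    ultimately show ?thesis by blast
  qed
  have "{t. exp_up A (w t) (s - t) \<noteq> 0} \<subseteq> (\<Union>\<beta>\<in>keys v. (\<lambda>l. form n \<gamma> \<beta> - of_nat l) ` {..B})"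
  proof
    fix t assume "t \<in> {t. exp_up A (w t) (s - t) \<noteq> 0}"
    then obtain \<delta> where "lookup (exp_up A (w t) (s - t)) \<delta> \<noteq> 0"
      by (metis (mono_tags) lookup_zero poly_mapping_eqI mem_Collect_eq)
    then have "lookup (w t) \<delta> \<noteq> 0" unfolding l by (auto split: if_splits)
    then show "t \<in> (\<Union>\<beta>\<in>keys v. (\<lambda>l. form n \<gamma> \<beta> - of_nat l) ` {..B})" using wt by blast
  qed
  then have fin: "finite {t. exp_up A (w t) (s - t) \<noteq> 0}" by (rule finite_subset) simp
  have "lookup (on_V n (ocomp (exp_up A) (ocomp (exp_down D) z)) v s) \<delta> = Sum_any F"
    using v unfolding on_V_def ocomp_def[of "exp_up A"] w_def[symmetric] F_def by (simp add: lookup_Sum_any fin)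
  also have "\<dots> = (\<Sum>t\<in>(\<lambda>l. form n \<gamma> \<beta> - of_nat l) ` {..B}. F t)"
  proof (rule Sum_any.expand_superset)
    show "{t. F t \<noteq> 0} \<subseteq> (\<lambda>l. form n \<gamma> \<beta> - of_nat l) ` {..B}"
    proof
      fix t assume "t \<in> {t. F t \<noteq> 0}"
      then have "lookup (w t) \<delta> \<noteq> 0" by (auto simp: F_def l split: if_splits)
      then show "t \<in> (\<lambda>l. form n \<gamma> \<beta> - of_nat l) ` {..B}" using wt unfolding \<beta>_def by blast
    qed
  qed simp
  also have "\<dots> = (\<Sum>l\<le>B. F (form n \<gamma> \<beta> - of_nat l))"
    by (rule sum.reindex_cong[where l = "\<lambda>l. form n \<gamma> \<beta> - of_nat l"]) (auto simp: inj_on_def)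
  also have "\<dots> = VOc n u d \<gamma> g \<beta> p s"
  proof (cases "s - form n \<gamma> \<beta> \<in> \<int>")
    case True
    then obtain m where m: "s - form n \<gamma> \<beta> = of_int m" by (auto elim: Ints_cases)
    have "F (form n \<gamma> \<beta> - of_nat l) = smK (g \<beta>) (Hz n u (m + int l) * Tc n d l p)" for l
    proof -
      have "s - (form n \<gamma> \<beta> - of_nat l) = of_int (m + int l)" using m by simp
      then show ?thesis
        by (simp add: F_def lookup_exp_up_Hc[of A n u, OF A] lw \<beta>_def[symmetric] p_def[symmetric] of_int_in_Nats Hz_def mult_smK del: of_int_add)
    qed
    then show ?thesis by (simp add: VOc_def m Lc_tbound[OF B] p_def smK_sum)
  next
    case False
    have "F (form n \<gamma> \<beta> - of_nat l) = 0" for l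
    proof -
      have "s - (form n \<gamma> \<beta> - of_nat l) \<notin> \<nat>"
      proof
        assume "s - (form n \<gamma> \<beta> - of_nat l) \<in> \<nat>"
        then have "s - (form n \<gamma> \<beta> - of_nat l) \<in> \<int>" using Nats_subset_Ints by blast
        then have "s - (form n \<gamma> \<beta> - of_nat l) - of_nat l \<in> \<int>" by (rule Ints_diff) simp
        then show False using False by simp
      qed
      then show ?thesis by (simp add: F_def l)
    qed
    then show ?thesis using False by (simp add: VOc_def)
  qed
  also have "\<dots> = lookup (VO n u d \<gamma> g v s) \<delta>"
    by (simp add: lookup_VO v \<beta>_def p_def)
  finally show "lookup (on_V n (ocomp (exp_up A) (ocomp (exp_down D) z)) v s) \<delta>
     = lookup (VO n u d \<gamma> g v s) \<delta>" .
qed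

lemma lookup_e_op: "lookup (e_op n \<gamma> w) \<delta> = smK (eps n \<gamma> (\<delta> - \<gamma>)) (lookup w (\<delta> - \<gamma>))"
proof -
  have "\<gamma> + \<beta> = \<delta> \<longleftrightarrow> \<beta> = \<delta> - \<gamma>" for \<beta> by (auto simp: algebra_simps)
  then show ?thesis by (simp add: e_op_def lookup_sum lookup_single when_def in_keys_iff)
qed

lemma lookup_zdel: "lookup (zdel n \<gamma> v s) \<beta> = (if form n \<gamma> \<beta> = s then lookup v \<beta> else 0)"
  by (simp add: zdel_def lookup_mapp when_def in_keys_iff)

definition ysgn :: "nat \<Rightarrow> nat \<Rightarrow> weight \<Rightarrow> scal" where
  "ysgn n i \<beta> = cst (exp (pi * \<i> * of_rat (of_nat (if i = n then 0 else i) * form n (fund n) \<beta>)))"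

lemma lookup_signdel: "lookup (signdel n (if i = n then 0 else i) (fund n) v) \<beta> = smK (ysgn n i \<beta>) (lookup v \<beta>)"
  by (simp add: signdel_def lookup_mapp when_def in_keys_iff ysgn_def)

lemma lookup_K_op: "lookup (K_op n \<sigma> j v) \<beta>
    = smK (qpow (of_int \<sigma> * form n (simple_root n j) \<beta>)) (lookup v \<beta>)"
  by (simp add: K_op_def lookup_mapp when_def in_keys_iff)

text \<open>The commutator of \<open>a\<^sub>j(r)\<close> with \<open>a\<^sub>k(-r)\<close> is
  \<open>heis_coeff j (k, r)\<close>.\<close>

definition heis_coeff :: "nat \<Rightarrow> nat \<times> nat \<Rightarrow> scal" where
  "heis_coeff j x = qint (cartan j (fst x) * int (snd x)) * qint (int (snd x)) / of_nat (snd x)"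

definition xu :: "int \<Rightarrow> nat \<Rightarrow> nat \<times> nat \<Rightarrow> scal" where
  "xu \<sigma> j x = (if fst x = j then of_int \<sigma> * qpow (- of_int \<sigma> * of_nat (snd x) / 2) / qint (int (snd x)) else 0)"

definition xd :: "int \<Rightarrow> nat \<Rightarrow> nat \<times> nat \<Rightarrow> scal" where
  "xd \<sigma> j x = - of_int \<sigma> * qpow (- of_int \<sigma> * of_nat (snd x) / 2) / qint (int (snd x)) * heis_coeff j x"

definition psid :: "nat \<Rightarrow> nat \<times> nat \<Rightarrow> scal" where
  "psid j x = (qpow 1 - qpow (- 1)) * heis_coeff j x"

definition phiu :: "nat \<Rightarrow> nat \<times> nat \<Rightarrow> scal" where
  "phiu j x = (if fst x = j then - (qpow 1 - qpow (- 1)) else 0)"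

definition yu :: "nat \<Rightarrow> nat \<Rightarrow> nat \<times> nat \<Rightarrow> scal" where
  "yu n i x = qpow (of_nat (snd x) / 2) / qint (int (snd x)) * mstar n i (fst x) (- int (snd x))"

definition yd :: "nat \<Rightarrow> nat \<Rightarrow> nat \<times> nat \<Rightarrow> scal" where
  "yd n i x = - qpow (of_nat (snd x) / 2) / qint (int (snd x)) *
     (\<Sum>j=1..n. mstar n i j (int (snd x)) * heis_coeff j x)"

lemma heis_pos: "r > 0 \<Longrightarrow> heis n j (int r) p = Dn n (heis_coeff j) r p"
  by (simp add: heis_def Dn_def heis_coeff_def)

lemma heis_neg: "r > 0 \<Longrightarrow> heis n j (- int r) p = var (j, r) * p"
  by (simp add: heis_def)

lemma smK_Dn: "smK c (Dn n d r p) = Dn n (\<lambda>x. c * d x) r p"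
  by (simp add: Dn_def smK_sum smK_smK)

lemma Dn_cong: "(\<And>i. i \<in> {1..n} \<Longrightarrow> d (i, r) = d' (i, r)) \<Longrightarrow> Dn n d r p = Dn n d' r p"
  by (simp add: Dn_def)

lemma Up_single: "j \<in> {1..n} \<Longrightarrow> Up n (\<lambda>x. if fst x = j then f x else 0) r = smK (f (j, r)) (var (j, r))"
proof -
  assume "j \<in> {1..n}"
  moreover have "Up n (\<lambda>x. if fst x = j then f x else 0) r = (\<Sum>i=1..n. if i = j then smK (f (j, r)) (var (j, r)) else 0)"
    unfolding Up_def by (intro sum.cong) (auto simp: smK_0_left)
  ultimately show ?thesis by simp
qed

lemma x_op_VO:
  assumes j: "j \<in> {1..n}"
  shows "x_op n 1 j = VO n (xu 1 j) (xd 1 j) (simple_root n j) (eps n (simple_root n j))"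
    and "x_op n (- 1) j = VO n (xu (- 1) j) (xd (- 1) j) (- simple_root n j) (eps n (- simple_root n j))"
proof -
  have up: "smK (of_int \<sigma> * qpow (- of_int \<sigma> * of_nat r / 2) / qint (int r)) (heis n j (- int r) p) = Up n (xu \<sigma> j) r * p"
    if "r > 0" for r p \<sigma>
    unfolding xu_def[abs_def] Up_single[OF j] using that by (simp add: heis_neg smK_mult)
  have down: "smK (- of_int \<sigma> * qpow (- of_int \<sigma> * of_nat r / 2) / qint (int r)) (heis n j (int r) p) = Dn n (xd \<sigma> j) r p"
    if "r > 0" for r p \<sigma>
    using that by (auto simp: heis_pos smK_Dn xd_def intro: Dn_cong)
  have "on_V n (ocomp (exp_up (\<lambda>r p. smK (of_int \<sigma> * qpow (- of_int \<sigma> * of_nat r / 2) / qint (int r)) (heis n j (- int r) p)))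
     (ocomp (exp_down (\<lambda>r p. smK (- of_int \<sigma> * qpow (- of_int \<sigma> * of_nat r / 2) / qint (int r)) (heis n j (int r) p)))
       (\<lambda>v s. e_op n \<gamma> (zdel n \<gamma> v s)))) = VO n (xu \<sigma> j) (xd \<sigma> j) \<gamma> (eps n \<gamma>)" for \<sigma> \<gamma>
    by (rule ocomp_exp_VO) (simp_all only: up down lookup_e_op lookup_zdel if_distrib[of "smK _"] smK_zero)
  from this[of 1 "simple_root n j"] this[of "- 1" "- simple_root n j"]
  show "x_op n 1 j = VO n (xu 1 j) (xd 1 j) (simple_root n j) (eps n (simple_root n j))"
    and "x_op n (- 1) j = VO n (xu (- 1) j) (xd (- 1) j) (- simple_root n j) (eps n (- simple_root n j))"
    by (simp_all add: x_op_def Let_def)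
qed

lemma Y_op_VO: "Y_op n i = VO n (yu n i) (yd n i) (fund i) (\<lambda>\<beta>. eps n (fund i) \<beta> * ysgn n i \<beta>)"
  unfolding Y_op_def
proof (rule ocomp_exp_VO)
  fix v s \<delta>
  show "lookup (e_op n (fund i) (signdel n (if i = n then 0 else i) (fund n) (zdel n (fund i) v s))) \<delta>
    = (if form n (fund i) (\<delta> - fund i) = s then smK (eps n (fund i) (\<delta> - fund i) * ysgn n i (\<delta> - fund i))
       (lookup v (\<delta> - fund i)) else 0)"
    unfolding lookup_e_op lookup_signdel lookup_zdel by (simp add: smK_smK)
next
  fix r p assume r: "(r::nat) > 0"
  show "smK (qpow (of_nat r / 2) / qint (int r)) (heis_star n i (- int r) p) = Up n (yu n i) r * p"
    using r by (simp add: heis_star_def heis_neg Up_def yu_def smK_sum smK_smK smK_mult sum_distrib_right)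
  have "heis_star n i (int r) p = Dn n (\<lambda>x. \<Sum>j=1..n. mstar n i j (int r) * heis_coeff j x) r p"
    using r unfolding heis_star_def Dn_def smK_sum_left
    by (subst sum.swap) (simp add: heis_pos Dn_def smK_sum smK_smK)
  then show "smK (- qpow (of_nat r / 2) / qint (int r)) (heis_star n i (int r) p) = Dn n (yd n i) r p"
    by (auto simp: smK_Dn yd_def intro: Dn_cong)
qed

lemma Lc_u0:
  assumes "tbound n p B"
  shows "Lc n (\<lambda>_. 0) d p m = (if m \<le> 0 then Tc n d (nat (- m)) p else 0)"
proof -
  have "Lc n (\<lambda>_. 0) d p m = (\<Sum>l\<le>B. if int l = - m then Tc n d l p else 0)"
    unfolding Lc_tbound[OF assms] by (intro sum.cong refl) (auto simp: Hz_def Hc_u0)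
  also have "\<dots> = (if m \<le> 0 then Tc n d (nat (- m)) p else 0)"
  proof (cases "m \<le> 0")
    case True
    have "(\<Sum>l\<le>B. if int l = - m then Tc n d l p else 0) = (\<Sum>l\<le>B. if l = nat (- m) then Tc n d l p else 0)"
      using True by (intro sum.cong refl) auto
    also have "\<dots> = Tc n d (nat (- m)) p" using tbound_Tc[OF assms, of "nat (- m)" d] by auto
    finally show ?thesis using True by simp
  next
    case False
    then have "int l \<noteq> - m" for l by linarith
    then show ?thesis using False by simp
  qed
  finally show ?thesis .
qed

lemma Tc_d0: "Tc n (\<lambda>_. 0) m p = (if m = 0 then p else 0)"
  using Tc_scale[of n "\<lambda>_. 0" 0 "\<lambda>_. 0" m p] by (cases m) (simp_all add: smK_0_left)

lemma Lc_d0: "Lc n u (\<lambda>_. 0) p m = Hz n u m * p"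
  using Lc_eq[of 0 n "\<lambda>_. 0" p u m] by (simp add: Tc_d0)

lemma VO_vacuum:
  assumes v: "v \<in> Vsp n"
  shows "lookup (VO n (\<lambda>_. 0) d 0 g v s) \<beta>
    = (if - s \<in> \<nat> then smK (g \<beta>) (Tc n d (nat \<lfloor>- s\<rfloor>) (lookup v \<beta>)) else 0)"
proof -
  obtain B where B: "tbound n (lookup v \<beta>) B" using tbound_ex by blast
  show ?thesis
  proof (cases "s \<in> \<int>")
    case True
    then obtain m where m: "s = of_int m" by (auto elim: Ints_cases)
    have "- s = of_int (- m)" using m by simp
    then show ?thesis using of_int_in_Nats[of "- m"] by (auto simp: lookup_VO[OF v] VOc_def Lc_u0[OF B] m)
  next
    case False
    then have "- s \<notin> \<nat>" using Nats_subset_Ints Ints_minus[of "- s"] by auto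
    then show ?thesis using False by (simp add: lookup_VO[OF v] VOc_def)
  qed
qed

lemma psi_op_VO: "psi_op n j = VO n (\<lambda>_. 0) (psid j) 0 (\<lambda>\<beta>. qpow (form n (simple_root n j) \<beta>))"
proof (rule oper_eqI[of n])
  fix v assume "v \<notin> Vsp n"
  then show "psi_op n j v = VO n (\<lambda>_. 0) (psid j) 0 (\<lambda>\<beta>. qpow (form n (simple_root n j) \<beta>)) v"
    by (simp add: psi_op_def on_V_def VO_outside)
next
  fix v s \<beta> assume v: "v \<in> Vsp n"
  have "smK (qpow 1 - qpow (- 1)) (heis n j (int r) p) = Dn n (psid j) r p" if "r > 0" for r p
    using that by (auto simp: heis_pos smK_Dn psid_def intro: Dn_cong)
  then have "lookup (exp_down (\<lambda>r p. smK (qpow 1 - qpow (- 1)) (heis n j (int r) p)) v s) \<beta>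
    = (if - s \<in> \<nat> then Tc n (psid j) (nat \<lfloor>- s\<rfloor>) (lookup v \<beta>) else 0)"
    by (rule lookup_exp_down_Tc)
  then show "lookup (psi_op n j v s) \<beta>
     = lookup (VO n (\<lambda>_. 0) (psid j) 0 (\<lambda>\<beta>. qpow (form n (simple_root n j) \<beta>)) v s) \<beta>"
    using v by (simp add: psi_op_def on_V_def lookup_K_op VO_vacuum)
qed

lemma phi_op_VO:
  assumes j: "j \<in> {1..n}"
  shows "phi_op n j = VO n (phiu j) (\<lambda>_. 0) 0 (\<lambda>\<beta>. qpow (- form n (simple_root n j) \<beta>))"
proof (rule oper_eqI[of n])
  fix v assume "v \<notin> Vsp n"
  then show "phi_op n j v = VO n (phiu j) (\<lambda>_. 0) 0 (\<lambda>\<beta>. qpow (- form n (simple_root n j) \<beta>)) v"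
    by (simp add: phi_op_def on_V_def VO_outside)
next
  fix v s \<beta> assume v: "v \<in> Vsp n"
  have "smK (- (qpow 1 - qpow (- 1))) (heis n j (- int r) p) = Up n (phiu j) r * p" if "r > 0" for r p
    unfolding phiu_def[abs_def] Up_single[OF j] using that by (simp add: heis_neg smK_mult)
  then have "lookup (exp_up (\<lambda>r p. smK (- (qpow 1 - qpow (- 1))) (heis n j (- int r) p)) v s) \<beta>
    = (if s \<in> \<nat> then Hc n (phiu j) (nat \<lfloor>s\<rfloor>) * (lookup v \<beta>) else 0)"
    by (rule lookup_exp_up_Hc)
  moreover have "lookup (VO n (phiu j) (\<lambda>_. 0) 0 (\<lambda>\<beta>. qpow (- form n (simple_root n j) \<beta>)) v s) \<beta>
    = smK (qpow (- form n (simple_root n j) \<beta>)) (if s \<in> \<nat> then Hc n (phiu j) (nat \<lfloor>s\<rfloor>) * (lookup v \<beta>) else 0)"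
  proof (cases "s \<in> \<int>")
    case True
    then obtain m where m: "s = of_int m" by (auto elim: Ints_cases)
    then show ?thesis by (simp add: lookup_VO[OF v] VOc_def Lc_d0 of_int_in_Nats Hz_def)
  next
    case False
    then have "s \<notin> \<nat>" using Nats_subset_Ints by auto
    then show ?thesis using False by (simp add: lookup_VO[OF v] VOc_def)
  qed
  ultimately show "lookup (phi_op n j v s) \<beta>
     = lookup (VO n (phiu j) (\<lambda>_. 0) 0 (\<lambda>\<beta>. qpow (- form n (simple_root n j) \<beta>)) v s) \<beta>"
    using v by (simp add: phi_op_def on_V_def lookup_K_op)
qed

section \<open>Composition with an operator that has no creating part\<close>

lemma Lc_add_d:
  assumes B: "tbound n p B"
  shows "Lc n u (d + d') p m = (\<Sum>l'\<le>B. Lc n u d (Tc n d' l' p) (m + int l'))"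
proof -
  have T0: "Tc n d l (Tc n d' l' p) = 0" if "l > B \<or> l' > B" for l l'
    using B that unfolding tbound_def by blast
  have T2: "Tc n (d + d') k p = 0" if "k > 2 * B" for k
    unfolding Tc_add by (intro sum.neutral ballI T0) (use that in auto)
  have "(\<Sum>l'\<le>B. Lc n u d (Tc n d' l' p) (m + int l')) = (\<Sum>l'\<le>B. \<Sum>l\<le>B. Hz n u (m + int l' + int l) * Tc n d l (Tc n d' l' p))"
    by (intro sum.cong refl Lc_eq T0) simp
  also have "\<dots> = (\<Sum>l\<le>B. \<Sum>l'\<le>B. Hz n u (m + int l' + int l) * Tc n d l (Tc n d' l' p))"
    by (rule sum.swap)
  also have "\<dots> = (\<Sum>k\<le>2 * B. \<Sum>l\<le>k. Hz n u (m + int (k - l) + int l) * Tc n d l (Tc n d' (k - l) p))"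
    by (rule sum_conv_square) (simp add: T0)
  also have "\<dots> = (\<Sum>k\<le>2 * B. Hz n u (m + int k) * Tc n (d + d') k p)"
    by (intro sum.cong refl) (simp add: Tc_add sum_distrib_left of_nat_diff)
  also have "\<dots> = Lc n u (d + d') p m" by (rule Lc_eq[symmetric]) (rule T2)
  finally show ?thesis ..
qed

text \<open>The right factor creates nothing that the left one could contract with, so the shifts
  add and the characters multiply.\<close>

lemma ocomp_VO_vacuum:
  assumes "\<gamma> \<in> Plat n"
  shows "ocomp (VO n u d \<gamma> g) (VO n (\<lambda>_. 0) d' 0 g') = VO n u (d + d') \<gamma> (\<lambda>\<beta>. g \<beta> * g' \<beta>)"
proof (rule oper_eqI[of n])
  fix v assume "v \<notin> Vsp n"
  moreover have "VO n u d \<gamma> g 0 s = 0" for s by (simp add: VO_def on_V_def)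
  ultimately show "ocomp (VO n u d \<gamma> g) (VO n (\<lambda>_. 0) d' 0 g') v = VO n u (d + d') \<gamma> (\<lambda>\<beta>. g \<beta> * g' \<beta>) v"
    by (auto simp: ocomp_def VO_outside)
next
  fix v s \<delta> assume v: "v \<in> Vsp n"
  define w where "w = VO n (\<lambda>_. 0) d' 0 g' v"
  obtain B where B: "\<And>\<beta>. tbound n (lookup v \<beta>) B" using vbound_ex[of n v] by blast
  define \<beta> where "\<beta> = \<delta> - \<gamma>"
  define p where "p = lookup v \<beta>"
  have lw: "lookup (w t) \<beta> = (if - t \<in> \<nat> then smK (g' \<beta>) (Tc n d' (nat \<lfloor>- t\<rfloor>) (lookup v \<beta>)) else 0)" for t \<beta>
    unfolding w_def by (rule VO_vacuum[OF v])
  have wt: "t \<in> (\<lambda>l. - of_nat l) ` {..B}" if nz: "lookup (w t) \<beta> \<noteq> 0" for t \<beta>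
  proof -
    obtain l where l: "- t = of_nat l" and T: "Tc n d' l (lookup v \<beta>) \<noteq> 0"
      using nz unfolding lw by (auto simp: Nats_def smK_eq_0_iff split: if_splits)
    have "l \<le> B" using T tbound_Tc[OF B] by (meson not_le)
    moreover have "t = - of_nat l" using l by simp
    ultimately show ?thesis by blast
  qed
  have wV: "w t \<in> Vsp n" for t unfolding w_def by (rule VO_Vsp[OF v]) simp
  have "{t. VO n u d \<gamma> g (w t) (s - t) \<noteq> 0} \<subseteq> (\<lambda>l. - of_nat l) ` {..B}"
  proof
    fix t assume "t \<in> {t. VO n u d \<gamma> g (w t) (s - t) \<noteq> 0}"
    then have "w t \<noteq> 0" by (auto simp: VO_def on_V_def)
    then obtain \<beta> where "lookup (w t) \<beta> \<noteq> 0" by (metis lookup_zero poly_mapping_eqI)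
    then show "t \<in> (\<lambda>l. - of_nat l) ` {..B}" by (rule wt)
  qed
  then have "ocomp (VO n u d \<gamma> g) (VO n (\<lambda>_. 0) d' 0 g') v s = (\<Sum>t\<in>(\<lambda>l. - of_nat l) ` {..B}. VO n u d \<gamma> g (w t) (s - t))"
    unfolding ocomp_def w_def[symmetric] by (rule Sum_any.expand_superset[rotated]) simp
  also have "\<dots> = (\<Sum>l\<le>B. VO n u d \<gamma> g (w (- of_nat l)) (s + of_nat l))"
    by (rule sum.reindex_cong[where l = "\<lambda>l. - of_nat l"]) (auto simp: inj_on_def)
  finally have "lookup (ocomp (VO n u d \<gamma> g) (VO n (\<lambda>_. 0) d' 0 g') v s) \<delta>
     = (\<Sum>l\<le>B. VOc n u d \<gamma> g \<beta> (smK (g' \<beta>) (Tc n d' l p)) (s + of_nat l))"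
    by (simp add: lookup_sum lookup_VO[OF wV] lw p_def \<beta>_def)
  also have "\<dots> = VOc n u (d + d') \<gamma> (\<lambda>\<beta>. g \<beta> * g' \<beta>) \<beta> p s"
  proof (cases "s - form n \<gamma> \<beta> \<in> \<int>")
    case True
    then obtain m where m: "s - form n \<gamma> \<beta> = of_int m" by (auto elim: Ints_cases)
    have "s + of_nat l - form n \<gamma> \<beta> = of_int (m + int l)" for l using m by simp
    then show ?thesis
      by (simp add: VOc_def m Lc_add_d[OF B] p_def smK_sum Lc_smK smK_smK del: of_int_add)
  next
    case False
    have "s + of_nat l - form n \<gamma> \<beta> \<notin> \<int>" for l
      using False Ints_diff[of "s + of_nat l - form n \<gamma> \<beta>" "of_nat l"] by auto
    then show ?thesis using False by (simp add: VOc_def)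
  qed
  finally show "lookup (ocomp (VO n u d \<gamma> g) (VO n (\<lambda>_. 0) d' 0 g') v s) \<delta>
     = lookup (VO n u (d + d') \<gamma> (\<lambda>\<beta>. g \<beta> * g' \<beta>) v s) \<delta>"
    by (simp add: lookup_VO[OF v] p_def \<beta>_def)
qed

section \<open>States\<close>

lemma form_sym: "form n \<beta> \<gamma> = form n \<gamma> \<beta>"
  unfolding form_def by (subst sum.swap) (simp add: mult_ac min.commute max.commute)

lemma form_simple_root_left:
  assumes "j \<in> {1..n}"
  shows "form n (simple_root n j) \<beta> = of_int (lookup \<beta> j)"
proof -
  have "form n \<beta> (simple_root n j) = (\<Sum>i=1..n. if i = j then of_int (lookup \<beta> j) else 0)"
    unfolding form_expand_left[of n \<beta>] using assms
    by (intro sum.cong refl) (simp add: form_fund_simple_root)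
  then show ?thesis using assms by (simp add: form_sym)
qed

lemma Plat_simple_root [simp]: "simple_root n j \<in> Plat n"
  by (auto simp: Plat_def in_keys_iff lookup_simple_root split: if_splits)

lemma Plat_fund [simp]: "i \<in> {1..n} \<Longrightarrow> fund i \<in> Plat n"
  by (simp add: Plat_def fund_def)

text \<open>The minuscule weights of the fundamental representation with highest weight \<open>\<lambda>\<^sub>i\<close> correspond to
  the \<open>i\<close>-element subsets of \<open>{1, \<dots>, n + 1}\<close>; the action of \<open>x\<^sub>j\<^sup>-\<close> replaces \<open>j\<close> by \<open>j + 1\<close>.\<close>

definition states :: "nat \<Rightarrow> nat \<Rightarrow> nat set set" where
  "states n i = {S. S \<subseteq> {1..Suc n} \<and> card S = i}"

definition cnt :: "nat set \<Rightarrow> nat \<Rightarrow> nat" where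
  "cnt S j = card (S \<inter> {1..j})"

text \<open>The exponent \<open>h\<close> of the zero or pole \<open>z\<^sub>1 = q^h z\<close> in
  the contraction of \<open>x_j^-\<close> with the state \<open>S\<close>. It is 1 for
  \<open>S = {1..i}\<close> and \<open>j = i\<close>, and a move at \<open>j\<close> raises it by
  2.\<close>

definition ht :: "nat \<Rightarrow> nat set \<Rightarrow> nat \<Rightarrow> int" where
  "ht i S j = int i + int j + 1 - 2 * int (cnt S j)"

definition pairing :: "nat set \<Rightarrow> nat \<Rightarrow> int" where
  "pairing S j = of_bool (j \<in> S) - of_bool (Suc j \<in> S)"

definition move :: "nat set \<Rightarrow> nat \<Rightarrow> nat set" where
  "move S j = insert (Suc j) (S - {j})"

lemma states_finite: "S \<in> states n i \<Longrightarrow> finite S"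
  by (auto simp: states_def intro: finite_subset)

lemma states_initial: "i \<in> {1..n} \<Longrightarrow> {1..i} \<in> states n i"
  by (auto simp: states_def)

lemma states_move: "S \<in> states n i \<Longrightarrow> j \<in> {1..n} \<Longrightarrow> j \<in> S \<Longrightarrow> Suc j \<notin> S \<Longrightarrow> move S j \<in> states n i"
  using states_finite[of S n i]
  by (auto simp: states_def move_def card_Diff_singleton) (metis Suc_pred card_gt_0_iff empty_iff)

text \<open>Undoing a move lowers the sum of the elements, which is the measure for
  \<open>states_induct\<close>.\<close>

lemma states_unmove:
  assumes "S \<in> states n i" "j \<in> {1..n}" "j \<notin> S" "Suc j \<in> S"
  obtains T where "T \<in> states n i" "j \<in> T" "Suc j \<notin> T" "S = move T j" "\<Sum>T < \<Sum>S"
proof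
  let ?T = "insert j (S - {Suc j})"
  have fin: "finite S" by (rule states_finite[OF assms(1)])
  have c: "card S = i" "card S > 0" using assms fin by (auto simp: states_def card_gt_0_iff)
  show "?T \<in> states n i" using assms fin c by (auto simp: states_def card_Diff_singleton)
  show "S = move ?T j" using assms by (auto simp: move_def)
  have "\<Sum>?T = j + \<Sum>(S - {Suc j})" using assms fin by (subst sum.insert) auto
  moreover have "\<Sum>S = Suc j + \<Sum>(S - {Suc j})" using assms fin by (simp add: sum.remove)
  ultimately show "\<Sum>?T < \<Sum>S" by simp
qed auto

lemma down_closed_eq_interval:
  fixes S :: "nat set"
  assumes "finite S" "0 \<notin> S" "\<And>j. j \<ge> 1 \<Longrightarrow> Suc j \<in> S \<Longrightarrow> j \<in> S"
  shows "S = {1..card S}"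
proof (cases "S = {}")
  case False
  define m where "m = Max S"
  have m: "m \<in> S" using False assms by (simp add: m_def)
  have "{1..m} \<subseteq> S"
  proof
    fix k assume "k \<in> {1..m}"
    then have "k \<le> m" "1 \<le> k" by auto
    then show "k \<in> S" using m
    proof (induction rule: inc_induct)
      case (step k)
      then show ?case using assms(3)[of k] by simp
    qed
  qed
  moreover have "S \<subseteq> {1..m}"
  proof
    fix x assume x: "x \<in> S"
    then have "x \<le> m" using assms by (simp add: m_def)
    moreover have "x \<noteq> 0" using x assms(2) by metis
    ultimately show "x \<in> {1..m}" by simp
  qed
  ultimately have "S = {1..m}" by blast
  then show ?thesis by (metis card_atLeastAtMost diff_Suc_1)
qed simp

text \<open>Moves are undone as long as possible; a state in which no move can be undone is downward
  closed, hence the initial segment, that is, the highest weight.\<close>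

lemma states_induct [consumes 2, case_names initial move]:
  assumes "S \<in> states n i" "i \<in> {1..n}" and "P {1..i}"
    and "\<And>S j. S \<in> states n i \<Longrightarrow> j \<in> {1..n} \<Longrightarrow> j \<in> S \<Longrightarrow> Suc j \<notin> S \<Longrightarrow> P S \<Longrightarrow> P (move S j)"
  shows "P S"
  using assms(1)
proof (induction "\<Sum>S" arbitrary: S rule: less_induct)
  case less
  show ?case
  proof (cases "\<exists>j\<in>{1..n}. j \<notin> S \<and> Suc j \<in> S")
    case True
    then obtain j where "j \<in> {1..n}" "j \<notin> S" "Suc j \<in> S" by blast
    then obtain T where "T \<in> states n i" "j \<in> T" "Suc j \<notin> T" "S = move T j" "\<Sum>T < \<Sum>S"
      using states_unmove[OF less.prems] by metis
    then show ?thesis using less.hyps assms(4) \<open>j \<in> {1..n}\<close> by blast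
  next
    case False
    have "S = {1..card S}"
    proof (rule down_closed_eq_interval)
      show "finite S" using states_finite less.prems by blast
      show "0 \<notin> S" using less.prems by (auto simp: states_def)
      fix j assume j: "j \<ge> 1" "Suc j \<in> S"
      then have "j \<in> {1..n}" using less.prems by (auto simp: states_def)
      then show "j \<in> S" using False j by blast
    qed
    then show ?thesis using less.prems assms(3) by (simp add: states_def)
  qed
qed

lemma cnt_le: "S \<in> states n i \<Longrightarrow> cnt S j \<le> min i j"
  using card_mono[of S "S \<inter> {1..j}"] card_mono[of "{1..j}" "S \<inter> {1..j}"] states_finite[of S n i]
  by (auto simp: cnt_def states_def)

lemma cnt_Suc: "cnt S (Suc j) = cnt S j + of_bool (Suc j \<in> S)"
proof -
  have "S \<inter> {1..Suc j} = (if Suc j \<in> S then insert (Suc j) (S \<inter> {1..j}) else S \<inter> {1..j})"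
    by (auto simp: le_Suc_eq)
  then show ?thesis by (simp add: cnt_def)
qed

lemma cnt_0 [simp]: "cnt S 0 = 0"
  by (simp add: cnt_def)

lemma cnt_move:
  assumes "j \<in> S" "Suc j \<notin> S" "j \<ge> 1"
  shows "cnt (move S j) k = cnt S k - of_bool (k = j)"
    and "cnt S j \<ge> 1"
proof -
  show c1: "cnt S j \<ge> 1"
    using assms(1,3) cnt_Suc[of S "j - 1"] by (cases j) auto
  have "cnt (move S j) k + of_bool (k = j) = cnt S k"
  proof (induction k)
    case (Suc k)
    then show ?case using assms by (cases "k = j"; cases "Suc k = j") (auto simp: cnt_Suc move_def)
  qed (use assms in auto)
  then show "cnt (move S j) k = cnt S k - of_bool (k = j)" by linarith
qed

lemma cnt_interval: "cnt {1..i} j = min i j"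
proof -
  have "{1..i} \<inter> {1..j} = {1..min i j}" by auto
  then show ?thesis by (simp add: cnt_def)
qed

lemma pairing_move:
  assumes "j \<in> S" "Suc j \<notin> S" "j \<ge> 1" "k \<ge> 1"
  shows "pairing (move S j) k = pairing S k - cartan j k"
  using assms by (auto simp: pairing_def move_def cartan_def)

lemma ht_move:
  assumes "j \<in> S" "Suc j \<notin> S" "j \<ge> 1"
  shows "ht i (move S j) k = ht i S k + 2 * of_bool (k = j)"
  using cnt_move[OF assms] by (auto simp: ht_def)

definition swt :: "nat \<Rightarrow> nat set \<Rightarrow> weight" where
  "swt n S = (\<Sum>j=1..n. single j (pairing S j))"

lemma lookup_swt: "lookup (swt n S) j = (if j \<in> {1..n} then pairing S j else 0)"
  by (simp add: swt_def lookup_sum lookup_single when_def)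

lemma Plat_swt [simp]: "swt n S \<in> Plat n"
  by (auto simp: Plat_def in_keys_iff lookup_swt split: if_splits)

lemma swt_move:
  assumes "j \<in> S" "Suc j \<notin> S" "j \<ge> 1"
  shows "swt n (move S j) = - simple_root n j + swt n S"
  by (rule poly_mapping_eqI) (use assms in \<open>auto simp: lookup_swt lookup_add lookup_minus lookup_simple_root pairing_move\<close>)

lemma swt_initial: "i \<in> {1..n} \<Longrightarrow> swt n {1..i} = fund i"
  by (rule poly_mapping_eqI) (auto simp: lookup_swt fund_def lookup_single when_def pairing_def)

text \<open>The coefficient functions of the operator with state \<open>S\<close>: the operators \<open>x\<^sub>k\<^sup>-(zq\<^sup>h)\<close> in it have
  \<open>h = i + k + 1 - 2 m\<close> with \<open>cnt S k < m \<le> min i k\<close>.\<close>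

definition su :: "nat \<Rightarrow> nat \<Rightarrow> nat set \<Rightarrow> nat \<times> nat \<Rightarrow> scal" where
  "su n i S x = yu n i x + (\<Sum>m\<in>{Suc (cnt S (fst x))..min i (fst x)}.
     qpow (of_int (int i + int (fst x) + 1 - 2 * int m)) ^ snd x) * xu (- 1) (fst x) x"

definition sd :: "nat \<Rightarrow> nat \<Rightarrow> nat set \<Rightarrow> nat \<times> nat \<Rightarrow> scal" where
  "sd n i S x = yd n i x + (\<Sum>k=1..n. (\<Sum>m\<in>{Suc (cnt S k)..min i k}.
     qpow (- of_int (int i + int k + 1 - 2 * int m)) ^ snd x) * xd (- 1) k x)"

definition pd :: "(nat \<times> rat) list \<Rightarrow> nat \<times> nat \<Rightarrow> scal" where
  "pd w x = (\<Sum>(j, t)\<leftarrow>w. scaled (- t) (psid j) x)"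

text \<open>The character of \<open>P\<close> belonging to a state: the cocycle, the sign of
  \<open>Y_op\<close>, the powers of \<open>q\<close> that the factors
  \<open>z^(-\<partial>)\<close> of the letters acquire at \<open>zq^h\<close>, and the
  \<open>K_j\<close> of the \<open>\<psi>\<close>-letters. It is 1 at the zero weight.\<close>

definition sg :: "nat \<Rightarrow> nat \<Rightarrow> nat set \<Rightarrow> (nat \<times> rat) list \<Rightarrow> weight \<Rightarrow> scal" where
  "sg n i S w \<beta> = eps n (swt n S) \<beta> * ysgn n i \<beta> *
     (\<Prod>k=1..n. \<Prod>m\<in>{Suc (cnt S k)..min i k}.
        qpow (- of_int (int i + int k + 1 - 2 * int m) * of_int (lookup \<beta> k))) *
     (\<Prod>(j, t)\<leftarrow>w. qpow (of_int (lookup \<beta> j)))"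

text \<open>The scalar \<open>\<kappa>\<close> is kept apart because it collects cocycle values and
  residues, which depend on the way in which the state is reached.\<close>

definition VS :: "nat \<Rightarrow> nat \<Rightarrow> nat set \<Rightarrow> (nat \<times> rat) list \<Rightarrow> scal \<Rightarrow> oper" where
  "VS n i S w \<kappa> = VO n (su n i S) (sd n i S + pd w) (swt n S) (\<lambda>\<beta>. \<kappa> * sg n i S w \<beta>)"

lemma atLeastAtMost_insert_lower: "(a::nat) \<le> b \<Longrightarrow> {a..b} = insert a {Suc a..b}"
  by auto

text \<open>A move at \<open>j\<close> lowers the count at \<open>j\<close> by one and thereby adds
  precisely the letter \<open>m = cnt S j\<close>, whose exponent is
  \<open>ht i S j\<close>.\<close>

lemma letters_move:
  assumes S: "S \<in> states n i" and j: "j \<in> S" "Suc j \<notin> S" "j \<ge> 1"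
  shows "{Suc (cnt (move S j) k)..min i k} =
     (if k = j then insert (cnt S j) {Suc (cnt S j)..min i j} else {Suc (cnt S k)..min i k})"
  using cnt_move(1)[OF j, of k] cnt_move(2)[OF j] cnt_le[OF S, of j] atLeastAtMost_insert_lower[of "cnt S j" "min i j"]
  by auto

lemma xu_zero: "fst x \<noteq> j \<Longrightarrow> xu \<sigma> j x = 0"
  by (simp add: xu_def)

lemma su_move:
  assumes "S \<in> states n i" "j \<in> S" "Suc j \<notin> S" "j \<ge> 1"
  shows "su n i (move S j) x = su n i S x + scaled (of_int (ht i S j)) (xu (- 1) j) x"
  unfolding su_def letters_move[OF assms] scaled_def
  by (auto simp: ht_def distrib_right xu_zero)

lemma sd_move:
  assumes S: "S \<in> states n i" and j: "j \<in> S" "Suc j \<notin> S" and jn: "j \<in> {1..n}"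
  shows "sd n i (move S j) x = sd n i S x + scaled (- of_int (ht i S j)) (xd (- 1) j) x"
proof -
  have j1: "j \<ge> 1" using jn by simp
  define f where "f k m = qpow (- of_int (int i + int k + 1 - 2 * int m)) ^ snd x" for k m
  have "(\<Sum>m\<in>{Suc (cnt (move S j) k)..min i k}. f k m) * xd (- 1) k x
     = (\<Sum>m\<in>{Suc (cnt S k)..min i k}. f k m) * xd (- 1) k x + (if k = j then f j (cnt S j) * xd (- 1) j x else 0)" for k
    unfolding letters_move[OF S j j1] by (auto simp: distrib_right)
  then have "(\<Sum>k=1..n. (\<Sum>m\<in>{Suc (cnt (move S j) k)..min i k}. f k m) * xd (- 1) k x)
     = (\<Sum>k=1..n. (\<Sum>m\<in>{Suc (cnt S k)..min i k}. f k m) * xd (- 1) k x) + f j (cnt S j) * xd (- 1) j x"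
    using jn by (simp add: sum.distrib)
  then show ?thesis unfolding sd_def f_def[symmetric] by (simp add: scaled_def f_def ht_def)
qed

lemma eps_uminus_left: "eps n (- \<gamma>) \<beta> = inverse (eps n \<gamma> \<beta>)"
proof -
  have "eps n 0 \<beta> = 1" by (simp add: eps_def coord_def)
  then have "eps n \<gamma> \<beta> * eps n (- \<gamma>) \<beta> = 1" by (simp flip: eps_add_left)
  then show ?thesis by (simp add: inverse_unique)
qed

lemma eps_nonzero [simp]: "eps n \<gamma> \<beta> \<noteq> 0"
  by (simp add: eps_def)

lemma sg_move:
  assumes S: "S \<in> states n i" and j: "j \<in> S" "Suc j \<notin> S" and jn: "j \<in> {1..n}"
  shows "sg n i (move S j) w \<beta> = eps n (- simple_root n j) \<beta>
     * qpow (- of_int (ht i S j) * of_int (lookup \<beta> j)) * sg n i S w \<beta>"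
proof -
  have j1: "j \<ge> 1" using jn by simp
  define f where "f k m = qpow (- of_int (int i + int k + 1 - 2 * int m) * of_int (lookup \<beta> k))" for k m
  have "(\<Prod>m\<in>{Suc (cnt (move S j) k)..min i k}. f k m)
     = (\<Prod>m\<in>{Suc (cnt S k)..min i k}. f k m) * (if k = j then f j (cnt S j) else 1)" for k
    unfolding letters_move[OF S j j1] by auto
  then have "(\<Prod>k=1..n. \<Prod>m\<in>{Suc (cnt (move S j) k)..min i k}. f k m)
     = (\<Prod>k=1..n. \<Prod>m\<in>{Suc (cnt S k)..min i k}. f k m) * f j (cnt S j)"
    using jn by (simp add: prod.distrib)
  then show ?thesis unfolding sg_def f_def[symmetric] swt_move[OF j j1] eps_add_left
    by (simp add: f_def ht_def mult_ac)
qed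

lemma Y_op_state:
  assumes "i \<in> {1..n}"
  shows "Y_op n i = VS n i {1..i} [] 1"
proof -
  \<comment> \<open>In the initial state every count is already maximal, so there are no
    letters.\<close>
  have e: "{Suc (cnt {1..i} k)..min i k} = {}" for k unfolding cnt_interval by simp
  have "su n i {1..i} = yu n i" "sd n i {1..i} + pd [] = yd n i"
    "(\<lambda>\<beta>. 1 * sg n i {1..i} [] \<beta>) = (\<lambda>\<beta>. eps n (fund i) \<beta> * ysgn n i \<beta>)"
    using assms e[unfolded One_nat_def] swt_initial[OF assms, unfolded One_nat_def]
    by (simp_all add: su_def[abs_def] sd_def[abs_def] sg_def[abs_def] pd_def[abs_def] fun_eq_iff)
  then show ?thesis unfolding VS_def Y_op_VO swt_initial[OF assms] by simp
qed

section \<open>Contractions with a state\<close>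

lemma qpow_half_sq: "qpow (of_nat r / 2) * qpow (of_nat r / 2) = qpow (of_nat r)"
  by (subst qpow_add[symmetric]) auto

lemma q_diff_nonzero: "qpow 1 - qpow (- 1) \<noteq> 0"
  using qpow_eq_iff[of 1 "- 1"] by simp

lemma qint_eq: "qint m * (qpow 1 - qpow (- 1)) = qpow (of_int m) - qpow (- of_int m)"
  using q_diff_nonzero by (simp add: qint_def)

lemma qint_neq_0': "r > 0 \<Longrightarrow> qint (int r) \<noteq> 0"
  by (rule qint_neq_0) simp

lemma qint_frac: "qint m = (qpow (of_int m) - inverse (qpow (of_int m))) / (qpow 1 - qpow (- 1))"
  by (simp add: qint_def qpow_minus)

lemma qpow_of_int_mult_add: "qpow (of_int ((a + b) * r)) = qpow (of_int (a * r)) * qpow (of_int (b * r))"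
  by (simp add: distrib_right qpow_add flip: of_int_mult)

text \<open>Needed for the diagonal entries of the inverse of the q-deformed Cartan matrix.\<close>

lemma qint_mult_qint_diff:
  "qint ((a + 1) * r) * qint ((b + 1) * r) - qint (a * r) * qint (b * r) = qint r * qint ((a + b + 1) * r)"
proof -
  define D where "D = qpow 1 - qpow (- 1)"
  define x A B where "x = qpow (of_int r)" and "A = qpow (of_int (a * r))" and "B = qpow (of_int (b * r))"
  have nz: "x \<noteq> 0" "A \<noteq> 0" "B \<noteq> 0" by (simp_all add: x_def A_def B_def)
  have e: "qpow (of_int ((a + 1) * r)) = A * x" "qpow (of_int ((b + 1) * r)) = B * x"
    "qpow (of_int ((a + b + 1) * r)) = A * B * x"
    unfolding qpow_of_int_mult_add by (simp_all add: x_def A_def B_def)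
  have "((A * x - inverse (A * x)) * (B * x - inverse (B * x)) - (A - inverse A) * (B - inverse B))
     = (x - inverse x) * (A * B * x - inverse (A * B * x))"
    using nz by (simp add: field_simps)
  then show ?thesis
    unfolding qint_frac e D_def[symmetric] x_def[symmetric] A_def[symmetric] B_def[symmetric]
    by (simp add: diff_divide_distrib[symmetric])
qed

text \<open>The three-term recursion of the q-integers; it gives the vanishing of the off-diagonal
  entries in \<open>cartan_mstar\<close>.\<close>

lemma qint_double: "qint (2 * r) * qint (a * r) = qint r * (qint ((a + 1) * r) + qint ((a - 1) * r))"
proof -
  define D where "D = qpow 1 - qpow (- 1)"
  define x A where "x = qpow (of_int r)" and "A = qpow (of_int (a * r))"
  have nz: "x \<noteq> 0" "A \<noteq> 0" by (simp_all add: x_def A_def)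
  have "qpow (of_int ((a - 1) * r)) * x = A"
    using qpow_of_int_mult_add[of "a - 1" 1 r] by (simp add: x_def A_def)
  then have "qpow (of_int ((a - 1) * r)) = A * inverse x" using nz by (simp add: field_simps)
  moreover have "qpow (of_int (2 * r)) = x * x"
    using qpow_of_int_mult_add[of 1 1 r] by (simp add: x_def)
  moreover have "qpow (of_int ((a + 1) * r)) = A * x"
    unfolding qpow_of_int_mult_add by (simp add: x_def A_def)
  moreover have "(x * x - inverse (x * x)) * (A - inverse A)
      = (x - inverse x) * ((A * x - inverse (A * x)) + (A * inverse x - inverse (A * inverse x)))"
    using nz by (simp add: field_simps)
  ultimately show ?thesis
    unfolding qint_frac D_def[symmetric] x_def[symmetric] A_def[symmetric]
    by (simp add: add_divide_distrib[symmetric])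
qed

lemma qint_0 [simp]: "qint 0 = 0"
  by (simp add: qint_def)

lemma mstar_uminus: "mstar n i k (- l) = mstar n i k l"
  by (simp add: mstar_def qint_uminus)

lemma sum_qint_cartan:
  assumes "j \<in> {1..n}" "f 0 = 0" "f (Suc n) = 0"
  shows "(\<Sum>k=1..n. qint (cartan j k * l) * f k) = qint (2 * l) * f j - qint l * (f (j - 1) + f (Suc j))"
proof -
  have "(\<Sum>k=1..n. qint (cartan j k * l) * f k) = (\<Sum>k=1..n. (if k = j then qint (2 * l) * f k else 0)
     - (if k = j - 1 then qint l * f k else 0) - (if k = Suc j then qint l * f k else 0))"
    using assms(1) by (intro sum.cong refl) (auto simp: cartan_def qint_uminus)
  also have "\<dots> = qint (2 * l) * f j - qint l * f (j - 1) - qint l * f (Suc j)"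
  proof -
    have "j - 1 \<in> {1..n} \<or> j - 1 = 0" "Suc j \<in> {1..n} \<or> Suc j = Suc n" using assms(1) by auto
    then show ?thesis using assms by (auto simp: sum_subtractf)
  qed
  finally show ?thesis by (simp add: algebra_simps)
qed

text \<open>Up to the factor \<open>qint r\<close>, \<open>mstar\<close> is inverse to the deformed
  Cartan matrix. It is built like a Green function: on either side of the diagonal it solves the
  three-term recursion with zero boundary value at 0 or \<open>n + 1\<close>, and the jump at the
  diagonal is \<open>qint_mult_qint_diff\<close>.\<close>

lemma cartan_mstar:
  assumes "i \<in> {1..n}" "j \<in> {1..n}" "r > 0"
  shows "(\<Sum>k=1..n. qint (cartan j k * int r) * mstar n i k (int r)) = (if i = j then qint (int r) else 0)"
proof -
  define l where "l = int r"
  define D where "D = qint ((int n + 1) * l) * qint l"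
  have Dnz: "qint l \<noteq> 0" "qint ((int n + 1) * l) \<noteq> 0" using assms(3) by (auto simp: l_def intro!: qint_neq_0)
  define f where "f k = (if k \<le> i then qint (int k * l) * qint ((int n - int i + 1) * l)
      else qint (int i * l) * qint ((int n - int k + 1) * l))" for k
  have m: "mstar n i k (int r) = f k / D" for k by (simp add: mstar_def f_def D_def l_def)
  have f_ge: "f k = qint (int i * l) * qint ((int n - int k + 1) * l)" if "k \<ge> i" for k
    using that by (auto simp: f_def)
  have "(\<Sum>k=1..n. qint (cartan j k * l) * f k) = qint (2 * l) * f j - qint l * (f (j - 1) + f (Suc j))"
    by (rule sum_qint_cartan) (use assms in \<open>auto simp: f_def\<close>)
  also have "\<dots> = (if i = j then D * qint l else 0)"
  proof -
    obtain j' where j': "j = Suc j'" using assms by (cases j) auto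
    consider "j < i" | "j = i" | "j > i" by linarith
    then show ?thesis
    proof cases
      case 1
      then have f1: "f j = qint (int j * l) * qint ((int n - int i + 1) * l)"
        "f (j - 1) = qint ((int j - 1) * l) * qint ((int n - int i + 1) * l)"
        "f (Suc j) = qint ((int j + 1) * l) * qint ((int n - int i + 1) * l)"
        by (auto simp: f_def j' algebra_simps)
      have "qint (2 * l) * f j = (qint (2 * l) * qint (int j * l)) * qint ((int n - int i + 1) * l)"
        unfolding f1 by (simp only: mult.assoc)
      then show ?thesis using 1 unfolding qint_double f1(2,3) by (simp add: distrib_left distrib_right mult.assoc)
    next
      case 3
      have f1: "f j = qint (int i * l) * qint ((int n - int j + 1) * l)"
        "f (j - 1) = qint (int i * l) * qint ((int n - int j + 1 + 1) * l)"
        "f (Suc j) = qint (int i * l) * qint ((int n - int j + 1 - 1) * l)"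
        using 3 by (auto simp: f_ge j' algebra_simps)
      have "qint (2 * l) * f j = qint (int i * l) * (qint (2 * l) * qint ((int n - int j + 1) * l))"
        unfolding f1 by (simp only: mult_ac)
      then show ?thesis using 3 unfolding qint_double f1(2,3) by (simp add: distrib_left mult_ac)
    next
      case 2
      have f1: "f j = qint (int j * l) * qint ((int n - int j + 1) * l)"
        "f (j - 1) = qint ((int j - 1) * l) * qint ((int n - int j + 1) * l)"
        "f (Suc j) = qint (int j * l) * qint ((int n - int j) * l)"
        using 2 by (auto simp: f_def j' algebra_simps)
      have "qint (2 * l) * f j - qint l * (f (j - 1) + f (Suc j))
        = (qint (2 * l) * qint (int j * l)) * qint ((int n - int j + 1) * l) - qint l * (f (j - 1) + f (Suc j))"
        unfolding f1 by (simp add: mult.assoc)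
      also have "\<dots> = qint l * (qint ((int j + 1) * l) * qint ((int n - int j + 1) * l) - qint (int j * l) * qint ((int n - int j) * l))"
        unfolding f1 qint_double by (simp add: algebra_simps)
      also have "\<dots> = qint l * (qint l * qint ((int j + (int n - int j) + 1) * l))"
        unfolding qint_mult_qint_diff[of "int j" l "int n - int j"] ..
      finally show ?thesis using 2 by (simp add: D_def mult_ac)
    qed
  qed
  finally have *: "(\<Sum>k=1..n. qint (cartan j k * l) * f k) = (if i = j then D * qint l else 0)" .
  have "(\<Sum>k=1..n. qint (cartan j k * int r) * mstar n i k (int r)) = (\<Sum>k=1..n. qint (cartan j k * l) * f k) / D"
    by (simp add: m l_def sum_divide_distrib)
  then show ?thesis using Dnz unfolding * by (auto simp: D_def l_def)
qed

text \<open>A move at \<open>l\<close> adds the contraction of \<open>x_j^-\<close> with the new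
  letter, \<open>- [a_jl r]/[r] q^((h+1) r)/r\<close>. It turns a pole at \<open>h\<close> into a
  zero at \<open>h + 2\<close> when \<open>j = l\<close>. For neighbours it creates a pole at
  \<open>h + 1\<close> or cancels a zero there; the positions match because \<open>l\<close> lies in
  \<open>S\<close> and \<open>l + 1\<close> does not.\<close>

lemma contraction_state:
  assumes S: "S \<in> states n i" and i: "i \<in> {1..n}" and j: "j \<in> {1..n}" and r: "r > 0"
  shows "(\<Sum>k=1..n. xd (- 1) j (k, r) * su n i S (k, r)) = of_int (pairing S j) * qpow (of_int (ht i S j)) ^ r / of_nat r"
  using S i
proof (induction rule: states_induct)
  case initial
  have e: "{Suc (cnt {1..i} k)..min i k} = {}" for k unfolding cnt_interval by simp
  have su: "su n i {1..i} x = yu n i x" for x unfolding su_def e by simp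
  have "(\<Sum>k=1..n. xd (- 1) j (k, r) * su n i {1..i} (k, r))
     = (\<Sum>k=1..n. qpow (of_nat r) / (of_nat r * qint (int r)) * (qint (cartan j k * int r) * mstar n i k (int r)))"
    unfolding su using r qint_neq_0'[OF r]
    by (intro sum.cong refl)
       (simp add: xd_def yu_def heis_coeff_def mstar_uminus qpow_half_sq[symmetric])
  also have "\<dots> = (if i = j then qpow (of_nat r) / of_nat r else 0)"
    unfolding sum_distrib_left[symmetric] cartan_mstar[OF i j r] using qint_neq_0'[OF r] by simp
  also have "\<dots> = of_int (pairing {1..i} j) * qpow (of_int (ht i {1..i} j)) ^ r / of_nat r"
  proof -
    have h: "ht i {1..i} i = 1" using i by (simp add: ht_def cnt_interval[unfolded One_nat_def])
    have "qpow 1 ^ r = qpow (of_nat r)" using qpow_of_nat_mult[of 1 r] by simp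
    then show ?thesis using i j h by (auto simp: pairing_def)
  qed
  finally show ?case .
next
  case (move S l)
  have l1: "l \<ge> 1" using move by auto
  define h where "h = ht i S l"
  have "(\<Sum>k=1..n. xd (- 1) j (k, r) * su n i (move S l) (k, r))
     = (\<Sum>k=1..n. xd (- 1) j (k, r) * su n i S (k, r)) + (\<Sum>k=1..n. xd (- 1) j (k, r) * scaled (of_int h) (xu (- 1) l) (k, r))"
    unfolding su_move[OF move(1,3,4) l1] distrib_left sum.distrib h_def ..
  also have "(\<Sum>k=1..n. xd (- 1) j (k, r) * su n i S (k, r)) = of_int (pairing S j) * qpow (of_int (ht i S j)) ^ r / of_nat r"
    using move by blast
  also have "(\<Sum>k=1..n. xd (- 1) j (k, r) * scaled (of_int h) (xu (- 1) l) (k, r))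
     = (\<Sum>k=1..n. if k = l then xd (- 1) j (l, r) * scaled (of_int h) (xu (- 1) l) (l, r) else 0)"
    by (intro sum.cong refl) (auto simp: scaled_def xu_zero)
  also have "\<dots> = xd (- 1) j (l, r) * scaled (of_int h) (xu (- 1) l) (l, r)" using move by simp
  also have "\<dots> = - (qint (cartan j l * int r) / qint (int r)) * qpow (of_int (h + 1)) ^ r / of_nat r"
  proof -
    have "qpow (of_int (h + 1)) ^ r = qpow (of_int h) ^ r * qpow (of_nat r)"
      using qpow_of_nat_mult[of 1 r] by (simp add: qpow_add power_mult_distrib)
    then show ?thesis using r qint_neq_0'[OF r]
      by (simp add: xd_def xu_def scaled_def heis_coeff_def qpow_half_sq[symmetric] mult_ac)
  qed
  also have "of_int (pairing S j) * qpow (of_int (ht i S j)) ^ r / of_nat r + \<dots>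
     = of_int (pairing (move S l) j) * qpow (of_int (ht i (move S l) j)) ^ r / of_nat r"
  proof -
    have pm: "pairing (move S l) j = pairing S j - cartan l j"
      using pairing_move[OF move(3,4) l1] j by simp
    have hm: "ht i (move S l) j = ht i S j + 2 * of_bool (j = l)" by (rule ht_move[OF move(3,4) l1])
    consider "j = l" | "j = Suc l" | "Suc j = l" | "cartan j l = 0" "cartan l j = 0" "j \<noteq> l"
      by (cases "j = l \<or> j = Suc l \<or> Suc j = l") (auto simp: cartan_def)
    then show ?thesis
    proof cases
      case 1
      have "pairing S j = 1" using 1 move by (simp add: pairing_def)
      moreover have "qint (2 * int r) = qint (int r) * (qpow (of_nat r) + inverse (qpow (of_nat r)))"
      proof -
        have "qpow (of_int (2 * int r)) = qpow (of_nat r) * qpow (of_nat r)"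
          using qpow_add[of "of_nat r" "of_nat r"] by simp
        then show ?thesis by (simp add: qint_frac field_simps)
      qed
      moreover have "qpow (of_int (h + 1)) ^ r = qpow (of_int h) ^ r * qpow (of_nat r)"
        "qpow (of_int (h + 2)) ^ r = qpow (of_int h) ^ r * (qpow (of_nat r) * qpow (of_nat r))"
        using qpow_of_nat_mult[of 1 r] qpow_of_nat_mult[of 2 r] qpow_add[of "of_nat r" "of_nat r"]
        by (simp_all add: qpow_add power_mult_distrib mult_2_right)
      ultimately have db: "qint (cartan j l * int r) / qint (int r) = qpow (of_nat r) + inverse (qpow (of_nat r))"
        and h1: "qpow (of_int (h + 1)) ^ r = qpow (of_int h) ^ r * qpow (of_nat r)"
        and h2: "qpow (of_int (h + 2)) ^ r = qpow (of_int h) ^ r * (qpow (of_nat r) * qpow (of_nat r))"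
        and p1: "pairing S j = 1"
        using 1 qint_neq_0'[OF r] by (simp_all add: cartan_def)
      have e: "pairing (move S l) j = - 1" "ht i (move S l) j = h + 2" "ht i S j = h"
        unfolding pm hm using 1 p1 by (simp_all add: cartan_def h_def)
      \<comment> \<open>Here \<open>H = q^(h r)\<close> and \<open>X = q^r\<close>: the term at
        exponent \<open>h\<close> cancels and one at \<open>h + 2\<close> with opposite sign is
        left.\<close>
      have "H + - (X + inverse X) * (H * X) = - 1 * (H * (X * X))" if "X \<noteq> 0" for H X :: scal
        using that by (simp add: field_simps)
      then show ?thesis unfolding db e h1 h2 p1 add_divide_distrib[symmetric] by simp
    next
      case 2
      have "ht i S j = h + 1" using 2 move by (simp add: h_def ht_def cnt_Suc)
      then show ?thesis using 2 pm hm qint_neq_0'[OF r]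
        by (simp add: cartan_def qint_uminus algebra_simps add_divide_distrib)
    next
      case 3
      have "ht i S j = h + 1" using 3 move by (auto simp: h_def ht_def cnt_Suc)
      then show ?thesis using 3 pm hm qint_neq_0'[OF r]
        by (auto simp: cartan_def qint_uminus algebra_simps add_divide_distrib)
    next
      case 4
      then show ?thesis using pm hm by simp
    qed
  qed
  finally show ?case .
qed

lemma fps_nth_linear_mult:
  "fps_nth ((1 - fps_const a * fps_X) * F) m = fps_nth F m - (if m = 0 then 0 else a * fps_nth F (m - 1))"
  for a :: "'a::comm_ring_1"
proof -
  have "(1 - fps_const a * fps_X) * F = F - fps_const a * (fps_X * F)" by (simp add: algebra_simps)
  then show ?thesis by simp
qed

text \<open>The contraction is \<open>(1 - b X) / (1 - q^t0 X)\<close>, and the numerator at the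
  pole is the scalar factor. A pure pole is \<open>b = 0\<close>; the trivial contraction is covered
  by \<open>t0 = 0\<close>, \<open>b = 1\<close>, where the factor vanishes.\<close>

lemma bullet_pole:
  assumes "\<gamma> \<in> Plat n" "\<gamma>' \<in> Plat n" "\<forall>\<beta>\<in>Plat n. form n \<gamma> \<beta> \<in> \<int>" "g 0 \<noteq> 0" and t0: "2 * t0 \<in> \<int>"
    and c: "\<And>r. r > 0 \<Longrightarrow> (\<Sum>k=1..n. d (k, r) * u' (k, r)) = (qpow t0 ^ r - b ^ r) / of_nat r"
  shows "bullet n (VO n u d \<gamma> g) (VO n u' d' \<gamma>' g') =
    VO n (scaled t0 u + u') (scaled (- t0) d + d') (\<gamma> + \<gamma>')
      (\<lambda>\<beta>. (1 - b * qpow (- t0)) * qpow (t0 * form n \<gamma> \<beta>) * g (\<gamma>' + \<beta>) * g' \<beta>)"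
proof -
  let ?A = "1 - fps_const (qpow t0) * fps_X" and ?B = "1 - fps_const b * fps_X"
  have A: "is_exp (\<lambda>r. - (qpow t0 ^ r) / of_nat r) ?A" "is_exp (\<lambda>r. - (b ^ r) / of_nat r) ?B"
    by (rule is_exp_linear, simp)+
  have "is_exp (\<lambda>r. qpow t0 ^ r / of_nat r) (inverse ?A)"
    by (rule is_exp_inverse[OF A(1)]) simp
  from is_exp_mult[OF A(2) this, of "\<lambda>r. \<Sum>k=1..n. d (k, r) * u' (k, r)"]
  have C: "is_exp (\<lambda>r. \<Sum>k=1..n. d (k, r) * u' (k, r)) (?B * inverse ?A)"
    by (simp add: c diff_divide_distrib del: One_nat_def)
  have "?A * (?B * inverse ?A) = ?B * (?A * inverse ?A)" by (simp only: mult_ac)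
  also have "?A * inverse ?A = 1" by (rule inverse_mult_eq_1') simp
  finally have AB: "?A * (?B * inverse ?A) = ?B" by simp
  have R: "fps_nth ?B m = fps_nth (?B * inverse ?A) m - (if m = 0 then 0 else qpow t0 * fps_nth (?B * inverse ?A) (m - 1))" for m
    using fps_nth_linear_mult[of "qpow t0" "?B * inverse ?A" m] unfolding AB .
  have K: "\<forall>m>1. fps_nth ?B m = 0" by auto
  have "(\<Sum>k\<le>1. fps_nth ?B k * qpow (- t0) ^ k) = 1 - b * qpow (- t0)" by simp
  then show ?thesis
    using bullet_VO[where d = d and u' = u' and g = g and ?t0.0 = t0 and C = "?B * inverse ?A" and R = "fps_nth ?B" and K = 1,
        OF assms(1-4) t0 C R K] by simp
qed

text \<open>A contraction without pole is multiplied by \<open>1 - X\<close> to fit the general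
  formula at \<open>t0 = 0\<close>; the artificial factor vanishes at 1 and with it the
  product.\<close>

lemma bullet_regular:
  assumes "\<gamma> \<in> Plat n" "\<gamma>' \<in> Plat n" "\<forall>\<beta>\<in>Plat n. form n \<gamma> \<beta> \<in> \<int>" "g 0 \<noteq> 0"
    and c: "\<And>r. r > 0 \<Longrightarrow> (\<Sum>k=1..n. d (k, r) * u' (k, r)) = - (b ^ r) / of_nat r"
  shows "bullet n (VO n u d \<gamma> g) (VO n u' d' \<gamma>' g') = 0"
proof -
  let ?B = "1 - fps_const b * fps_X" and ?A = "1 - fps_const 1 * fps_X :: scal fps"
  have C: "is_exp (\<lambda>r. \<Sum>k=1..n. d (k, r) * u' (k, r)) ?B"
    by (rule is_exp_linear) (simp add: c del: One_nat_def)
  have R: "fps_nth (?A * ?B) m = fps_nth ?B m - (if m = 0 then 0 else qpow 0 * fps_nth ?B (m - 1))" for m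
    unfolding fps_nth_linear_mult by simp
  have K: "\<forall>m>2. fps_nth (?A * ?B) m = 0" unfolding fps_nth_linear_mult by auto
  have "{..2::nat} = {0, 1, 2}" by auto
  then have "(\<Sum>k\<le>2. fps_nth (?A * ?B) k) = 0" unfolding fps_nth_linear_mult by simp
  moreover have t: "2 * (0::rat) \<in> \<int>" by simp
  ultimately show ?thesis
    using bullet_VO[where d = d and u' = u' and g = g and ?t0.0 = 0 and C = ?B and R = "fps_nth (?A * ?B)" and K = 2,
        OF assms(1-4) t C R K] by (simp add: VO_0)
qed

section \<open>The action of the generators on states\<close>

lemma VS_0: "VS n i S w 0 = 0"
  by (simp add: VS_def VO_0)

lemma qpow_half_power: "qpow (of_nat r / 2) = qpow (1 / 2) ^ r"
  using qpow_of_nat_mult[of "1 / 2" r] by simp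

lemma Ints_halves: "2 * (of_int a + 1 / 2 :: rat) \<in> \<int>" "2 * (of_int a - 3 / 2 :: rat) \<in> \<int>"
  "2 * (- 3 / 2 :: rat) \<in> \<int>" "2 * (1 / 2 :: rat) \<in> \<int>"
  by (simp_all add: distrib_left right_diff_distrib)

text \<open>The annihilating parts of \<open>x_j^+\<close> and \<open>x_j^-\<close> are inverse to
  each other up to a rescaling of \<open>z\<close> by \<open>q\<close>, so contractions of
  \<open>x_j^+\<close> need no induction of their own.\<close>

lemma xd_plus: "r > 0 \<Longrightarrow> xd 1 j (k, r) = - (qpow (- 1) ^ r * xd (- 1) j (k, r))"
proof -
  have "qpow (- 1) ^ r = inverse (qpow (1 / 2) ^ r * qpow (1 / 2) ^ r)"
    using qpow_add[of "1 / 2" "1 / 2"] by (simp add: qpow_minus power_mult_distrib power_inverse)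
  moreover have "qpow (- of_nat r / 2) = inverse (qpow (1 / 2) ^ r)"
    by (simp add: qpow_minus qpow_half_power)
  ultimately show ?thesis by (simp add: xd_def qpow_half_power)
qed

text \<open>By \<open>[r] (q - 1/q) = q^r - q^(-r)\<close> the exponent of \<open>\<psi>_j\<close>
  is a difference of two rescaled copies of that of \<open>x_j^-\<close>. Its contraction with a
  state of nonzero pairing therefore has one pole and one zero, with exponents 2 apart.\<close>

lemma psid_eq: "r > 0 \<Longrightarrow> psid j (k, r) = (qpow (1 / 2) ^ r - qpow (- 3 / 2) ^ r) * xd (- 1) j (k, r)"
proof -
  assume r: "r > 0"
  define y where "y = qpow (1 / 2) ^ r"
  have y: "y \<noteq> 0" by (simp add: y_def)
  have 3: "qpow (- 3 / 2) ^ r = inverse (y * y * y)"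
  proof -
    have "qpow (3 / 2) = qpow (1 / 2) * qpow (1 / 2) * qpow (1 / 2)"
      using qpow_add[of "1 / 2" 1] qpow_add[of "1 / 2" "1 / 2"] by simp
    then show ?thesis using qpow_minus[of "3 / 2"] by (simp add: y_def power_mult_distrib power_inverse)
  qed
  have q: "qpow (of_nat r) = y * y" by (simp add: y_def qpow_half_sq flip: qpow_half_power)
  have "qint (int r) * (qpow 1 - qpow (- 1)) = y * y - inverse (y * y)"
    using qint_eq[of "int r"] by (simp add: q qpow_minus)
  then have "qpow 1 - qpow (- 1) = (y * y - inverse (y * y)) / qint (int r)"
    using qint_neq_0'[OF r] by (simp add: field_simps)
  also have "\<dots> = (y - inverse (y * y * y)) * (y / qint (int r))"
  proof -
    have "(y - inverse (y * y * y)) * y = y * y - inverse (y * y)" using y by (simp add: field_simps)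
    then show ?thesis by simp
  qed
  finally have D: "qpow 1 - qpow (- 1) = (y - inverse (y * y * y)) * (y / qint (int r))" .
  have "qpow (- of_int (- 1) * of_nat r / 2) = y" using qpow_half_power[of r] by (simp add: y_def)
  then show ?thesis unfolding psid_def xd_def snd_conv 3 D y_def[symmetric] by simp
qed

lemma form_pm_simple_root:
  assumes "j \<in> {1..n}"
  shows "\<forall>\<beta>\<in>Plat n. form n (simple_root n j) \<beta> \<in> \<int>" "\<forall>\<beta>\<in>Plat n. form n (- simple_root n j) \<beta> \<in> \<int>"
  using assms by (auto simp: form_simple_root_left form_uminus_left)

lemma bullet_x_minus:
  assumes S: "S \<in> states n i" and i: "i \<in> {1..n}" and j: "j \<in> {1..n}" "j \<in> S" "Suc j \<notin> S"
  shows "bullet n (x_op n (- 1) j) (VS n i S w \<kappa>)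
    = VS n i (move S j) w (\<kappa> * eps n (- simple_root n j) (swt n S))"
proof -
  let ?\<alpha> = "simple_root n j" and ?h = "ht i S j"
  have j1: "j \<ge> 1" using j by simp
  have p: "pairing S j = 1" using j by (simp add: pairing_def)
  have c: "(\<Sum>k=1..n. xd (- 1) j (k, r) * su n i S (k, r)) = (qpow (of_int ?h) ^ r - 0 ^ r) / of_nat r" if "r > 0" for r
    using contraction_state[OF S i j(1) that] that by (simp add: p)
  have "bullet n (x_op n (- 1) j) (VS n i S w \<kappa>) =
     VO n (scaled (of_int ?h) (xu (- 1) j) + su n i S) (scaled (- of_int ?h) (xd (- 1) j) + (sd n i S + pd w)) (- ?\<alpha> + swt n S)
      (\<lambda>\<beta>. (1 - 0 * qpow (- of_int ?h)) * qpow (of_int ?h * form n (- ?\<alpha>) \<beta>) * eps n (- ?\<alpha>) (swt n S + \<beta>) * (\<kappa> * sg n i S w \<beta>))"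
    unfolding x_op_VO(2)[OF j(1)] VS_def
    by (rule bullet_pole) (simp_all add: Plat_uminus form_pm_simple_root[OF j(1)] c del: One_nat_def)
  also have "\<dots> = VS n i (move S j) w (\<kappa> * eps n (- ?\<alpha>) (swt n S))"
    unfolding VS_def swt_move[OF j(2,3) j1]
    by (rule VO_cong)
       (simp_all add: su_move[OF S j(2,3) j1] sd_move[OF S j(2,3,1)] sg_move[OF S j(2,3,1)] eps_add_right
         form_uminus_left form_simple_root_left[OF j(1)] del: of_int_mult)
  finally show ?thesis .
qed

lemma bullet_x_minus_zero:
  assumes S: "S \<in> states n i" and i: "i \<in> {1..n}" and j: "j \<in> {1..n}" "\<not> (j \<in> S \<and> Suc j \<notin> S)"
  shows "bullet n (x_op n (- 1) j) (VS n i S w \<kappa>) = 0"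
proof -
  have "pairing S j = 0 \<or> pairing S j = - 1" using j by (auto simp: pairing_def)
  then show ?thesis
  proof
    assume "pairing S j = 0"
    \<comment> \<open>The trivial contraction, written with a zero and a pole that cancel at
      1.\<close>
    then have c: "(\<Sum>k=1..n. xd (- 1) j (k, r) * su n i S (k, r)) = (qpow 0 ^ r - 1 ^ r) / of_nat r" if "r > 0" for r
      using contraction_state[OF S i j(1) that] by simp
    show ?thesis
      unfolding x_op_VO(2)[OF j(1)] VS_def
      by (subst bullet_pole[where ?t0.0 = 0 and b = 1])
         (simp_all add: Plat_uminus form_pm_simple_root[OF j(1)] c VO_0 del: One_nat_def)
  next
    assume "pairing S j = - 1"
    then have c: "(\<Sum>k=1..n. xd (- 1) j (k, r) * su n i S (k, r)) = - (qpow (of_int (ht i S j)) ^ r) / of_nat r" if "r > 0" for r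
      using contraction_state[OF S i j(1) that] by simp
    show ?thesis
      unfolding x_op_VO(2)[OF j(1)] VS_def
      by (rule bullet_regular) (simp_all add: Plat_uminus form_pm_simple_root[OF j(1)] c del: One_nat_def)
  qed
qed

lemma contraction_state_plus:
  assumes "S \<in> states n i" "i \<in> {1..n}" "j \<in> {1..n}" "r > 0"
  shows "(\<Sum>k=1..n. xd 1 j (k, r) * su n i S (k, r)) = - of_int (pairing S j) * qpow (of_int (ht i S j) - 1) ^ r / of_nat r"
proof -
  have "(\<Sum>k=1..n. xd 1 j (k, r) * su n i S (k, r)) = - (qpow (- 1) ^ r) * (\<Sum>k=1..n. xd (- 1) j (k, r) * su n i S (k, r))"
    unfolding sum_distrib_left by (intro sum.cong refl) (simp add: xd_plus assms(4))
  also have "\<dots> = - of_int (pairing S j) * (qpow (of_int (ht i S j)) * qpow (- 1)) ^ r / of_nat r"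
    unfolding contraction_state[OF assms] by (simp add: power_mult_distrib)
  also have "qpow (of_int (ht i S j)) * qpow (- 1) = qpow (of_int (ht i S j) - 1)"
    by (simp flip: qpow_add)
  finally show ?thesis .
qed

lemma sg_Cons: "sg n i S ((j, t) # w) \<beta> = sg n i S w \<beta> * qpow (of_int (lookup \<beta> j))"
  by (simp add: sg_def mult_ac)

lemma pd_Cons: "pd ((j, t) # w) x = scaled (- t) (psid j) x + pd w x"
  by (simp add: pd_def)

text \<open>Since \<open>x\<^sub>j\<^sup>+(zq\<^bsup>h+1\<^esup>)\<close> and \<open>x\<^sub>j\<^sup>-(zq\<^sup>h)\<close> have the normally ordered product \<open>\<psi>\<^sub>j(zq\<^bsup>h+1/2\<^esup>)\<close>, the action of
  \<open>x\<^sub>j\<^sup>+\<close> undoes the one of \<open>x\<^sub>j\<^sup>-\<close> at the cost of a factor \<open>\<psi>\<^sub>j\<close>.\<close>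

lemma bullet_x_plus:
  assumes T: "T \<in> states n i" and i: "i \<in> {1..n}" and j: "j \<in> {1..n}" "j \<in> T" "Suc j \<notin> T"
  shows "bullet n (x_op n 1 j) (VS n i (move T j) w \<kappa>)
    = VS n i T ((j, of_int (ht i T j) + 1 / 2) # w) (\<kappa> * eps n (simple_root n j) (swt n (move T j)))"
proof -
  let ?\<alpha> = "simple_root n j" and ?h = "ht i T j" and ?S = "move T j"
  let ?t = "of_int (?h + 1) :: rat"
  have j1: "j \<ge> 1" using j by simp
  have S: "?S \<in> states n i" using T j by (intro states_move) auto
  have p: "pairing ?S j = - 1" using j by (auto simp: pairing_def move_def)
  \<comment> \<open>The move has raised the height by 2, and the rescaling in \<open>xd_plus\<close>
    lowers it by 1: the pole lies one above the removed letter.\<close>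
  have ht: "of_int (ht i ?S j) - 1 = ?t" using ht_move[OF j(2,3) j1, of i j] by simp
  have c: "(\<Sum>k=1..n. xd 1 j (k, r) * su n i ?S (k, r)) = (qpow ?t ^ r - 0 ^ r) / of_nat r" if "r > 0" for r
    using contraction_state_plus[OF S i j(1) that] that unfolding p ht by simp
  have "bullet n (x_op n 1 j) (VS n i ?S w \<kappa>) =
     VO n (scaled ?t (xu 1 j) + su n i ?S) (scaled (- ?t) (xd 1 j) + (sd n i ?S + pd w)) (?\<alpha> + swt n ?S)
      (\<lambda>\<beta>. (1 - 0 * qpow (- ?t)) * qpow (?t * form n ?\<alpha> \<beta>) * eps n ?\<alpha> (swt n ?S + \<beta>) * (\<kappa> * sg n i ?S w \<beta>))"
    unfolding x_op_VO(1)[OF j(1)] VS_def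
    by (rule bullet_pole) (rule Plat_simple_root Plat_swt form_pm_simple_root(1)[OF j(1)] eps_nonzero Ints_2_of_int(1) c | assumption)+
  also have "?\<alpha> + swt n ?S = swt n T" by (simp add: swt_move[OF j(2,3) j1])
  also have "VO n (scaled ?t (xu 1 j) + su n i ?S) (scaled (- ?t) (xd 1 j) + (sd n i ?S + pd w)) (swt n T)
      (\<lambda>\<beta>. (1 - 0 * qpow (- ?t)) * qpow (?t * form n ?\<alpha> \<beta>) * eps n ?\<alpha> (swt n ?S + \<beta>) * (\<kappa> * sg n i ?S w \<beta>))
    = VS n i T ((j, of_int ?h + 1 / 2) # w) (\<kappa> * eps n ?\<alpha> (swt n ?S))"
    unfolding VS_def
  proof (rule VO_cong)
    fix k r assume kr: "k \<in> {1..n}" "(r::nat) > 0"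
    define y where "y = qpow (1 / 2) ^ r"
    define H where "H = qpow (of_int ?h) ^ r"
    have y: "y \<noteq> 0" and H: "H \<noteq> 0" by (simp_all add: y_def H_def)
    have qt: "qpow ?t ^ r = H * (y * y)"
    proof -
      have "qpow ?t = qpow (of_int ?h) * (qpow (1 / 2) * qpow (1 / 2))"
        using qpow_add[of "1 / 2" "1 / 2"] by (simp add: qpow_add)
      then show ?thesis by (simp add: y_def H_def power_mult_distrib)
    qed
    have qm: "qpow (- of_nat r / 2) = inverse y" "qpow (of_nat r / 2) = y"
      by (simp_all add: qpow_minus qpow_half_power y_def)
    \<comment> \<open>The creating parts of \<open>x_j^+(zq^(h+1))\<close> and of the letter
      \<open>x_j^-(zq^h)\<close> cancel.\<close>
    have "scaled ?t (xu 1 j) (k, r) + scaled (of_int ?h) (xu (- 1) j) (k, r) = 0"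
    proof -
      have "xu 1 j (k, r) = (if k = j then inverse y / qint (int r) else 0)"
        "xu (- 1) j (k, r) = (if k = j then - y / qint (int r) else 0)"
        using qm by (simp_all add: xu_def)
      then show ?thesis unfolding scaled_def snd_conv qt H_def[symmetric] using y by (simp add: field_simps)
    qed
    then show "(scaled ?t (xu 1 j) + su n i ?S) (k, r) = su n i T (k, r)"
      by (simp add: su_move[OF T j(2,3) j1] algebra_simps)
    have qt': "qpow (- ?t) ^ r = inverse (H * (y * y))" "qpow (- of_int ?h) ^ r = inverse H"
      by (simp_all only: qpow_minus[OF Ints_2_of_int(1)] power_inverse qt H_def)
    have q3: "qpow (- (of_int ?h + 1 / 2)) ^ r = inverse (H * y)"
      using qpow_minus[of "of_int ?h + 1 / 2"] Ints_halves(1)[of ?h]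
      by (simp add: qpow_add H_def y_def power_inverse power_mult_distrib)
    have m3: "qpow (- 3 / 2) ^ r = inverse (y * y * y)"
    proof -
      have "qpow (3 / 2) = qpow (1 / 2) * qpow (1 / 2) * qpow (1 / 2)"
        using qpow_add[of "1 / 2" 1] qpow_add[of "1 / 2" "1 / 2"] by simp
      then show ?thesis using qpow_minus[of "3 / 2"] by (simp add: y_def power_mult_distrib power_inverse)
    qed
    have m1: "qpow (- 1) ^ r = inverse (y * y)"
      using qpow_add[of "1 / 2" "1 / 2"] qpow_minus[of 1] by (simp add: y_def power_mult_distrib power_inverse)
    \<comment> \<open>The annihilating parts do not cancel; what is left is that of
      \<open>\<psi>_j\<close> at \<open>zq^(h+1/2)\<close>.\<close>
    have "scaled (- ?t) (xd 1 j) (k, r) + scaled (- of_int ?h) (xd (- 1) j) (k, r) = scaled (- (of_int ?h + 1 / 2)) (psid j) (k, r)"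
    proof -
      have "inverse (H * (y * y)) * - (inverse (y * y) * X) + inverse H * X = inverse (H * y) * ((y - inverse (y * y * y)) * X)" for X
        using y H by (simp add: field_simps)
      then show ?thesis
        unfolding scaled_def snd_conv qt' q3 psid_eq[OF kr(2)] xd_plus[OF kr(2)] m1 m3 y_def[symmetric] .
    qed
    then show "(scaled (- ?t) (xd 1 j) + (sd n i ?S + pd w)) (k, r) = (sd n i T + pd ((j, of_int ?h + 1 / 2) # w)) (k, r)"
      by (simp add: sd_move[OF T j(2,3,1)] pd_Cons algebra_simps)
  next
    fix \<beta> assume "\<beta> \<in> Plat n"
    define b where "b = lookup \<beta> j"
    \<comment> \<open>Likewise the powers of \<open>q\<close> in the characters leave exactly the
      factor \<open>K_j\<close> of \<open>\<psi>_j\<close>.\<close>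
    have q: "qpow (of_int ((?h + 1) * b)) * qpow (of_int (- ?h * b)) = qpow (of_int b)"
      by (subst qpow_add[symmetric], simp) (simp add: algebra_simps)
    have e: "eps n ?\<alpha> \<beta> * eps n (- ?\<alpha>) \<beta> = 1" by (simp add: eps_uminus_left)
    have "(1 - 0 * qpow (- ?t)) * qpow (?t * form n ?\<alpha> \<beta>) * eps n ?\<alpha> (swt n ?S + \<beta>) * (\<kappa> * sg n i ?S w \<beta>)
       = \<kappa> * eps n ?\<alpha> (swt n ?S) * (eps n ?\<alpha> \<beta> * eps n (- ?\<alpha>) \<beta>) * (qpow (of_int ((?h + 1) * b)) * qpow (of_int (- ?h * b))) * sg n i T w \<beta>"
      by (simp add: sg_move[OF T j(2,3,1)] eps_add_right form_simple_root_left[OF j(1)] b_def mult_ac)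
    also have "\<dots> = \<kappa> * eps n ?\<alpha> (swt n ?S) * sg n i T ((j, of_int ?h + 1 / 2) # w) \<beta>"
      unfolding q e by (simp add: sg_Cons b_def mult_ac)
    finally show "(1 - 0 * qpow (- ?t)) * qpow (?t * form n ?\<alpha> \<beta>) * eps n ?\<alpha> (swt n ?S + \<beta>) * (\<kappa> * sg n i ?S w \<beta>)
       = \<kappa> * eps n ?\<alpha> (swt n ?S) * sg n i T ((j, of_int ?h + 1 / 2) # w) \<beta>" .
  qed
  finally show ?thesis .
qed

lemma bullet_x_plus_zero:
  assumes S: "S \<in> states n i" and i: "i \<in> {1..n}" and j: "j \<in> {1..n}" "\<not> (j \<notin> S \<and> Suc j \<in> S)"
  shows "bullet n (x_op n 1 j) (VS n i S w \<kappa>) = 0"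
proof -
  have "pairing S j = 0 \<or> pairing S j = 1" using j by (auto simp: pairing_def)
  then show ?thesis
  proof
    assume "pairing S j = 0"
    then have c: "(\<Sum>k=1..n. xd 1 j (k, r) * su n i S (k, r)) = (qpow 0 ^ r - 1 ^ r) / of_nat r" if "r > 0" for r
      using contraction_state_plus[OF S i j(1) that] by simp
    show ?thesis
      unfolding x_op_VO(1)[OF j(1)] VS_def
      by (subst bullet_pole[where ?t0.0 = 0 and b = 1])
         (simp_all add: form_pm_simple_root[OF j(1)] c VO_0 del: One_nat_def)
  next
    assume "pairing S j = 1"
    then have c: "(\<Sum>k=1..n. xd 1 j (k, r) * su n i S (k, r)) = - (qpow (of_int (ht i S j) - 1) ^ r) / of_nat r" if "r > 0" for r
      using contraction_state_plus[OF S i j(1) that] by simp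
    show ?thesis
      unfolding x_op_VO(1)[OF j(1)] VS_def
      by (rule bullet_regular) (simp_all add: form_pm_simple_root[OF j(1)] c del: One_nat_def)
  qed
qed

lemma contraction_state_psi:
  assumes "S \<in> states n i" "i \<in> {1..n}" "j \<in> {1..n}" "r > 0"
  shows "(\<Sum>k=1..n. psid j (k, r) * su n i S (k, r)) = of_int (pairing S j) *
    (qpow (of_int (ht i S j) + 1 / 2) ^ r - qpow (of_int (ht i S j) - 3 / 2) ^ r) / of_nat r"
proof -
  let ?h = "of_int (ht i S j) :: rat"
  have "(\<Sum>k=1..n. psid j (k, r) * su n i S (k, r)) = (qpow (1 / 2) ^ r - qpow (- 3 / 2) ^ r) * (\<Sum>k=1..n. xd (- 1) j (k, r) * su n i S (k, r))"
    unfolding sum_distrib_left by (intro sum.cong refl) (simp add: psid_eq assms(4))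
  also have "\<dots> = of_int (pairing S j) * ((qpow ?h * qpow (1 / 2)) ^ r - (qpow ?h * qpow (- 3 / 2)) ^ r) / of_nat r"
    unfolding contraction_state[OF assms] by (simp add: power_mult_distrib algebra_simps diff_divide_distrib)
  also have "qpow ?h * qpow (1 / 2) = qpow (?h + 1 / 2)"
    by (simp flip: qpow_add)
  also have "qpow ?h * qpow (- 3 / 2) = qpow (?h - 3 / 2)"
    by (simp flip: qpow_add)
  finally show ?thesis .
qed

lemma bullet_psi_pole:
  assumes j: "j \<in> {1..n}" and t: "2 * t \<in> \<int>"
    and c: "\<And>r. r > 0 \<Longrightarrow> (\<Sum>k=1..n. psid j (k, r) * su n i S (k, r)) = (qpow t ^ r - b ^ r) / of_nat r"
  shows "bullet n (psi_op n j) (VS n i S w \<kappa>)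
    = VS n i S ((j, t) # w) (\<kappa> * (1 - b * qpow (- t)) * qpow (of_int (pairing S j)))"
proof -
  have "bullet n (psi_op n j) (VS n i S w \<kappa>) =
     VO n (scaled t (\<lambda>_. 0) + su n i S) (scaled (- t) (psid j) + (sd n i S + pd w)) (0 + swt n S)
      (\<lambda>\<beta>. (1 - b * qpow (- t)) * qpow (t * form n 0 \<beta>) * qpow (form n (simple_root n j) (swt n S + \<beta>)) * (\<kappa> * sg n i S w \<beta>))"
    unfolding psi_op_VO VS_def
    by (rule bullet_pole) (use t in \<open>simp_all add: c del: One_nat_def\<close>)
  also have "\<dots> = VS n i S ((j, t) # w) (\<kappa> * (1 - b * qpow (- t)) * qpow (of_int (pairing S j)))"
    unfolding VS_def add_0_left
    by (rule VO_cong)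
       (use j in \<open>simp_all add: scaled_def pd_Cons sg_Cons form_simple_root_left lookup_add lookup_swt qpow_add mult_ac\<close>)
  finally show ?thesis .
qed

text \<open>Without annihilating part there is no contraction, hence no pole.\<close>

lemma bullet_phi:
  assumes "j \<in> {1..n}"
  shows "bullet n (phi_op n j) (VS n i S w \<kappa>) = 0"
  unfolding phi_op_VO[OF assms] VS_def
  by (subst bullet_pole[where ?t0.0 = 0 and b = 1]) (simp_all add: VO_0)

definition psi_letters :: "nat \<Rightarrow> (nat \<times> rat) list \<Rightarrow> bool" where
  "psi_letters n w \<longleftrightarrow> (\<forall>(j, t)\<in>set w. j \<in> {1..n} \<and> 2 * t \<in> \<int>)"

lemma bullet_gens:
  assumes S: "S \<in> states n i" and i: "i \<in> {1..n}" and w: "psi_letters n w" and a: "a \<in> gens n"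
  shows "\<exists>S' w' \<kappa>'. S' \<in> states n i \<and> psi_letters n w' \<and> bullet n a (VS n i S w \<kappa>) = VS n i S' w' \<kappa>'"
proof -
  have zero: ?thesis if "bullet n a (VS n i S w \<kappa>) = 0"
    using that S w by (metis VS_0)
  obtain j where j: "j \<in> {1..n}" and "a = x_op n 1 j \<or> a = x_op n (- 1) j \<or> a = psi_op n j \<or> a = phi_op n j"
    using a by (auto simp: gens_def)
  then consider "a = x_op n 1 j" | "a = x_op n (- 1) j" | "a = psi_op n j" | "a = phi_op n j" by blast
  then show ?thesis
  proof cases
    case 1
    show ?thesis
    proof (cases "j \<notin> S \<and> Suc j \<in> S")
      case True
      then obtain T where T: "T \<in> states n i" "j \<in> T" "Suc j \<notin> T" "S = move T j"
        using states_unmove[OF S j] by metis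
      have "psi_letters n ((j, of_int (ht i T j) + 1 / 2) # w)"
        using w j Ints_halves(1) by (simp add: psi_letters_def)
      then show ?thesis unfolding 1 T(4) bullet_x_plus[OF T(1) i j T(2,3)] using T(1) by blast
    next
      case False
      then show ?thesis using bullet_x_plus_zero[OF S i j] zero 1 by blast
    qed
  next
    case 2
    show ?thesis
    proof (cases "j \<in> S \<and> Suc j \<notin> S")
      case True
      then show ?thesis using bullet_x_minus[OF S i j] states_move[OF S j] w unfolding 2 by blast
    next
      case False
      then show ?thesis using bullet_x_minus_zero[OF S i j] zero 2 by blast
    qed
  next
    case 3
    let ?h = "of_int (ht i S j) :: rat"
    have "pairing S j = 0 \<or> pairing S j = 1 \<or> pairing S j = - 1" by (auto simp: pairing_def)
    \<comment> \<open>Pairing 1 or -1 decides which of the two points \<open>h + 1/2\<close>,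
      \<open>h - 3/2\<close> is the pole and which the zero; for pairing 0 both are placed at
      1.\<close>
    then have "\<exists>t b. 2 * t \<in> \<int> \<and> (\<forall>r>0. (\<Sum>k=1..n. psid j (k, r) * su n i S (k, r)) = (qpow t ^ r - b ^ r) / of_nat r)"
    proof (elim disjE)
      assume "pairing S j = 0"
      then show ?thesis using contraction_state_psi[OF S i j] by (intro exI[of _ 0] exI[of _ 1]) simp
    next
      assume "pairing S j = 1"
      then show ?thesis using contraction_state_psi[OF S i j] Ints_halves(1)[of "ht i S j"]
        by (intro exI[of _ "?h + 1 / 2"] exI[of _ "qpow (?h - 3 / 2)"]) simp
    next
      assume "pairing S j = - 1"
      then show ?thesis using contraction_state_psi[OF S i j] Ints_halves(2)[of "ht i S j"]
        by (intro exI[of _ "?h - 3 / 2"] exI[of _ "qpow (?h + 1 / 2)"]) simp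
    qed
    then obtain t b where t: "2 * t \<in> \<int>" and
      c: "\<And>r. r > 0 \<Longrightarrow> (\<Sum>k=1..n. psid j (k, r) * su n i S (k, r)) = (qpow t ^ r - b ^ r) / of_nat r"
      by blast
    have "psi_letters n ((j, t) # w)" using w j t by (simp add: psi_letters_def)
    then show ?thesis using bullet_psi_pole[OF j t c] S unfolding 3 by blast
  next
    case 4
    then show ?thesis using bullet_phi[OF j] zero by blast
  qed
qed

lemma foldr_bullet_gens:
  assumes i: "i \<in> {1..n}" and "set as \<subseteq> gens n"
  shows "\<exists>S w \<kappa>. S \<in> states n i \<and> psi_letters n w \<and> foldr (bullet n) as (Y_op n i) = VS n i S w \<kappa>"
  using assms(2)
proof (induction as)
  case Nil
  have "psi_letters n []" by (simp add: psi_letters_def)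
  then show ?case using states_initial[OF i] Y_op_state[OF i] by auto
next
  case (Cons a as)
  then obtain S w \<kappa> where "S \<in> states n i" "psi_letters n w" "foldr (bullet n) as (Y_op n i) = VS n i S w \<kappa>"
    by auto
  then show ?case using bullet_gens[OF _ i, of S w a \<kappa>] Cons.prems by auto
qed

section \<open>The set \<open>\<B>\<^sub>i\<^sup>-\<close>\<close>

text \<open>The first simple root is not among the generators of the twisted group algebra: it
  equals \<open>- 2 \<alpha>_2 - ... - n \<alpha>_n + (n + 1) \<lambda>_n\<close>.\<close>

lemma coord_simple_root_1:
  assumes "k \<in> {2..Suc n}"
  shows "coord n (simple_root n 1) k = (if k = Suc n then int k else - int k)"
proof -
  have s: "(\<Sum>l\<in>I. int (k - l) * lookup (simple_root n 1) l) = int k"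
    if "I = {1..<k}" for I
  proof -
    have "(\<Sum>l\<in>I. int (k - l) * lookup (simple_root n 1) l)
      = (\<Sum>l\<in>{1..<k}. (if l = 1 then 2 * (int k - 1) else 0) + (if l = 2 then - (int k - 2) else 0))"
      unfolding that using assms
      by (intro sum.cong refl) (auto simp: lookup_simple_root cartan_def of_nat_diff)
    also have "\<dots> = int k" using assms by (simp add: sum.distrib)
    finally show ?thesis .
  qed
  show ?thesis
  proof (cases "k = Suc n")
    case True
    then show ?thesis using s[of "{1..n}"] by (simp add: coord_def atLeastLessThanSuc_atLeastAtMost)
  next
    case False
    then show ?thesis using s[of "{1..<k}"] by (simp add: coord_def)
  qed
qed

lemma coord_simple_root:
  assumes "j \<in> {2..n}" "k \<in> {2..Suc n}"
  shows "coord n (simple_root n j) k = (if k = j then 1 else 0)"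
  using coord_gen[of n j k] assms by (auto simp: lattice_gen_def split: if_splits)

text \<open>The two cocycle exponents are \<open>j + 1\<close> and \<open>j - 1\<close>, which have
  the same parity.\<close>

lemma eps_simple_root_commute_1:
  assumes j: "j \<in> {3..n}"
  shows "eps n (simple_root n 1) (simple_root n j) = eps n (simple_root n j) (simple_root n 1)"
proof -
  let ?c = "coord n (simple_root n 1)"
  have "(\<Sum>k=2..Suc n. \<Sum>l=2..<k. gcomm n k l * ?c k * coord n (simple_root n j) l)
     = (\<Sum>k=2..Suc n. if k = Suc j then gcomm n k j * ?c k else 0)"
  proof (rule sum.cong[OF refl])
    fix k assume k: "k \<in> {2..Suc n}"
    have "(\<Sum>l=2..<k. gcomm n k l * ?c k * coord n (simple_root n j) l) = (\<Sum>l=2..<k. if l = j then gcomm n k j * ?c k else 0)"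
      using k j by (intro sum.cong refl) (auto simp: coord_simple_root)
    also have "\<dots> = (if j < k then gcomm n k j * ?c k else 0)" using j by auto
    \<comment> \<open>Among the generators to be moved past number \<open>j\<close> only its
      successor anticommutes with it. For \<open>j < n\<close> both factors of this term are
      negative, for \<open>j = n\<close>, where the successor is \<open>\<lambda>_n\<close>, both
      are positive.\<close>
    also have "\<dots> = (if k = Suc j then gcomm n k j * ?c k else 0)"
      using k j by (auto simp: gcomm_def cartan_def)
    finally show "(\<Sum>l=2..<k. gcomm n k l * ?c k * coord n (simple_root n j) l) = (if k = Suc j then gcomm n k j * ?c k else 0)" .
  qed
  also have "\<dots> = gcomm n (Suc j) j * ?c (Suc j)" using j by simp
  also have "\<dots> = int j + 1"
    using j coord_simple_root_1[of "Suc j" n] by (auto simp: gcomm_def cartan_def)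
  finally have 1: "eps n (simple_root n 1) (simple_root n j) = (- 1) powi (int j + 1)"
    by (simp add: eps_def)
  have "(\<Sum>k=2..Suc n. \<Sum>l=2..<k. gcomm n k l * coord n (simple_root n j) k * ?c l)
     = (\<Sum>k=2..Suc n. if k = j then (\<Sum>l=2..<j. gcomm n j l * ?c l) else 0)"
    using j by (intro sum.cong refl) (auto simp: coord_simple_root)
  also have "\<dots> = (\<Sum>l=2..<j. gcomm n j l * ?c l)" using j by simp
  \<comment> \<open>Since \<open>j \<ge> 3\<close>, the predecessor \<open>j - 1\<close> is itself
    the number of a generator.\<close>
  also have "\<dots> = (\<Sum>l=2..<j. if l = j - 1 then int j - 1 else 0)"
    using j by (intro sum.cong refl) (auto simp: gcomm_def cartan_def coord_simple_root_1[unfolded One_nat_def])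
  also have "\<dots> = int j - 1" using j by auto
  finally have 2: "eps n (simple_root n j) (simple_root n 1) = (- 1) powi (int j - 1)"
    by (simp add: eps_def)
  have "(- 1 :: scal) powi (int j + 1) = (- 1) powi (int j - 1) * (- 1) powi 2"
  proof -
    have e: "int j + 1 = (int j - 1) + 2" by simp
    show ?thesis unfolding e by (rule power_int_add) simp
  qed
  then show ?thesis unfolding 1 2 by simp
qed

lemma eps_simple_root_commute:
  assumes "j \<in> {1..n}" "k \<in> {1..n}" "j \<noteq> k" "j \<noteq> Suc k" "k \<noteq> Suc j"
  shows "eps n (simple_root n j) (simple_root n k) = eps n (simple_root n k) (simple_root n j)"
proof -
  have *: ?thesis if "j \<ge> 2" "k \<ge> 2"
  proof -
    have "lattice_gen n j = simple_root n j" "lattice_gen n k = simple_root n k"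
      using assms by (auto simp: lattice_gen_def)
    moreover have "gcomm n j k = 0" "gcomm n k j = 0"
      using assms by (auto simp: gcomm_def cartan_def)
    ultimately show ?thesis using eps_gen[of n j k] eps_gen[of n k j] that assms by auto
  qed
  consider "j = 1" "k \<in> {3..n}" | "k = 1" "j \<in> {3..n}" | "j \<ge> 2" "k \<ge> 2"
    using assms by fastforce
  then show ?thesis
    using eps_simple_root_commute_1[of k n] eps_simple_root_commute_1[of j n] * by cases auto
qed

text \<open>Words with nonzero product, together with the state reached and the cocycle factor
  accumulated on the way. The aim is that this factor depends on the state alone.\<close>

inductive minus_path :: "nat \<Rightarrow> nat \<Rightarrow> nat list \<Rightarrow> nat set \<Rightarrow> scal \<Rightarrow> bool" for n i where
  Nil: "minus_path n i [] {1..i} 1"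
| Cons: "minus_path n i js S \<kappa> \<Longrightarrow> j \<in> {1..n} \<Longrightarrow> j \<in> S \<Longrightarrow> Suc j \<notin> S \<Longrightarrow>
    minus_path n i (j # js) (move S j) (\<kappa> * eps n (- simple_root n j) (swt n S))"

lemma minus_path_props:
  assumes "minus_path n i js S \<kappa>" "i \<in> {1..n}"
  shows "S \<in> states n i \<and> \<kappa> \<noteq> 0 \<and> set js \<subseteq> {1..n} \<and> \<Sum>S = \<Sum>{1..i} + length js \<and>
    foldr (\<lambda>j. bullet n (x_op n (- 1) j)) js (Y_op n i) = VS n i S [] \<kappa>"
  using assms
proof (induction rule: minus_path.induct)
  case Nil
  then show ?case by (simp add: states_initial Y_op_state del: One_nat_def)
next
  case (Cons js S \<kappa> j)
  then have S: "S \<in> states n i" by simp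
  have "finite S" by (rule states_finite[OF S])
  then have "\<Sum>(move S j) = Suc (\<Sum>S)"
    using Cons.hyps(3,4) by (simp add: move_def sum.remove[of S j])
  then show ?case using Cons states_move[OF S Cons.hyps(2-4)] bullet_x_minus[OF S Cons.prems Cons.hyps(2-4)]
    by (auto simp: comp_def)
qed

lemma minus_path_ex: "S \<in> states n i \<Longrightarrow> i \<in> {1..n} \<Longrightarrow> \<exists>js \<kappa>. minus_path n i js S \<kappa>"
  by (induction rule: states_induct) (blast intro: minus_path.intros)+

lemma move_inject:
  assumes "j \<in> S" "Suc j \<notin> S" "j \<in> T" "Suc j \<notin> T" "move S j = move T j"
  shows "S = T"
proof -
  have "U = insert j (move U j - {Suc j})" if "j \<in> U" "Suc j \<notin> U" for U
    using that by (auto simp: move_def)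
  note inv = this
  have "S = insert j (move S j - {Suc j})" using assms(1,2) by (rule inv)
  also have "\<dots> = insert j (move T j - {Suc j})" unfolding assms(5) ..
  also have "\<dots> = T" using assms(3,4) by (rule inv[symmetric])
  finally show ?thesis .
qed

lemma move_commute:
  assumes "j \<noteq> k" "j \<noteq> Suc k" "k \<noteq> Suc j"
  shows "move (move S j) k = move (move S k) j"
  using assms by (auto simp: move_def)

text \<open>Moves at different places \<open>j\<close> and \<open>k\<close> that lead to the same state satisfy \<open>\<bar>j - k\<bar> > 1\<close>, so that
  the operators \<open>x\<^sub>j\<^sup>-\<close> and \<open>x\<^sub>k\<^sup>-\<close> commute.\<close>

lemma minus_path_unique:
  assumes "i \<in> {1..n}"
  shows "minus_path n i js S \<kappa> \<Longrightarrow> minus_path n i js' S \<kappa>' \<Longrightarrow> \<kappa> = \<kappa>'"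
proof (induction "length js" arbitrary: js js' S \<kappa> \<kappa>')
  case 0
  have "length js' = length js"
    using minus_path_props[OF 0(2) assms] minus_path_props[OF 0(3) assms] by simp
  then show ?case using 0 by (auto elim: minus_path.cases)
next
  case (Suc m)
  have len: "length js' = length js"
    using minus_path_props[OF Suc(3) assms] minus_path_props[OF Suc(4) assms] by simp
  obtain j u S1 \<kappa>1 where 1: "js = j # u" "minus_path n i u S1 \<kappa>1" "j \<in> {1..n}" "j \<in> S1" "Suc j \<notin> S1"
      "S = move S1 j" "\<kappa> = \<kappa>1 * eps n (- simple_root n j) (swt n S1)"
    using Suc(3,2) by (cases rule: minus_path.cases) auto
  obtain k u' S2 \<kappa>2 where 2: "js' = k # u'" "minus_path n i u' S2 \<kappa>2" "k \<in> {1..n}" "k \<in> S2" "Suc k \<notin> S2"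
      "S = move S2 k" "\<kappa>' = \<kappa>2 * eps n (- simple_root n k) (swt n S2)"
    using Suc(4,2) len by (cases rule: minus_path.cases) auto
  have S1: "S1 \<in> states n i" using minus_path_props[OF 1(2) assms] by simp
  have lu: "length u = m" "length u' = m" using Suc(2) 1(1) 2(1) len by simp_all
  show ?case
  proof (cases "j = k")
    case True
    then have "S1 = S2" using move_inject[of j S1 S2] 1 2 by auto
    moreover have "\<kappa>1 = \<kappa>2" using Suc.hyps(1)[of u S1 \<kappa>1 u' \<kappa>2] lu 1(2) 2(2) \<open>S1 = S2\<close> by simp
    ultimately show ?thesis using 1(7) 2(7) True by simp
  next
    case False
    \<comment> \<open>Two different last moves with the same result cannot overlap: the last move of
      the second word is visible in \<open>S1\<close> as an element \<open>k + 1\<close> without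
      \<open>k\<close>.\<close>
    have jk: "j \<noteq> Suc k" "k \<noteq> Suc j" "k \<notin> S1" "Suc k \<in> S1"
    proof -
      have m: "x \<in> move U y \<longleftrightarrow> x = Suc y \<or> x \<in> U \<and> x \<noteq> y" for x y U by (auto simp: move_def)
      have e: "x \<in> move S1 j \<longleftrightarrow> x \<in> move S2 k" for x using 1(6) 2(6) by simp
      have a: "k = Suc j \<or> k \<in> S1 \<longleftrightarrow> k = Suc k" using e[of k] False unfolding m by blast
      have b: "Suc k = Suc j \<or> Suc k \<in> S1 \<and> Suc k \<noteq> j" using e[of "Suc k"] unfolding m by blast
      have c: "\<not> (j = Suc k)" using e[of j] False unfolding m by auto
      show "j \<noteq> Suc k" "k \<noteq> Suc j" "k \<notin> S1" "Suc k \<in> S1" using a b c False by auto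
    qed
    \<comment> \<open>The common predecessor closing the diamond: both moves are undone.\<close>
    obtain S0 where S0: "S0 \<in> states n i" "k \<in> S0" "Suc k \<notin> S0" "S1 = move S0 k"
      using states_unmove[OF S1 2(3) jk(3,4)] by metis
    have j0: "j \<in> S0" "Suc j \<notin> S0" using 1(4,5) jk False unfolding S0(4) move_def by auto
    have "move S2 k = move (move S0 j) k"
      using move_commute[OF False jk(1,2), of S0] 1(6) 2(6) S0(4) by simp
    moreover have "k \<in> move S0 j" "Suc k \<notin> move S0 j"
      using S0(2,3) False jk unfolding move_def by auto
    ultimately have S2: "S2 = move S0 j" using move_inject[OF 2(4,5)] by blast
    \<comment> \<open>A path to \<open>S0\<close>, prolonged by either move, can be compared by the
      induction hypothesis with each of the two given words deprived of its last letter; afterwards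
      only the order of two commuting roots differs.\<close>
    obtain v \<kappa>0 where v: "minus_path n i v S0 \<kappa>0" using minus_path_ex[OF S0(1) assms] by blast
    have p1: "minus_path n i (k # v) S1 (\<kappa>0 * eps n (- simple_root n k) (swt n S0))"
      unfolding S0(4) by (rule minus_path.Cons[OF v 2(3) S0(2,3)])
    have p2: "minus_path n i (j # v) S2 (\<kappa>0 * eps n (- simple_root n j) (swt n S0))"
      unfolding S2 by (rule minus_path.Cons[OF v 1(3) j0])
    have k1: "\<kappa>1 = \<kappa>0 * eps n (- simple_root n k) (swt n S0)"
      using Suc.hyps(1)[OF _ 1(2) p1] lu by simp
    have k2: "\<kappa>2 = \<kappa>0 * eps n (- simple_root n j) (swt n S0)"
      using Suc.hyps(1)[OF _ 2(2) p2] lu by simp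
    have w1: "swt n S1 = - simple_root n k + swt n S0"
      unfolding S0(4) by (rule swt_move) (use S0 2(3) in auto)
    have w2: "swt n S2 = - simple_root n j + swt n S0"
      unfolding S2 by (rule swt_move) (use j0 1(3) in auto)
    have em: "eps n \<gamma> (- \<beta>) = inverse (eps n \<gamma> \<beta>)" for \<gamma> \<beta>
    proof -
      have "eps n \<gamma> 0 = 1" by (simp add: eps_def coord_def)
      then have "eps n \<gamma> \<beta> * eps n \<gamma> (- \<beta>) = 1" by (simp flip: eps_add_right)
      then show ?thesis by (simp add: inverse_unique)
    qed
    show ?thesis
      unfolding 1(7) 2(7) k1 k2 w1 w2 eps_add_right eps_uminus_left em
      using eps_simple_root_commute[OF 1(3) 2(3) False jk(1,2)] by (simp add: mult_ac)
  qed
qed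

lemma minus_word:
  assumes i: "i \<in> {1..n}" and "set js \<subseteq> {1..n}"
  shows "foldr (\<lambda>j. bullet n (x_op n (- 1) j)) js (Y_op n i) = 0 \<or> (\<exists>S \<kappa>. minus_path n i js S \<kappa>)"
  using assms(2)
proof (induction js)
  case Nil
  show ?case using minus_path.Nil by blast
next
  case (Cons j js)
  then have j: "j \<in> {1..n}" by simp
  have z: "bullet n (x_op n (- 1) j) 0 = 0"
    unfolding x_op_VO(2)[OF j] by (rule bullet_zero) (simp_all add: Plat_uminus form_pm_simple_root[OF j])
  show ?case
  proof (cases "foldr (\<lambda>j. bullet n (x_op n (- 1) j)) js (Y_op n i) = 0")
    case True
    then show ?thesis using z by simp
  next
    case False
    moreover have "set js \<subseteq> {1..n}" using Cons.prems by simp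
    ultimately obtain S \<kappa> where p: "minus_path n i js S \<kappa>" using Cons.IH by blast
    have S: "S \<in> states n i" and f: "foldr (\<lambda>j. bullet n (x_op n (- 1) j)) js (Y_op n i) = VS n i S [] \<kappa>"
      using minus_path_props[OF p i] by auto
    show ?thesis
    proof (cases "j \<in> S \<and> Suc j \<notin> S")
      case True
      then show ?thesis using minus_path.Cons[OF p j] by blast
    next
      case False
      then show ?thesis using bullet_x_minus_zero[OF S i j False] f by simp
    qed
  qed
qed

text \<open>For a reachable state the choice is forced by \<open>minus_path_unique\<close>.\<close>

definition kap :: "nat \<Rightarrow> nat \<Rightarrow> nat set \<Rightarrow> scal" where
  "kap n i S = (SOME \<kappa>. \<exists>js. minus_path n i js S \<kappa>)"

lemma kap_path: "S \<in> states n i \<Longrightarrow> i \<in> {1..n} \<Longrightarrow> \<exists>js. minus_path n i js S (kap n i S)"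
  unfolding kap_def by (rule someI_ex) (use minus_path_ex in blast)

lemma kap_nonzero: "S \<in> states n i \<Longrightarrow> i \<in> {1..n} \<Longrightarrow> kap n i S \<noteq> 0"
  using kap_path minus_path_props by blast

lemma sg_0: "sg n i S w 0 = 1"
proof -
  have "(\<Prod>(j, t)\<leftarrow>w. qpow 0) = (1 :: scal)" by (induction w) auto
  then show ?thesis by (simp add: sg_def eps_def coord_def ysgn_def)
qed

text \<open>On the vacuum the coefficient of \<open>z^0\<close> is \<open>\<kappa>\<close>, whatever
  the other data are.\<close>

lemma VS_nonzero:
  assumes "\<kappa> \<noteq> 0" shows "VS n i S w \<kappa> \<noteq> 0"
proof
  assume z: "VS n i S w \<kappa> = 0"
  have vac: "vac \<in> Vsp n" unfolding vac_def by (rule Vsp_single) simp_all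
  have "tbound n 1 0" by (auto simp: tbound_def Tc_1)
  then have "Lc n u d 1 0 = 1" for u d by (simp add: Lc_tbound Hz_def Hc_0)
  then have "lookup (VS n i S w \<kappa> vac 0) (swt n S) = smK \<kappa> 1"
    unfolding VS_def by (subst lookup_VO[OF vac]) (simp add: VOc_def vac_def sg_0)
  then show False using assms unfolding z by (simp add: smK_eq_0_iff)
qed

lemma B_minus_eq:
  assumes i: "i \<in> {1..n}"
  shows "B_minus n i = {VS n i S [] (kap n i S) | S. S \<in> states n i}"
proof (intro equalityI subsetI)
  fix b assume "b \<in> B_minus n i"
  then obtain js where js: "set js \<subseteq> {1..n}" "b = foldr (\<lambda>j. bullet n (x_op n (- 1) j)) js (Y_op n i)" "b \<noteq> 0"
    by (auto simp: B_minus_def)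
  then obtain S \<kappa> where p: "minus_path n i js S \<kappa>" using minus_word[OF i js(1)] by auto
  then have S: "S \<in> states n i" "b = VS n i S [] \<kappa>" using minus_path_props[OF p i] js by auto
  obtain js' where "minus_path n i js' S (kap n i S)" using kap_path[OF S(1) i] by blast
  then have "\<kappa> = kap n i S" using minus_path_unique[OF i p] by blast
  then show "b \<in> {VS n i S [] (kap n i S) | S. S \<in> states n i}" using S by blast
next
  fix b assume "b \<in> {VS n i S [] (kap n i S) | S. S \<in> states n i}"
  then obtain S where S: "S \<in> states n i" "b = VS n i S [] (kap n i S)" by blast
  obtain js where "minus_path n i js S (kap n i S)" using kap_path[OF S(1) i] by blast
  from minus_path_props[OF this i] S VS_nonzero[of "kap n i S" n i S "[]"]
  show "b \<in> B_minus n i" by (auto simp: B_minus_def)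
qed

section \<open>Words in the operators \<open>\<psi>\<^sub>j\<close>\<close>

lemma sum_prod_list_mset:
  assumes "mset xs = mset ys"
  shows "sum_list (map f xs) = (sum_list (map f ys) :: 'a::comm_monoid_add)"
    and "prod_list (map g xs) = (prod_list (map g ys) :: 'b::comm_monoid_mult)"
proof -
  have "mset (map f xs) = mset (map f ys)" "mset (map g xs) = mset (map g ys)" using assms by simp_all
  then show "sum_list (map f xs) = sum_list (map f ys)" "prod_list (map g xs) = prod_list (map g ys)"
    by (simp_all only: sum_mset_sum_list[symmetric] prod_mset_prod_list[symmetric])
qed

text \<open>The letters \<open>\<psi>_j\<close> enter through one sum and one product only. Hence
  any word may be sorted into \<open>psi_words\<close>, and the reversal caused by
  \<open>foldl\<close> is harmless.\<close>

lemma VS_mset: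
  assumes "mset w = mset w'"
  shows "VS n i S w \<kappa> = VS n i S w' \<kappa>"
proof -
  have "pd w x = pd w' x" for x
    unfolding pd_def by (rule sum_prod_list_mset(1)[OF assms])
  moreover have "sg n i S w \<beta> = sg n i S w' \<beta>" for \<beta>
    unfolding sg_def by (simp only: sum_prod_list_mset(2)[OF assms])
  ultimately show ?thesis unfolding VS_def by (intro VO_cong) simp_all
qed

lemma ocomp_VS_psi:
  assumes j: "j \<in> {1..n}" and t: "2 * t \<in> \<int>"
  shows "ocomp (VS n i S w \<kappa>) (shift t (psi_op n j)) = VS n i S ((j, t) # w) \<kappa>"
proof -
  have s: "scaled t (\<lambda>_. 0) = (\<lambda>_. 0)" by (simp add: scaled_def fun_eq_iff)
  have "shift t (psi_op n j) = VO n (\<lambda>_. 0) (scaled (- t) (psid j)) 0 (\<lambda>\<beta>. qpow (t * form n 0 \<beta>) * qpow (form n (simple_root n j) \<beta>))"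
    unfolding psi_op_VO by (subst shift_VO[OF t]) (simp_all add: s)
  then have "ocomp (VS n i S w \<kappa>) (shift t (psi_op n j)) = VO n (su n i S) (sd n i S + pd w + scaled (- t) (psid j)) (swt n S)
      (\<lambda>\<beta>. \<kappa> * sg n i S w \<beta> * (qpow (t * form n 0 \<beta>) * qpow (form n (simple_root n j) \<beta>)))"
    unfolding VS_def by (simp only: ocomp_VO_vacuum[OF Plat_swt])
  also have "\<dots> = VS n i S ((j, t) # w) \<kappa>"
    unfolding VS_def
    by (rule VO_cong) (simp_all add: pd_Cons sg_Cons form_simple_root_left[OF j] add.assoc add.commute mult.assoc)
  finally show ?thesis .
qed

lemma foldl_ocomp_VS:
  assumes "psi_letters n w'"
  shows "foldl (\<lambda>c (j, t). ocomp c (shift t (psi_op n j))) (VS n i S w \<kappa>) w' = VS n i S (rev w' @ w) \<kappa>"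
  using assms
proof (induction w' arbitrary: w)
  case (Cons x w')
  then show ?case by (auto simp: psi_letters_def ocomp_VS_psi)
qed simp

lemma ex_sorted_wrt:
  assumes total: "\<And>x y. P x y \<or> P y x" and trans: "\<And>x y z. P x y \<Longrightarrow> P y z \<Longrightarrow> P x z"
  shows "\<exists>ys. mset ys = mset xs \<and> sorted_wrt P ys"
proof (induction xs)
  case (Cons x xs)
  then obtain ys where ys: "mset ys = mset xs" "sorted_wrt P ys" by blast
  define A B where "A = takeWhile (\<lambda>y. \<not> P x y) ys" and "B = dropWhile (\<lambda>y. \<not> P x y) ys"
  have AB: "ys = A @ B" by (simp add: A_def B_def)
  have A: "P a x" if "a \<in> set A" for a
    using that total[of a x] by (auto simp: A_def dest: set_takeWhileD)
  have B: "P x b" if "b \<in> set B" for b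
  proof -
    have "B \<noteq> []" using that by auto
    then have h: "P x (hd B)" unfolding B_def using hd_dropWhile[of "\<lambda>y. \<not> P x y" ys] by simp
    have "sorted_wrt P B" using ys(2) unfolding AB by (simp add: sorted_wrt_append)
    then have "b = hd B \<or> P (hd B) b" using that by (cases B) auto
    then show ?thesis using h trans[of x "hd B" b] by blast
  qed
  have "sorted_wrt P (A @ x # B)" using ys(2) A B unfolding AB by (auto simp: sorted_wrt_append)
  moreover have "mset (A @ x # B) = mset (x # xs)" using ys(1) unfolding AB by simp
  ultimately show ?case by blast
qed simp

lemma psi_words_letters: "w \<in> psi_words n \<Longrightarrow> psi_letters n w"
  by (auto simp: psi_words_def psi_letters_def)

lemma ex_psi_word:
  assumes "psi_letters n w"
  shows "\<exists>w'\<in>psi_words n. mset w' = mset w"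
proof -
  define P where "P x y \<longleftrightarrow> fst x < fst y \<or> fst x = fst y \<and> snd x \<le> snd y" for x y :: "nat \<times> rat"
  have "\<exists>w'. mset w' = mset w \<and> sorted_wrt P w'"
    by (rule ex_sorted_wrt) (auto simp: P_def)
  then obtain w' where w': "mset w' = mset w" "sorted_wrt P w'" by blast
  have q: "P x y \<Longrightarrow> fst x \<le> fst y \<and> (fst x = fst y \<longrightarrow> snd x \<le> snd y)" for x y
    by (auto simp: P_def)
  have "P (w' ! s) (w' ! r)" if "r < length w'" "s \<le> r" for r s
  proof (cases "s = r")
    case False
    then show ?thesis using w'(2) that unfolding sorted_wrt_iff_nth_less by simp
  qed (simp add: P_def)
  then have "fst (w' ! s) \<le> fst (w' ! r) \<and> (fst (w' ! s) = fst (w' ! r) \<longrightarrow> snd (w' ! s) \<le> snd (w' ! r))"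
    if "r < length w'" "s \<le> r" for r s
    using that q by blast
  moreover have "set w' = set w" using w'(1) by (rule mset_eq_setD)
  ultimately have "w' \<in> psi_words n" using assms by (auto simp: psi_words_def psi_letters_def)
  then show ?thesis using w'(1) by blast
qed

lemma B_minus_psi_eq:
  assumes i: "i \<in> {1..n}"
  shows "B_minus_psi n i = {VS n i S w (kap n i S) | S w. S \<in> states n i \<and> w \<in> psi_words n}"
proof -
  define F where "F = foldl (\<lambda>c (j, t). ocomp c (shift t (psi_op n j)))"
  have F: "F (VS n i S [] \<kappa>) w = VS n i S w \<kappa>" if "w \<in> psi_words n" for S w \<kappa>
    unfolding F_def foldl_ocomp_VS[OF psi_words_letters[OF that]] by (rule VS_mset) simp
  have "B_minus_psi n i = {F b w | b w. b \<in> B_minus n i \<and> w \<in> psi_words n}"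
    unfolding B_minus_psi_def F_def ..
  also have "\<dots> = {F (VS n i S [] (kap n i S)) w | S w. S \<in> states n i \<and> w \<in> psi_words n}"
    unfolding B_minus_eq[OF i] by blast
  also have "\<dots> = {VS n i S w (kap n i S) | S w. S \<in> states n i \<and> w \<in> psi_words n}"
    by (rule Collect_cong) (metis F)
  finally show ?thesis .
qed

section \<open>Linear independence\<close>

text \<open>Dedekind's argument: from the relation translated by \<open>m0\<close> subtract
  \<open>f x m0\<close> times the relation itself. This removes \<open>x\<close>, and the shorter
  relation has coefficients \<open>c z * (f z m0 - f x m0)\<close>.\<close>

lemma characters_independent:
  fixes f :: "'x \<Rightarrow> 'm \<Rightarrow> 'a::field"
  assumes "finite T"
    and hom: "\<And>x m m'. x \<in> T \<Longrightarrow> m \<in> M \<Longrightarrow> m' \<in> M \<Longrightarrow> f x (opr m m') = f x m * f x m'"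
    and cl: "\<And>m m'. m \<in> M \<Longrightarrow> m' \<in> M \<Longrightarrow> opr m m' \<in> M"
    and e: "e \<in> M" "\<And>x. x \<in> T \<Longrightarrow> f x e = 1"
    and inj: "\<And>x y. x \<in> T \<Longrightarrow> y \<in> T \<Longrightarrow> x \<noteq> y \<Longrightarrow> \<exists>m\<in>M. f x m \<noteq> f y m"
    and zero: "\<And>m. m \<in> M \<Longrightarrow> (\<Sum>x\<in>T. c x * f x m) = 0"
  shows "\<forall>x\<in>T. c x = 0"
  using assms(1) hom e(2) inj zero
proof (induction T arbitrary: c rule: finite_induct)
  case (insert x T)
  have T0: "c z * (f z m0 - f x m0) = 0" if "z \<in> T" "m0 \<in> M" for z m0
  proof -
    have "(\<Sum>z\<in>T. (c z * (f z m0 - f x m0)) * f z m) = 0" if m: "m \<in> M" for m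
    proof -
      have "(\<Sum>z\<in>insert x T. c z * f z (opr m0 m)) - f x m0 * (\<Sum>z\<in>insert x T. c z * f z m) = 0"
        using insert.prems(4)[OF m] insert.prems(4)[OF cl[OF \<open>m0 \<in> M\<close> m]] by simp
      moreover have "(\<Sum>z\<in>insert x T. c z * f z (opr m0 m)) - f x m0 * (\<Sum>z\<in>insert x T. c z * f z m)
         = (\<Sum>z\<in>insert x T. (c z * (f z m0 - f x m0)) * f z m)"
        unfolding sum_distrib_left sum_subtractf[symmetric]
        using insert.prems(1) \<open>m0 \<in> M\<close> m by (intro sum.cong refl) (simp add: algebra_simps)
      ultimately show ?thesis using insert.hyps by simp
    qed
    then have "\<forall>z\<in>T. c z * (f z m0 - f x m0) = 0"
      using insert.prems(1-3) by (intro insert.IH) auto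
    then show ?thesis using that(1) by blast
  qed
  have cT: "c z = 0" if z: "z \<in> T" for z
  proof -
    have "x \<noteq> z" using z insert.hyps by auto
    then obtain m0 where "m0 \<in> M" "f z m0 \<noteq> f x m0" using insert.prems(3)[of z x] z by auto
    then show ?thesis using T0[OF z] by force
  qed
  have "c x = 0" using insert.prems(4)[OF e(1)] insert.hyps cT insert.prems(2)[of x] by simp
  then show ?case using cT by simp
qed simp

lemma lookup_mult_0: "lookup (p * q) 0 = lookup p 0 * lookup (q :: fock) 0"
proof (induction p rule: fock_induct)
  case (add p p')
  then show ?case by (simp add: distrib_right lookup_add)
next
  case (scale c p)
  then show ?case by (simp add: smK_mult lookup_smK)
next
  case one
  then show ?case by (simp add: lookup_one)
next
  case (var x p)
  then show ?case by (simp add: mult.assoc lookup_var_mult)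
qed

lemma lookup_Hc_0: "lookup (Hc n u m) 0 = (if m = 0 then 1 else 0)"
proof (cases "m = 0")
  case False
  have "lookup (var x) 0 = 0" for x
    using lookup_var_mult[of x 1 0] by simp
  then have U: "lookup (Up n u r) 0 = 0" for r
    by (simp add: Up_def lookup_sum lookup_smK)
  have "smK (of_nat m) (Hc n u m) = (\<Sum>r=1..m. smK (of_nat r) (Up n u r * Hc n u (m - r)))"
    using Hc_rec[of m n u] by (simp only: smK_of_nat)
  then have "lookup (smK (of_nat m) (Hc n u m)) 0 = 0"
    by (simp add: lookup_sum lookup_smK lookup_mult_0 U)
  then show ?thesis using False by (simp add: lookup_smK)
qed (simp add: Hc_0)

text \<open>The constant term of \<open>p(a\<^sub>i(-r) + d(i,r) z\<^bsup>-r\<^esup>)\<close> at \<open>z = 1\<close>\<close>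

definition ev :: "nat \<Rightarrow> (nat \<times> nat \<Rightarrow> scal) \<Rightarrow> fock \<Rightarrow> scal" where
  "ev n d p = Sum_any (\<lambda>l. lookup (Tc n d l p) 0)"

lemma ev_eq: "tbound n p B \<Longrightarrow> ev n d p = (\<Sum>l\<le>B. lookup (Tc n d l p) 0)"
  unfolding ev_def
proof (rule Sum_any.expand_superset)
  assume B: "tbound n p B"
  show "{l. lookup (Tc n d l p) 0 \<noteq> 0} \<subseteq> {..B}"
  proof
    fix l assume "l \<in> {l. lookup (Tc n d l p) 0 \<noteq> 0}"
    then have "Tc n d l p \<noteq> 0" by auto
    then show "l \<in> {..B}" using tbound_Tc[OF B] by (meson atMost_iff not_le)
  qed
qed simp

lemma ev_1: "ev n d 1 = 1"
proof -
  have "tbound n 1 0" by (auto simp: tbound_def Tc_1)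
  then show ?thesis by (simp add: ev_eq)
qed

lemma ev_var: "ev n d (var x) = var_coeff n d x"
proof -
  obtain B where B: "tbound n (var x) B" using tbound_ex by blast
  then have B': "tbound n (var x) (max B (snd x))" by (rule tbound_mono) simp
  have v: "lookup (var x) 0 = 0" using lookup_var_mult[of x 1 0] by simp
  have T: "Tc n d l (var x) = (if l = 0 then var x else 0) + (if l = snd x then smK (var_coeff n d x) 1 else 0)" for l
    using Tc_var[of n d l x 1] by (auto simp: Tc_1)
  have "ev n d (var x) = (\<Sum>l\<le>max B (snd x). if l = snd x then var_coeff n d x else 0)"
    unfolding ev_eq[OF B'] by (intro sum.cong refl) (simp add: T lookup_add v lookup_smK)
  then show ?thesis by simp
qed

text \<open>A multiplicative shift, followed by the multiplicative constant term, summed over all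
  powers of \<open>z\<close>; the summation is finite by \<open>tbound\<close>.\<close>

lemma ev_mult: "ev n d (p * q) = ev n d p * ev n d q"
proof -
  obtain B1 B2 B3 where B: "tbound n p B1" "tbound n q B2" "tbound n (p * q) B3" using tbound_ex by blast
  define B0 where "B0 = max (max B1 B2) B3"
  have b: "tbound n p B0" "tbound n q B0" "tbound n (p * q) (2 * B0)"
    using B by (auto elim!: tbound_mono simp: B0_def)
  have z: "Tc n d l p = 0" "Tc n d l q = 0" if "l > B0" for l
    using tbound_Tc[OF b(1) that] tbound_Tc[OF b(2) that] by auto
  have "ev n d p * ev n d q = (\<Sum>l\<le>B0. \<Sum>l'\<le>B0. lookup (Tc n d l p) 0 * lookup (Tc n d l' q) 0)"
    unfolding ev_eq[OF b(1)] ev_eq[OF b(2)] by (rule sum_product)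
  also have "\<dots> = (\<Sum>m\<le>2 * B0. \<Sum>l\<le>m. lookup (Tc n d l p) 0 * lookup (Tc n d (m - l) q) 0)"
    by (rule sum_conv_square) (auto simp: z)
  also have "\<dots> = ev n d (p * q)"
    unfolding ev_eq[OF b(3)] by (simp add: Tc_mult lookup_sum lookup_mult_0)
  finally show ?thesis ..
qed

text \<open>The constant term of the creating exponential is 1, so only the shift remains
  visible.\<close>

lemma lookup_Lc_0:
  "lookup (Lc n u d p (- int l)) 0 = lookup (Tc n d l p) 0"
proof -
  obtain B where "tbound n p B" using tbound_ex by blast
  then have B: "tbound n p (max B l)" by (rule tbound_mono) simp
  have "lookup (Lc n u d p (- int l)) 0 = (\<Sum>k\<le>max B l. if k = l then lookup (Tc n d l p) 0 else 0)"
    unfolding Lc_tbound[OF B] lookup_sum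
    by (intro sum.cong refl) (auto simp: lookup_mult_0 Hz_def lookup_Hc_0)
  then show ?thesis by simp
qed

lemma ysgn_add: "ysgn n i (\<beta> + \<beta>') = ysgn n i \<beta> * ysgn n i \<beta>'"
proof -
  have cm: "cst (x * y) = cst x * cst y" for x y by (simp add: cst_def flip: to_fract_mult)
  show ?thesis
    unfolding ysgn_def cm[symmetric] exp_add[symmetric]
    by (simp add: form_add_right of_rat_add distrib_left)
qed

lemma sg_add: "sg n i S w (\<beta> + \<beta>') = sg n i S w \<beta> * sg n i S w \<beta>'"
proof -
  have q: "qpow (- of_int h * of_int (x + y)) = qpow (- of_int h * of_int x) * qpow (- of_int h * of_int y)" for h x y :: int
  proof -
    have "2 * (- of_int h * of_int x :: rat) \<in> \<int>" by (intro Ints_mult Ints_minus) auto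
    then show ?thesis by (simp add: distrib_left qpow_add flip: qpow_add)
  qed
  have "(\<Prod>(j, t)\<leftarrow>w. qpow (of_int (lookup (\<beta> + \<beta>') j)))
     = (\<Prod>(j, t)\<leftarrow>w. qpow (of_int (lookup \<beta> j))) * (\<Prod>(j, t)\<leftarrow>w. qpow (of_int (lookup \<beta>' j)))"
    by (induction w) (auto simp: lookup_add qpow_add mult_ac)
  then show ?thesis
    unfolding sg_def lookup_add q eps_add_right ysgn_add prod.distrib by (simp add: mult_ac lookup_add)
qed

text \<open>Equal weights make the difference of the two indicator functions constant on
  \<open>{1..Suc n}\<close>; equal cardinalities make this constant 0.\<close>

lemma swt_inject:
  assumes S: "S \<in> states n i" "T \<in> states n i" and eq: "swt n S = swt n T"
  shows "S = T"
proof -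
  define f where "f j = of_bool (j \<in> S) - (of_bool (j \<in> T) :: int)" for j
  have "f j = f (Suc j)" if "j \<in> {1..n}" for j
    using arg_cong[OF eq, of "\<lambda>w. lookup w j"] that by (simp add: lookup_swt pairing_def f_def)
  then have c: "f (Suc j) = f 1" if "j \<le> n" for j
    using that
  proof (induction j)
    case (Suc j)
    then show ?case by simp
  qed simp
  have card: "(\<Sum>j\<in>{1..Suc n}. of_bool (j \<in> S)) = int i" if "S \<in> states n i" for S
  proof -
    have "(\<Sum>j\<in>{1..Suc n}. of_bool (j \<in> S)) = (\<Sum>j\<in>S. 1 :: int)"
      by (rule sum.mono_neutral_cong_right) (use that in \<open>auto simp: states_def\<close>)
    then show ?thesis using that by (simp add: states_def)
  qed
  have "(\<Sum>j\<in>{1..Suc n}. f j) = 0" unfolding f_def sum_subtractf card[OF S(1)] card[OF S(2)] by simp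
  moreover have "(\<Sum>j\<in>{1..Suc n}. f j) = (\<Sum>j\<in>{1..Suc n}. f 1)"
  proof (intro sum.cong refl)
    fix j assume "j \<in> {1..Suc n}"
    then show "f j = f 1" using c[of "j - 1"] by (cases j) auto
  qed
  ultimately have "f 1 = 0" by (simp del: sum.cl_ivl_Suc)
  have "j \<in> S \<longleftrightarrow> j \<in> T" if "j \<in> {1..Suc n}" for j
    using c[of "j - 1"] \<open>f 1 = 0\<close> that by (cases j) (auto simp: f_def of_bool_def split: if_splits)
  then show ?thesis using S by (auto simp: states_def)
qed

lemma VS_independent:
  assumes i: "i \<in> {1..n}"
  shows "oper.independent (B_minus_psi n i)"
  unfolding oper.independent_explicit_finite_subsets
proof (intro allI impI ballI)
  fix A u b0
  assume A: "A \<subseteq> B_minus_psi n i" "finite A" and zero: "(\<Sum>b\<in>A. smO (u b) b) = 0" and b0: "b0 \<in> A"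
  have "\<forall>b\<in>A. \<exists>S w. S \<in> states n i \<and> b = VS n i S w (kap n i S)"
    using A(1) unfolding B_minus_psi_eq[OF i] by blast
  then obtain st wd where st: "\<And>b. b \<in> A \<Longrightarrow> st b \<in> states n i"
    and b: "\<And>b. b \<in> A \<Longrightarrow> b = VS n i (st b) (wd b) (kap n i (st b))" by metis
  define S0 where "S0 = st b0"
  define A0 where "A0 = {b\<in>A. st b = S0}"
  define D where "D b = sd n i (st b) + pd (wd b)" for b
  define f where "f b m = ev n (D b) (single (fst m) 1) * sg n i (st b) (wd b) (snd m)"
    for b and m :: "((nat \<times> nat) \<Rightarrow>\<^sub>0 nat) \<times> weight"
  have "\<forall>b\<in>A0. u b * kap n i S0 = 0"
  proof (rule characters_independent[where f = f and M = "Mon n \<times> Plat n" and e = "(0, 0)"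
        and opr = "\<lambda>m m'. (fst m + fst m', snd m + snd m')"])
    show "finite A0" using A(2) by (simp add: A0_def)
    show "f x (fst m + fst m', snd m + snd m') = f x m * f x m'" for x m m'
    proof -
      have "single (fst m + fst m') 1 = (single (fst m) 1 * single (fst m') 1 :: fock)"
        by (simp add: mult_single)
      then show ?thesis by (simp add: f_def sg_add ev_mult mult_ac)
    qed
    show "(fst m + fst m', snd m + snd m') \<in> Mon n \<times> Plat n" if "m \<in> Mon n \<times> Plat n" "m' \<in> Mon n \<times> Plat n" for m m'
      using that by (auto intro: Mon_add Plat_add)
    show "(0, 0) \<in> Mon n \<times> Plat n" by simp
    show "f x (0, 0) = 1" for x by (simp add: f_def ev_1 sg_0)
    show "\<exists>m\<in>Mon n \<times> Plat n. f x m \<noteq> f y m" if "x \<in> A0" "y \<in> A0" "x \<noteq> y" for x y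
    \<comment> \<open>Equal characters would mean equal operators: the shift is recovered from the
      values at single variables, the character of \<open>P\<close> from those at the trivial
      monomial.\<close>
    proof (rule ccontr)
      assume "\<not> ?thesis"
      then have fe: "f x (\<mu>, \<beta>) = f y (\<mu>, \<beta>)" if "\<mu> \<in> Mon n" "\<beta> \<in> Plat n" for \<mu> \<beta>
        using that by auto
      have s: "st x = S0" "st y = S0" "x \<in> A" "y \<in> A" using that by (auto simp: A0_def)
      have d: "D x (k, r) = D y (k, r)" if kr: "k \<in> {1..n}" "r > 0" for k r
      proof -
        have "single (k, r) (1::nat) \<in> Mon n" using kr by (auto simp: Mon_def)
        then have "ev n (D x) (var (k, r)) = ev n (D y) (var (k, r))"
          using fe[of "single (k, r) 1" 0] by (simp add: f_def sg_0 var_def)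
        then show ?thesis using kr by (simp add: ev_var var_coeff_def)
      qed
      have g: "sg n i S0 (wd x) \<beta> = sg n i S0 (wd y) \<beta>" if "\<beta> \<in> Plat n" for \<beta>
        using fe[OF Mon_0 that] s by (simp add: f_def ev_1)
      have "x = VO n (su n i S0) (D x) (swt n S0) (\<lambda>\<beta>. kap n i S0 * sg n i S0 (wd x) \<beta>)"
        using b[OF s(3)] unfolding VS_def D_def s by simp
      also have "\<dots> = VO n (su n i S0) (D y) (swt n S0) (\<lambda>\<beta>. kap n i S0 * sg n i S0 (wd y) \<beta>)"
        by (rule VO_cong) (simp_all add: d g)
      also have "\<dots> = y" using b[OF s(4)] unfolding VS_def D_def s by simp
      finally show False using that by simp
    qed
    show "(\<Sum>x\<in>A0. u x * kap n i S0 * f x m) = 0" if mm: "m \<in> Mon n \<times> Plat n" for m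
    proof -
      obtain \<mu> \<beta> where m: "m = (\<mu>, \<beta>)" "\<mu> \<in> Mon n" "\<beta> \<in> Plat n" using mm by (cases m) auto
      let ?p = "single \<mu> 1 :: fock"
      obtain B where B: "tbound n ?p B" using tbound_ex by blast
      define v where "v = single \<beta> ?p"
      have v: "v \<in> Vsp n" unfolding v_def using m by (intro Vsp_single) (simp_all add: Fk_def)
      have l: "(\<Sum>x\<in>A0. u x * kap n i S0 * (lookup (Tc n (D x) l ?p) 0 * sg n i S0 (wd x) \<beta>)) = 0" for l
      proof -
        \<comment> \<open>The exponent at which an operator with state \<open>S0\<close>, applied to
          \<open>v\<close>, shows the shift of order \<open>l\<close>.\<close>
        define s where "s = form n (swt n S0) \<beta> - of_nat l"
        have "lookup (lookup ((\<Sum>b\<in>A. smO (u b) b) v s) (swt n S0 + \<beta>)) 0 = 0"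
          unfolding zero by simp
        moreover have "(\<Sum>b\<in>A'. smO (u b) b) v s = (\<Sum>b\<in>A'. smV (u b) (b v s))" for A'
          by (induction A' rule: infinite_finite_induct) (auto simp: smO_def)
        ultimately have "0 = (\<Sum>b\<in>A. u b * lookup (lookup (b v s) (swt n S0 + \<beta>)) 0)"
          by (simp add: lookup_sum lookup_smV lookup_smK)
        also have "\<dots> = (\<Sum>b\<in>A0. u b * lookup (lookup (b v s) (swt n S0 + \<beta>)) 0)"
        proof (rule sum.mono_neutral_right)
          show "\<forall>b\<in>A - A0. u b * lookup (lookup (b v s) (swt n S0 + \<beta>)) 0 = 0"
          proof
            fix b' assume b': "b' \<in> A - A0"
            then have "st b' \<noteq> S0" by (auto simp: A0_def)
            \<comment> \<open>Operators with another state map \<open>v\<close> into another weight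
              space and drop out.\<close>
            then have "swt n (st b') \<noteq> swt n S0" using swt_inject[of "st b'" n i S0] st b' b0 by (auto simp: S0_def)
            then have ne: "swt n S0 + \<beta> - swt n (st b') \<noteq> \<beta>" by (auto simp: algebra_simps)
            have "lookup (b' v s) (swt n S0 + \<beta>)
              = lookup (VS n i (st b') (wd b') (kap n i (st b')) v s) (swt n S0 + \<beta>)"
              using b[of b'] b' by simp
            also have "\<dots> = 0" unfolding VS_def lookup_VO[OF v] using ne by (auto simp: v_def lookup_single when_def)
            finally show "u b' * lookup (lookup (b' v s) (swt n S0 + \<beta>)) 0 = 0" by simp
          qed
        qed (use A in \<open>auto simp: A0_def\<close>)
        also have "\<dots> = (\<Sum>x\<in>A0. u x * kap n i S0 * (lookup (Tc n (D x) l ?p) 0 * sg n i S0 (wd x) \<beta>))"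
        proof (intro sum.cong refl)
          fix x assume "x \<in> A0"
          then have x: "st x = S0" "x \<in> A" by (auto simp: A0_def)
          have fl: "\<lfloor>- (of_nat l :: rat)\<rfloor> = - int l" by (metis floor_of_int of_int_minus of_int_of_nat_eq)
          have "lookup (x v s) (swt n S0 + \<beta>)
            = lookup (VS n i S0 (wd x) (kap n i S0) v s) (swt n S0 + \<beta>)"
            using b[OF x(2)] x by simp
          also have "\<dots> = smK (kap n i S0 * sg n i S0 (wd x) \<beta>) (Lc n (su n i S0) (D x) ?p (- int l))"
            unfolding VS_def lookup_VO[OF v] by (simp add: VOc_def s_def v_def fl D_def x)
          finally show "u x * lookup (lookup (x v s) (swt n S0 + \<beta>)) 0
            = u x * kap n i S0 * (lookup (Tc n (D x) l ?p) 0 * sg n i S0 (wd x) \<beta>)"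
            by (simp add: lookup_smK lookup_Lc_0)
        qed
        finally show ?thesis by simp
      qed
      have "(\<Sum>x\<in>A0. u x * kap n i S0 * f x m)
        = (\<Sum>x\<in>A0. \<Sum>l\<le>B. u x * kap n i S0 * (lookup (Tc n (D x) l ?p) 0 * sg n i S0 (wd x) \<beta>))"
        by (intro sum.cong refl) (simp add: f_def m ev_eq[OF B] A0_def sum_distrib_left sum_distrib_right)
      also have "\<dots> = 0" by (subst sum.swap) (simp add: l)
      finally show ?thesis .
    qed
  qed
  moreover have "b0 \<in> A0" using b0 by (simp add: A0_def S0_def)
  moreover have "kap n i S0 \<noteq> 0" using kap_nonzero st b0 i by (simp add: S0_def)
  ultimately show "u b0 = 0" by auto
qed

theorem theorem2p16:
  fixes n i :: nat
  assumes "n \<ge> 1" and "i \<in> {1..n}"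
  shows "oper.independent (B_minus_psi n i \<inter> Y_space n i) \<and>
         oper.span (B_minus_psi n i \<inter> Y_space n i) = Y_space n i"
proof
  let ?B = "B_minus_psi n i" and ?Y = "Y_space n i"
  show "oper.independent (?B \<inter> ?Y)"
    using VS_independent[OF assms(2)] by (rule oper.independent_mono) simp
  have sub: "oper.subspace ?Y" unfolding Y_space_def by (rule oper.subspace_span)
  show "oper.span (?B \<inter> ?Y) = ?Y"
  proof
    show "oper.span (?B \<inter> ?Y) \<subseteq> ?Y" using sub by (intro oper.span_minimal) auto
    show "?Y \<subseteq> oper.span (?B \<inter> ?Y)"
      unfolding Y_space_def[of n i, THEN eq_reflection]
    proof (rule oper.span_minimal)
      show "oper.subspace (oper.span (?B \<inter> oper.span {foldr (bullet n) as (Y_op n i) | as. set as \<subseteq> gens n}))"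
        by (rule oper.subspace_span)
      show "{foldr (bullet n) as (Y_op n i) | as. set as \<subseteq> gens n}
         \<subseteq> oper.span (?B \<inter> oper.span {foldr (bullet n) as (Y_op n i) | as. set as \<subseteq> gens n})"
      proof
        fix y assume y: "y \<in> {foldr (bullet n) as (Y_op n i) | as. set as \<subseteq> gens n}"
        then obtain S w \<kappa> where S: "S \<in> states n i" "psi_letters n w" "y = VS n i S w \<kappa>"
          using foldr_bullet_gens[OF assms(2)] by blast
        obtain w' where w': "w' \<in> psi_words n" "mset w' = mset w" using ex_psi_word[OF S(2)] by blast
        define e where "e = VS n i S w' (kap n i S)"
        have k: "kap n i S \<noteq> 0" by (rule kap_nonzero[OF S(1) assms(2)])
        have sc: "smO c (VS n i S w' \<kappa>') = VS n i S w' (c * \<kappa>')" for c \<kappa>'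
          by (simp add: VS_def smO_VO mult.assoc)
        have yw: "y = VS n i S w' \<kappa>" using S(3) VS_mset[OF w'(2)] by simp
        have y_e: "y = smO (\<kappa> / kap n i S) e" unfolding e_def sc yw using k by simp
        show "y \<in> oper.span (?B \<inter> oper.span {foldr (bullet n) as (Y_op n i) | as. set as \<subseteq> gens n})"
        proof (cases "\<kappa> = 0")
          case True
          then show ?thesis using yw by (simp add: VS_0 oper.span_zero)
        next
          case False
          \<comment> \<open>The multiple can be inverted, so the basis candidate \<open>e\<close>
            lies in the space as well; this is what membership in the intersection requires.\<close>
          have "e = smO (kap n i S / \<kappa>) y" unfolding e_def yw sc using False by simp
          then have "e \<in> oper.span {foldr (bullet n) as (Y_op n i) | as. set as \<subseteq> gens n}"
            using oper.span_scale[OF oper.span_base[OF y]] by simp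
          moreover have "e \<in> ?B" unfolding B_minus_psi_eq[OF assms(2)] e_def using S(1) w'(1) by blast
          ultimately show ?thesis unfolding y_e by (intro oper.span_scale oper.span_base) simp
        qed
      qed
    qed
  qed
qed

end
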